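(* Let $p\in(0,1)$ and assume that $\tilde\alpha,\tilde\beta$ are positive constants (depending on $p$) with the following property: for any non-negative adapted continuous process $(X_t)_{t\ge0}$ which satisfies $$X_t\le\int_0^tX_s^*\,ds+M_t+H\qquad\forall t\ge0$$ for some continuous local martingale $(M_t)_{t\ge0}$ starting in $0$ and some constant $H>0$, we have for all $t\ge0$ $$\|X_t^*\|_p\le\tilde\alpha\,H\exp(\tilde\beta t).$$ Then $\tilde\beta\ge(1-p)^{-1}$.
   Context: Processes are defined on filtered probability spaces satisfying the usual conditions. $X_t^*:=\sup_{0\le s\le t}X_s$ denotes the running supremum, and $\|Y\|_p:=\mathbb E[|Y|^p]^{1/p}$ for a random variable $Y$. *)

theory Defs
  imports "HOL-Probability.Probability"
begin

text \<open>
  Time runs through \<open>[0,\<infinity>]\<close>, rendered by \<^typ>\<open>ennreal\<close>, so that the library notion of a stopping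
  time applies directly to stopping times with values in \<open>[0,\<infinity>]\<close>. The \<open>\<sigma>\<close>-algebra at time
  \<open>\<infinity>\<close> is only required to lie between all the earlier ones and the one of \<open>P\<close>. Processes are
  functions \<open>real \<Rightarrow> 'a \<Rightarrow> real\<close> whose values at negative times are never used.
\<close>

locale usual_filtered_prob_space = prob_space P + complete_measure P + filtration "space P" F
  for P :: "'a measure" and F :: "ennreal \<Rightarrow> 'a measure" +
  assumes sets_F_subset: "sets (F t) \<subseteq> sets P"
    and null_sets_F: "null_sets P \<subseteq> sets (F 0)"
    and right_continuous_F: "t < \<infinity> \<Longrightarrow> sets (F t) = (\<Inter>s\<in>{t<..}. sets (F s))"

definition adapted :: "(ennreal \<Rightarrow> 'a measure) \<Rightarrow> (real \<Rightarrow> 'a \<Rightarrow> real) \<Rightarrow> bool" where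
  "adapted F X \<longleftrightarrow> (\<forall>t\<ge>0. X t \<in> borel_measurable (F (ennreal t)))"

definition continuous_process :: "'a measure \<Rightarrow> (real \<Rightarrow> 'a \<Rightarrow> real) \<Rightarrow> bool" where
  "continuous_process P X \<longleftrightarrow> (\<forall>\<omega>\<in>space P. continuous_on {0..} (\<lambda>t. X t \<omega>))"

definition martingale ::
    "'a measure \<Rightarrow> (ennreal \<Rightarrow> 'a measure) \<Rightarrow> (real \<Rightarrow> 'a \<Rightarrow> real) \<Rightarrow> bool" where
  "martingale P F X \<longleftrightarrow> adapted F X \<and> (\<forall>t\<ge>0. integrable P (X t)) \<and>
     (\<forall>s t. 0 \<le> s \<and> s \<le> t \<longrightarrow> (AE \<omega> in P. real_cond_exp P (F (ennreal s)) (X t) \<omega> = X s \<omega>))"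

definition stopped :: "(real \<Rightarrow> 'a \<Rightarrow> real) \<Rightarrow> ('a \<Rightarrow> ennreal) \<Rightarrow> real \<Rightarrow> 'a \<Rightarrow> real" where
  "stopped X \<tau> t \<omega> = X (enn2real (min (ennreal t) (\<tau> \<omega>))) \<omega>"

definition local_martingale ::
    "'a measure \<Rightarrow> (ennreal \<Rightarrow> 'a measure) \<Rightarrow> (real \<Rightarrow> 'a \<Rightarrow> real) \<Rightarrow> bool" where
  "local_martingale P F X \<longleftrightarrow> adapted F X \<and>
     (\<exists>\<tau> :: nat \<Rightarrow> 'a \<Rightarrow> ennreal.
        (\<forall>n. stopping_time F (\<tau> n)) \<and>
        (AE \<omega> in P. incseq (\<lambda>n. \<tau> n \<omega>) \<and> (\<lambda>n. \<tau> n \<omega>) \<longlonglongrightarrow> \<infinity>) \<and>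
        (\<forall>n. martingale P F (\<lambda>t \<omega>. stopped X (\<tau> n) t \<omega> - X 0 \<omega>)))"

definition running_sup :: "(real \<Rightarrow> 'a \<Rightarrow> real) \<Rightarrow> real \<Rightarrow> 'a \<Rightarrow> real" where
  "running_sup X t \<omega> = (SUP s\<in>{0..t}. X s \<omega>)"

text \<open>
  \<open>\<parallel>Y\<parallel>\<^sub>p = E[|Y|\<^sup>p]\<^sup>1\<^sup>/\<^sup>p\<close> for \<open>p > 0\<close>, with the value \<open>\<infinity>\<close> when the expectation is infinite.
\<close>

definition p_norm :: "'a measure \<Rightarrow> real \<Rightarrow> ('a \<Rightarrow> real) \<Rightarrow> ennreal" where
  "p_norm P p Y =
     (let I = \<integral>\<^sup>+ \<omega>. ennreal (\<bar>Y \<omega>\<bar> powr p) \<partial>P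
      in if I = \<infinity> then \<infinity> else ennreal (enn2real I powr (1 / p)))"

text \<open>
  Since types cannot be quantified inside a formula, the sample spaces in the theorem are taken to be
  (arbitrary) sets of real sequences. This loses nothing: a pair of continuous processes is
  determined by its values at rational times.
\<close>

type_synonym sample = "nat \<Rightarrow> real"

end

theory Submission
  imports Defs
begin

text \<open>
  A process of the required kind can grow as follows. Wait for a time \<open>h\<close> at the current maximum \<open>S\<close>: the
  drift provides a capital \<open>h S\<close>. Then, almost instantaneously, use \<open>M\<close> to gamble with this capital:
  multiply it by \<open>1 / q\<close> with probability \<open>q\<close>, lose it otherwise, and repeat this \<open>m\<close> times while it lasts. For
  \<open>q \<rightarrow> 1\<close> the capital exceeds \<open>z S\<close> with probability about \<open>h / z\<close>, hence \<open>E[S\<^sup>p]\<close> grows at the rate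
  \<open>\<integral>\<^sub>1\<^sup>\<infinity> (z\<^sup>p - 1) z\<^sup>-\<^sup>2 dz = p / (1 - p)\<close>, and \<open>\<parallel>S\<parallel>\<^sub>p\<close> at the rate \<open>1 / (1 - p)\<close>.

  A single bet is a continuous martingale with values in \<open>[0, 1]\<close> going from \<open>q\<close> to \<open>{0, 1}\<close> in one unit of
  time, namely \<open>N\<^sub>t = P(B\<^sub>1 > c | \<F>\<^sub>t) = \<Phi>((B\<^sub>t - c) / sqrt (1 - t))\<close> for a Brownian motion \<open>B\<close>, which is
  constructed by successive midpoint displacement from independent Gaussian variables.
\<close>

section \<open>Rotation invariance of Gaussian sequences\<close>

text \<open>Gambling a capital \<open>x\<close> until ruin in a fair continuous game lifts it above
  \<open>z * S\<close> with probability \<open>x / (z * S)\<close>. Hence the final maximum has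
  expected \<open>p\<close>-th power \<open>S powr p + p / (1 - p) * (x * S powr (p - 1))\<close>,
  and this value function is the origin of \<open>energy\<close>. Discrete bets fall slightly short
  of it. The loss is absorbed by a constant \<open>\<kappa>\<close> below
  \<open>p / (1 - p)\<close>, and \<open>q\<close> is then fixed in terms of
  \<open>\<kappa>\<close>.

  The unknown factor \<open>\<alpha>\<close> makes any bounded number of periods useless:
  \<open>k\<close> periods are played, and only the growth factor per period survives as
  \<open>k\<close> grows. Many bets per period are needed to exhaust the capital, yet each of them
  takes time. Therefore bets and waiting are cut into slots of one length \<open>d\<close>, with
  \<open>W\<close> waiting slots and \<open>m\<close> bets per period, and \<open>W\<close> grows
  while \<open>m\<close> and the waiting time stay fixed.

  The true running maximum is replaced by its values at the ends of slots, \<open>peak\<close>.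
  Being a lower bound, this suffices both for the drift and for the moments, and it keeps the
  process an explicit finite sum.\<close>

lemma std_normal_density_rot45:
  "std_normal_density ((u + v) / sqrt 2) * std_normal_density ((u - v) / sqrt 2) =
     std_normal_density u * std_normal_density v"
proof -
  have "((u + v) / sqrt 2)\<^sup>2 + ((u - v) / sqrt 2)\<^sup>2 = u\<^sup>2 + v\<^sup>2"
    by (simp add: power_divide power2_eq_square field_simps)
  then have "- ((u + v) / sqrt 2)\<^sup>2 / 2 + - ((u - v) / sqrt 2)\<^sup>2 / 2 = - u\<^sup>2 / 2 + - v\<^sup>2 / 2"
    by argo
  then have "exp (- ((u + v) / sqrt 2)\<^sup>2 / 2) * exp (- ((u - v) / sqrt 2)\<^sup>2 / 2) =
      exp (- u\<^sup>2 / 2) * exp (- v\<^sup>2 / 2)"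
    unfolding exp_add[symmetric] by simp
  then show ?thesis
    by (simp add: std_normal_density_def field_simps)
qed

definition rot45 :: "real \<times> real \<Rightarrow> real \<times> real" where
  "rot45 z = ((fst z + snd z) / sqrt 2, (fst z - snd z) / sqrt 2)"

lemma measurable_rot45 [measurable]: "rot45 \<in> borel \<Otimes>\<^sub>M borel \<rightarrow>\<^sub>M borel \<Otimes>\<^sub>M borel"
  unfolding rot45_def by measurable

text \<open>The planar substitution is split into two affine ones on the line with Tonelli in
  between: \<open>x = sqrt 2 * u - y\<close> for fixed \<open>y\<close>, then
  \<open>y = (u - v) / sqrt 2\<close> for fixed \<open>u\<close>. Their factors
  \<open>sqrt 2\<close> and \<open>1 / sqrt 2\<close> cancel, as they must for an isometry.\<close>

lemma nn_integral_rot45: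
  assumes [measurable]: "f \<in> borel_measurable (borel \<Otimes>\<^sub>M borel)"
  shows "(\<integral>\<^sup>+y. \<integral>\<^sup>+x. f (rot45 (x, y)) * ennreal (std_normal_density x) \<partial>lborel * ennreal (std_normal_density y) \<partial>lborel) =
    (\<integral>\<^sup>+u. \<integral>\<^sup>+v. f (u, v) * ennreal (std_normal_density v) \<partial>lborel * ennreal (std_normal_density u) \<partial>lborel)"
proof -
  let ?p = "\<lambda>x. ennreal (std_normal_density x)"
  have s2: "sqrt 2 * sqrt 2 = (2::real)" by simp
  have "(\<integral>\<^sup>+y. \<integral>\<^sup>+x. f (rot45 (x, y)) * ?p x \<partial>lborel * ?p y \<partial>lborel) =
    (\<integral>\<^sup>+y. (sqrt 2 * (\<integral>\<^sup>+u. f (rot45 (- y + sqrt 2 * u, y)) * ?p (- y + sqrt 2 * u) \<partial>lborel)) * ?p y \<partial>lborel)"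
    by (intro nn_integral_cong arg_cong2[where f = "(*)"] refl
        nn_integral_real_affine[where c = "sqrt 2" and t = "- y" for y, simplified abs_of_pos[OF real_sqrt_gt_zero]]) auto
  also have "\<dots> = (\<integral>\<^sup>+y. \<integral>\<^sup>+u. sqrt 2 * (f (rot45 (- y + sqrt 2 * u, y)) * ?p (- y + sqrt 2 * u) * ?p y) \<partial>lborel \<partial>lborel)"
    by (intro nn_integral_cong, subst nn_integral_cmult, simp, subst nn_integral_multc) (simp_all add: mult.assoc)
  also have "\<dots> = (\<integral>\<^sup>+u. \<integral>\<^sup>+y. sqrt 2 * (f (rot45 (- y + sqrt 2 * u, y)) * ?p (- y + sqrt 2 * u) * ?p y) \<partial>lborel \<partial>lborel)"
    by (rule lborel_pair.Fubini'[symmetric]) measurable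
  also have "\<dots> = (\<integral>\<^sup>+u. \<integral>\<^sup>+v. f (u, v) * (?p u * ?p v) \<partial>lborel \<partial>lborel)"
  proof (rule nn_integral_cong)
    fix u :: real
    let ?g = "\<lambda>y. sqrt 2 * (f (rot45 (- y + sqrt 2 * u, y)) * ?p (- y + sqrt 2 * u) * ?p y)"
    have "(\<integral>\<^sup>+y. ?g y \<partial>lborel) = \<bar>- 1 / sqrt 2\<bar> * (\<integral>\<^sup>+v. ?g (u / sqrt 2 + (- 1 / sqrt 2) * v) \<partial>lborel)"
      by (rule nn_integral_real_affine) auto
    also have "\<dots> = (\<integral>\<^sup>+v. \<bar>- 1 / sqrt 2\<bar> * ?g (u / sqrt 2 + (- 1 / sqrt 2) * v) \<partial>lborel)"
      by (subst nn_integral_cmult) auto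
    also have "\<dots> = (\<integral>\<^sup>+v. f (u, v) * (?p u * ?p v) \<partial>lborel)"
    proof (rule nn_integral_cong)
      fix v :: real
      define y where "y = u / sqrt 2 + (- 1 / sqrt 2) * v"
      have y: "y = (u - v) / sqrt 2" by (simp add: y_def diff_divide_distrib)
      have x: "- y + sqrt 2 * u = (u + v) / sqrt 2"
        unfolding y by (simp add: field_simps)
      have "rot45 (- y + sqrt 2 * u, y) = (u, v)"
        unfolding x unfolding y by (simp add: rot45_def) (simp add: field_simps)
      moreover have "?p (- y + sqrt 2 * u) * ?p y = ?p u * ?p v"
        unfolding x unfolding y using std_normal_density_rot45[of u v]
        by (simp add: ennreal_mult'[symmetric])
      moreover have "ennreal \<bar>- 1 / sqrt 2\<bar> * ennreal (sqrt 2) = 1"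
        by (simp add: ennreal_mult'[symmetric])
      ultimately show "\<bar>- 1 / sqrt 2\<bar> * ?g (u / sqrt 2 + (- 1 / sqrt 2) * v) = f (u, v) * (?p u * ?p v)"
        unfolding y_def[symmetric] by (simp only: mult.assoc[symmetric]) (simp add: mult.assoc)
    qed
    finally show "(\<integral>\<^sup>+y. ?g y \<partial>lborel) = (\<integral>\<^sup>+v. f (u, v) * (?p u * ?p v) \<partial>lborel)" .
  qed
  also have "\<dots> = (\<integral>\<^sup>+u. \<integral>\<^sup>+v. f (u, v) * ?p v \<partial>lborel * ?p u \<partial>lborel)"
    by (intro nn_integral_cong, subst nn_integral_multc[symmetric]) (simp_all add: ac_simps)
  finally show ?thesis .
qed

interpretation std_normal: real_distribution std_normal_distribution
  by (rule real_dist_normal_dist)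

abbreviation "std_normal_pair \<equiv> std_normal_distribution \<Otimes>\<^sub>M std_normal_distribution"

interpretation std_normal_pair: pair_prob_space std_normal_distribution std_normal_distribution ..

lemma sets_std_normal_pair [measurable_cong]: "sets std_normal_pair = sets (borel \<Otimes>\<^sub>M borel)"
  by (intro sets_pair_measure_cong) simp_all

lemma distr_rot45: "distr std_normal_pair (borel \<Otimes>\<^sub>M borel) rot45 = std_normal_pair"
proof (rule measure_eqI)
  fix A assume "A \<in> sets (distr std_normal_pair (borel \<Otimes>\<^sub>M borel) rot45)"
  then have [measurable]: "A \<in> sets (borel \<Otimes>\<^sub>M borel)" by simp
  have "emeasure (distr std_normal_pair (borel \<Otimes>\<^sub>M borel) rot45) A =
      (\<integral>\<^sup>+z. indicator A (rot45 z) \<partial>std_normal_pair)"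
    by (subst nn_integral_distr[symmetric, where M' = "borel \<Otimes>\<^sub>M borel" and f = "indicator A"]) auto
  also have "\<dots> = (\<integral>\<^sup>+y. \<integral>\<^sup>+x. indicator A (rot45 (x, y)) \<partial>std_normal_distribution \<partial>std_normal_distribution)"
    by (subst std_normal_pair.nn_integral_snd[symmetric]) (auto simp: )
  also have "\<dots> = (\<integral>\<^sup>+u. \<integral>\<^sup>+v. indicator A (u, v) \<partial>std_normal_distribution \<partial>std_normal_distribution)"
    using nn_integral_rot45[of "indicator A"] by (simp add: nn_integral_density mult.commute)
  also have "\<dots> = emeasure std_normal_pair A"
    by (subst std_normal.nn_integral_fst) (auto simp: )
  finally show "emeasure (distr std_normal_pair (borel \<Otimes>\<^sub>M borel) rot45) A = emeasure std_normal_pair A" .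
qed (simp add: sets_std_normal_pair)

section \<open>Independent standard normal sequences\<close>

definition gauss_seq :: "(nat \<Rightarrow> real) measure" where
  "gauss_seq = PiM UNIV (\<lambda>_. std_normal_distribution)"

interpretation gauss: product_prob_space "\<lambda>_::nat. std_normal_distribution" UNIV ..

interpretation gauss_seq: prob_space gauss_seq
  unfolding gauss_seq_def by (rule gauss.P.prob_space_axioms)

lemma space_gauss_seq [simp]: "space gauss_seq = UNIV"
  by (simp add: gauss_seq_def space_PiM)

lemma sets_gauss_seq [measurable_cong]: "sets gauss_seq = sets (PiM UNIV (\<lambda>_. borel))"
  unfolding gauss_seq_def by (intro sets_PiM_cong) simp_all

lemma distr_gauss_seq_component: "distr gauss_seq borel (\<lambda>\<omega>. \<omega> i) = std_normal_distribution"
proof -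
  have "distr gauss_seq borel (\<lambda>\<omega>. \<omega> i) = distr gauss_seq std_normal_distribution (\<lambda>\<omega>. \<omega> i)"
    by (intro distr_cong) simp_all
  then show ?thesis
    unfolding gauss_seq_def by (simp add: gauss.PiM_component)
qed

lemma indep_vars_gauss_seq: "gauss_seq.indep_vars (\<lambda>_. borel) (\<lambda>i \<omega>. \<omega> i) UNIV"
proof (subst gauss_seq.indep_vars_iff_distr_eq_PiM')
  show "distr gauss_seq (PiM UNIV (\<lambda>_. borel)) (\<lambda>x. \<lambda>i\<in>UNIV. x i) =
      PiM UNIV (\<lambda>i. distr gauss_seq borel (\<lambda>x. x i))"
    unfolding distr_gauss_seq_component
    by (simp add: restrict_def gauss_seq_def[symmetric] distr_id2[OF sets_gauss_seq[symmetric]])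
qed (auto simp: )

lemma prod_pairs: "(\<Prod>i<2 * n. f i) = (\<Prod>k<n. f (2 * k) * f (Suc (2 * k)))" for f :: "nat \<Rightarrow> 'a::comm_monoid_mult"
  by (induction n) (simp_all add: mult.assoc)

text \<open>Levy's midpoint step on all intervals at once: from a normalised increment (even index)
  and the normalised displacement of its midpoint (next index) it makes the normalised increments
  over the two halves.\<close>

definition rot_pairs :: "(nat \<Rightarrow> real) \<Rightarrow> nat \<Rightarrow> real" where
  "rot_pairs \<omega> i = (if even i then (\<omega> i + \<omega> (Suc i)) / sqrt 2 else (\<omega> (i - 1) - \<omega> i) / sqrt 2)"

lemma measurable_rot_pairs [measurable]:
  "rot_pairs \<in> PiM UNIV (\<lambda>_. borel) \<rightarrow>\<^sub>M PiM UNIV (\<lambda>_. borel)"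
  by (rule measurable_PiM_single') (auto simp: rot_pairs_def)

lemma distr_gauss_seq_pair:
  assumes "i \<noteq> j"
  shows "distr gauss_seq (borel \<Otimes>\<^sub>M borel) (\<lambda>\<omega>. (\<omega> i, \<omega> j)) = std_normal_pair"
proof -
  have "gauss_seq.indep_var borel (\<lambda>\<omega>. \<omega> i) borel (\<lambda>\<omega>. \<omega> j)"
    using gauss_seq.indep_vars_compose2[OF gauss_seq.indep_var_restrict[OF indep_vars_gauss_seq,
        of "{i}" "{j}", unfolded gauss_seq.indep_var_def]]
      gauss_seq.indep_var_compose[OF gauss_seq.indep_var_restrict[OF indep_vars_gauss_seq, of "{i}" "{j}"],
        of "\<lambda>f. f i" borel "\<lambda>f. f j" borel] assms by (auto simp: comp_def)
  then show ?thesis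
    unfolding gauss_seq.indep_var_distribution_eq distr_gauss_seq_component by simp
qed

text \<open>Tested on cylinder sets. The pairs \<open>{2 * k, Suc (2 * k)}\<close> are independent
  blocks that are transformed separately, so the probability factorises over blocks, and within a
  block \<open>distr_rot45\<close> applies.\<close>

lemma distr_rot_pairs: "distr gauss_seq (PiM UNIV (\<lambda>_. borel)) rot_pairs = gauss_seq"
  unfolding gauss_seq_def
proof (rule gauss.PiM_eq)
  show "sets (distr (PiM UNIV (\<lambda>_. std_normal_distribution)) (PiM UNIV (\<lambda>_. borel)) rot_pairs) =
      sets (PiM UNIV (\<lambda>_::nat. std_normal_distribution))"
    unfolding gauss_seq_def[symmetric] by (simp add: sets_gauss_seq)
next
  fix J :: "nat set" and F :: "nat \<Rightarrow> real set"
  assume J: "finite J" "J \<subseteq> UNIV" and F: "\<And>j. j \<in> J \<Longrightarrow> F j \<in> sets std_normal_distribution"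
  \<comment> \<open>Padding with \<open>UNIV\<close> completes every pair that meets
    \<open>J\<close>; the added factors are 1.\<close>
  define F' where "F' j = (if j \<in> J then F j else UNIV)" for j
  have F' [measurable]: "F' j \<in> sets borel" for j using F by (auto simp: F'_def)
  obtain n where n: "J \<subseteq> {..<n}" using J(1) finite_nat_iff_bounded by auto
  define K where "K k = {2 * k, Suc (2 * k)}" for k :: nat
  have disj: "disjoint_family_on K UNIV"
    unfolding disjoint_family_on_def K_def by (auto; presburger)
  define A where "A k = (\<lambda>f. (f (2 * k), f (Suc (2 * k)))) -` (rot45 -` (F' (2 * k) \<times> F' (Suc (2 * k))))
      \<inter> space (PiM (K k) (\<lambda>_. borel :: real measure))" for k
  have pm: "(\<lambda>f. (f (2 * k), f (Suc (2 * k)))) \<in> PiM (K k) (\<lambda>_. borel :: real measure) \<rightarrow>\<^sub>M borel \<Otimes>\<^sub>M borel" for k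
    by (intro measurable_Pair measurable_component_singleton) (auto simp: K_def)
  have rm: "rot45 -` (F' (2 * k) \<times> F' (Suc (2 * k))) \<in> sets (borel \<Otimes>\<^sub>M borel)" for k
    using measurable_sets[OF measurable_rot45, of "F' (2 * k) \<times> F' (Suc (2 * k))"]
    by (simp add: space_pair_measure)
  have Am: "A k \<in> sets (PiM (K k) (\<lambda>_. borel))" for k
    unfolding A_def using measurable_sets[OF pm rm] .
  have iv: "gauss_seq.indep_vars (\<lambda>k. PiM (K k) (\<lambda>_. borel)) (\<lambda>k \<omega>. restrict (\<lambda>i. \<omega> i) (K k)) UNIV"
    by (rule gauss_seq.indep_vars_restrict[OF indep_vars_gauss_seq]) (use disj in auto)
  have pre: "(\<lambda>\<omega>. restrict (\<lambda>i. \<omega> i) (K k)) -` A k \<inter> space gauss_seq =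
      {\<omega>. rot_pairs \<omega> (2 * k) \<in> F' (2 * k) \<and> rot_pairs \<omega> (Suc (2 * k)) \<in> F' (Suc (2 * k))}" for k
    unfolding A_def by (auto simp: K_def rot_pairs_def rot45_def space_PiM)
  have one: "gauss_seq.prob {\<omega>. rot_pairs \<omega> (2 * k) \<in> F' (2 * k) \<and> rot_pairs \<omega> (Suc (2 * k)) \<in> F' (Suc (2 * k))} =
      measure std_normal_distribution (F' (2 * k)) * measure std_normal_distribution (F' (Suc (2 * k)))" (is "?L k = _") for k
  proof -
    have "?L k = measure (distr gauss_seq (borel \<Otimes>\<^sub>M borel) (\<lambda>\<omega>. (\<omega> (2 * k), \<omega> (Suc (2 * k)))))
        (rot45 -` (F' (2 * k) \<times> F' (Suc (2 * k))))"
      by (subst measure_distr[OF _ rm]) (auto simp: rot_pairs_def rot45_def intro!: arg_cong[where f = "measure _"])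
    also have "\<dots> = measure (distr std_normal_pair (borel \<Otimes>\<^sub>M borel) rot45) (F' (2 * k) \<times> F' (Suc (2 * k)))"
      by (subst distr_gauss_seq_pair, simp, subst measure_distr) (auto simp: space_pair_measure)
    also have "\<dots> = measure std_normal_distribution (F' (2 * k)) * measure std_normal_distribution (F' (Suc (2 * k)))"
      unfolding distr_rot45 measure_def
      by (subst std_normal.emeasure_pair_measure_Times) (auto simp: enn2real_mult)
    finally show ?thesis .
  qed
  have "gauss_seq.prob {\<omega>. \<forall>j\<in>J. rot_pairs \<omega> j \<in> F j} = gauss_seq.prob (\<Inter>k\<in>{..n}. (\<lambda>\<omega>. restrict (\<lambda>i. \<omega> i) (K k)) -` A k \<inter> space gauss_seq)"
  proof (rule arg_cong[where f = "gauss_seq.prob"])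
    have "j \<in> J \<Longrightarrow> (even j \<and> j = 2 * (j div 2) \<or> odd j \<and> j = Suc (2 * (j div 2))) \<and> j div 2 \<le> n" for j
      using n by (cases "even j") (auto elim!: evenE oddE dest!: subsetD)
    then show "{\<omega>. \<forall>j\<in>J. rot_pairs \<omega> j \<in> F j} = (\<Inter>k\<in>{..n}. (\<lambda>\<omega>. restrict (\<lambda>i. \<omega> i) (K k)) -` A k \<inter> space gauss_seq)"
      unfolding pre F'_def by (auto split: if_splits) (metis atMost_iff)+
  qed
  also have "\<dots> = (\<Prod>k\<le>n. gauss_seq.prob ((\<lambda>\<omega>. restrict (\<lambda>i. \<omega> i) (K k)) -` A k \<inter> space gauss_seq))"
    by (rule gauss_seq.indep_varsD[OF iv]) (use Am in auto)
  also have "\<dots> = (\<Prod>k\<le>n. measure std_normal_distribution (F' (2 * k)) * measure std_normal_distribution (F' (Suc (2 * k))))"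
    unfolding pre one ..
  also have "\<dots> = (\<Prod>j<2 * Suc n. measure std_normal_distribution (F' j))"
    unfolding prod_pairs lessThan_Suc_atMost ..
  also have "\<dots> = (\<Prod>j\<in>J. measure std_normal_distribution (F j))"
  proof (rule prod.mono_neutral_cong_right)
    show "J \<subseteq> {..<2 * Suc n}" using n by auto
    show "\<forall>i\<in>{..<2 * Suc n} - J. measure std_normal_distribution (F' i) = 1"
      using std_normal.prob_space by (auto simp: F'_def)
  qed (auto simp: F'_def)
  finally have *: "gauss_seq.prob {\<omega>. \<forall>j\<in>J. rot_pairs \<omega> j \<in> F j} = (\<Prod>j\<in>J. measure std_normal_distribution (F j))" .
  have "emeasure (distr gauss_seq (PiM UNIV (\<lambda>_. borel)) rot_pairs) (prod_emb UNIV (\<lambda>_. std_normal_distribution) J (PiE J F)) =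
     emeasure gauss_seq {\<omega>. \<forall>j\<in>J. rot_pairs \<omega> j \<in> F j}"
  proof (subst emeasure_distr)
    have "prod_emb UNIV (\<lambda>_. std_normal_distribution) J (PiE J F) \<in> sets (PiM UNIV (\<lambda>_::nat. std_normal_distribution))"
      using J F by (intro sets_PiM_I) auto
    then show "prod_emb UNIV (\<lambda>_. std_normal_distribution) J (PiE J F) \<in> sets (PiM UNIV (\<lambda>_. borel))"
      using sets_gauss_seq unfolding gauss_seq_def by simp
    show "emeasure gauss_seq (rot_pairs -` prod_emb UNIV (\<lambda>_. std_normal_distribution) J (PiE J F) \<inter> space gauss_seq) =
        emeasure gauss_seq {\<omega>. \<forall>j\<in>J. rot_pairs \<omega> j \<in> F j}"
      by (intro arg_cong[where f = "emeasure _"]) (auto simp: prod_emb_def PiE_iff)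
  qed simp
  also have "\<dots> = (\<Prod>j\<in>J. emeasure std_normal_distribution (F j))"
    unfolding gauss_seq.emeasure_eq_measure * std_normal.emeasure_eq_measure
    by (rule prod_ennreal[symmetric]) simp
  finally show "emeasure (distr (PiM UNIV (\<lambda>_. std_normal_distribution)) (PiM UNIV (\<lambda>_. borel)) rot_pairs)
      (prod_emb UNIV (\<lambda>_. std_normal_distribution) J (PiE J F)) = (\<Prod>j\<in>J. emeasure std_normal_distribution (F j))"
    unfolding gauss_seq_def .
qed

section \<open>Brownian increments on dyadic grids\<close>

text \<open>
  The coordinates \<open>lead k\<close> carry the normalised increments of the current dyadic level, the coordinates
  \<open>4 k + 2\<close> the displacements of their midpoints; all others are a reservoir for the later levels. One
  refinement step therefore preserves the law \<open>gauss_seq\<close> of the whole sequence, so that the increments of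
  every level are independent.
\<close>

definition lead :: "nat \<Rightarrow> nat" where
  "lead k = 4 * (k div 2) + k mod 2"

text \<open>The new position \<open>n\<close> is filled from the old position
  \<open>shuffle_index n\<close>. Positions \<open>4 * k\<close> and \<open>4 * k + 1\<close>, which
  are \<open>lead (2 * k)\<close> and \<open>lead (2 * k + 1)\<close>, receive the increment and the
  displacement that \<open>rot_pairs\<close> is to combine. Positions \<open>4 * k + 2\<close> and
  \<open>4 * k + 3\<close> are refilled from the reservoir: \<open>8 * k + 3\<close> and
  \<open>8 * k + 7\<close> run through all numbers congruent to 3 modulo 4.\<close>

definition shuffle_index :: "nat \<Rightarrow> nat" where
  "shuffle_index n = (let k = n div 4 in
     if n mod 4 = 0 then lead k else if n mod 4 = 1 then 4 * k + 2
     else if n mod 4 = 2 then 8 * k + 3 else 8 * k + 7)"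

lemma shuffle_index_simps:
  "shuffle_index (4 * k) = lead k"
  "shuffle_index (4 * k + 1) = 4 * k + 2"
  "shuffle_index (4 * k + 2) = 8 * k + 3"
  "shuffle_index (4 * k + 3) = 8 * k + 7"
proof -
  have "(4 * k) div 4 = k" "(4 * k) mod 4 = 0" "(4 * k + 1) div 4 = k" "(4 * k + 1) mod 4 = 1"
    "(4 * k + 2) div 4 = k" "(4 * k + 2) mod 4 = 2" "(4 * k + 3) div 4 = k" "(4 * k + 3) mod 4 = 3"
    by presburger+
  then show "shuffle_index (4 * k) = lead k" "shuffle_index (4 * k + 1) = 4 * k + 2"
    "shuffle_index (4 * k + 2) = 8 * k + 3" "shuffle_index (4 * k + 3) = 8 * k + 7"
    unfolding shuffle_index_def Let_def by presburger+
qed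

lemma inj_shuffle_index: "inj shuffle_index"
proof (rule inj_on_inverseI)
  \<comment> \<open>A left inverse, read off from residues: 0 and 1 modulo 4 are values of
    \<open>lead\<close>, 2 is a displacement, and 3 and 7 modulo 8 separate the two reservoir
    cases.\<close>
  define g :: "nat \<Rightarrow> nat" where "g v = (if v mod 4 < 2 then 4 * (2 * (v div 4) + v mod 4)
      else if v mod 4 = 2 then 4 * (v div 4) + 1
      else if v mod 8 = 3 then 4 * (v div 8) + 2 else 4 * (v div 8) + 3)" for v
  fix n :: nat
  define k where "k = n div 4"
  have "lead k mod 4 = k mod 2" "lead k div 4 = k div 2"
    by (simp_all add: lead_def)
  then have "g (lead k) = 4 * k"
    unfolding g_def by simp
  moreover have "(4 * k + 2) mod 4 = 2" "(4 * k + 2) div 4 = k" "(8 * k + 3) mod 4 = 3" "(8 * k + 3) mod 8 = 3"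
    "(8 * k + 3) div 8 = k" "(8 * k + 7) mod 4 = 3" "(8 * k + 7) mod 8 = 7" "(8 * k + 7) div 8 = k"
    by presburger+
  then have "g (4 * k + 2) = 4 * k + 1" "g (8 * k + 3) = 4 * k + 2" "g (8 * k + 7) = 4 * k + 3"
    by (simp_all only: g_def, simp_all)
  moreover have "n = 4 * k \<or> n = 4 * k + 1 \<or> n = 4 * k + 2 \<or> n = 4 * k + 3"
    unfolding k_def by presburger
  ultimately show "g (shuffle_index n) = n"
    using shuffle_index_simps[of k] by metis
qed

definition refine :: "(nat \<Rightarrow> real) \<Rightarrow> nat \<Rightarrow> real" where
  "refine \<omega> = rot_pairs (\<lambda>n. \<omega> (shuffle_index n))"

lemma measurable_reindex:
  "(\<lambda>\<omega> n. \<omega> (f n)) \<in> PiM UNIV (\<lambda>_::nat. borel) \<rightarrow>\<^sub>M PiM UNIV (\<lambda>_::nat. borel :: real measure)"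
  by (rule measurable_PiM_single') auto

lemma measurable_refine [measurable]:
  "refine \<in> PiM UNIV (\<lambda>_. borel) \<rightarrow>\<^sub>M PiM UNIV (\<lambda>_. borel)"
  unfolding refine_def using measurable_compose[OF measurable_reindex measurable_rot_pairs] .

lemma distr_refine: "distr gauss_seq (PiM UNIV (\<lambda>_. borel)) refine = gauss_seq"
proof -
  have "distr gauss_seq gauss_seq (\<lambda>\<omega> n. \<omega> (shuffle_index n)) = gauss_seq"
    using distr_PiM_reindex[of UNIV "\<lambda>_::nat. std_normal_distribution" shuffle_index UNIV] inj_shuffle_index
      std_normal.prob_space_axioms by (simp add: gauss_seq_def restrict_def)
  then have "distr gauss_seq (PiM UNIV (\<lambda>_. borel)) (rot_pairs \<circ> (\<lambda>\<omega> n. \<omega> (shuffle_index n))) = gauss_seq"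
    using distr_rot_pairs measurable_reindex[of shuffle_index]
    by (subst distr_distr[symmetric, where N = gauss_seq]) (auto cong: measurable_cong_sets simp: sets_gauss_seq)
  then show ?thesis
    by (simp add: refine_def[abs_def] comp_def)
qed

lemma measurable_refine_pow [measurable]:
  "(refine ^^ n) \<in> PiM UNIV (\<lambda>_. borel) \<rightarrow>\<^sub>M PiM UNIV (\<lambda>_. borel)"
  by (induction n) (auto intro: measurable_comp[OF _ measurable_refine])

lemma distr_refine_pow: "distr gauss_seq (PiM UNIV (\<lambda>_. borel)) (refine ^^ n) = gauss_seq"
proof (induction n)
  case 0
  show ?case by (simp add: distr_id2[OF sets_gauss_seq[symmetric]] id_def)
next
  case (Suc n)
  have "distr gauss_seq (PiM UNIV (\<lambda>_. borel)) (refine \<circ> (refine ^^ n)) =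
      distr (distr gauss_seq (PiM UNIV (\<lambda>_. borel)) (refine ^^ n)) (PiM UNIV (\<lambda>_. borel)) refine"
    by (rule distr_distr[symmetric]) simp_all
  then show ?case by (simp add: Suc distr_refine comp_def)
qed

lemma refine_lead:
  "refine \<omega> (lead (2 * k)) = (\<omega> (lead k) + \<omega> (4 * k + 2)) / sqrt 2"
  "refine \<omega> (lead (Suc (2 * k))) = (\<omega> (lead k) - \<omega> (4 * k + 2)) / sqrt 2"
proof -
  have "lead (2 * k) = 4 * k" "lead (Suc (2 * k)) = Suc (4 * k)" by (simp_all add: lead_def)
  moreover have "shuffle_index (4 * k) = lead k" "shuffle_index (Suc (4 * k)) = 4 * k + 2"
    using shuffle_index_simps[of k] by simp_all
  ultimately show "refine \<omega> (lead (2 * k)) = (\<omega> (lead k) + \<omega> (4 * k + 2)) / sqrt 2"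
    "refine \<omega> (lead (Suc (2 * k))) = (\<omega> (lead k) - \<omega> (4 * k + 2)) / sqrt 2"
    by (simp_all add: refine_def rot_pairs_def)
qed

text \<open>
  \<open>incr n k\<close> is the increment of the Brownian motion over \<open>[k / 2\<^sup>n, (k + 1) / 2\<^sup>n]\<close>, and \<open>disp n k\<close> twice the
  displacement of its midpoint from the chord. \<open>bm_path j u\<close> below is \<open>B\<^sub>j\<^sub>+\<^sub>u - B\<^sub>j\<close> for \<open>u \<in> [0, 1]\<close>.
\<close>

definition incr :: "nat \<Rightarrow> nat \<Rightarrow> (nat \<Rightarrow> real) \<Rightarrow> real" where
  "incr n k \<omega> = (refine ^^ n) \<omega> (lead k) / sqrt 2 ^ n"

definition disp :: "nat \<Rightarrow> nat \<Rightarrow> (nat \<Rightarrow> real) \<Rightarrow> real" where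
  "disp n k \<omega> = (refine ^^ n) \<omega> (4 * k + 2) / sqrt 2 ^ n"

lemma measurable_incr [measurable]: "incr n k \<in> borel_measurable gauss_seq"
  unfolding incr_def by measurable

lemma measurable_disp [measurable]: "disp n k \<in> borel_measurable gauss_seq"
  unfolding disp_def by measurable

lemma incr_Suc:
  "incr (Suc n) (2 * k) \<omega> = (incr n k \<omega> + disp n k \<omega>) / 2"
  "incr (Suc n) (Suc (2 * k)) \<omega> = (incr n k \<omega> - disp n k \<omega>) / 2"
proof -
  have [simp]: "sqrt 2 * (sqrt 2 * x) = 2 * x" for x :: real
    by (simp flip: mult.assoc)
  show "incr (Suc n) (2 * k) \<omega> = (incr n k \<omega> + disp n k \<omega>) / 2"
    "incr (Suc n) (Suc (2 * k)) \<omega> = (incr n k \<omega> - disp n k \<omega>) / 2"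
    by (simp_all add: incr_def disp_def refine_lead) (simp_all add: field_simps)
qed

lemma incr_split: "incr n k \<omega> = incr (Suc n) (2 * k) \<omega> + incr (Suc n) (Suc (2 * k)) \<omega>"
  unfolding incr_Suc by (simp add: field_simps)

lemma sum_pairs: "(\<Sum>i<2 * n. f i) = (\<Sum>k<n. f (2 * k) + f (Suc (2 * k)))" for f :: "nat \<Rightarrow> 'a::comm_monoid_add"
  by (induction n) (simp_all add: add.assoc)

definition clamp01 :: "real \<Rightarrow> real" where
  "clamp01 x = max 0 (min 1 x)"

lemma continuous_clamp01 [continuous_intros]:
  "continuous_on A f \<Longrightarrow> continuous_on A (\<lambda>x. clamp01 (f x))"
  unfolding clamp01_def by (intro continuous_intros)

lemma clamp01_mono: "x \<le> y \<Longrightarrow> clamp01 x \<le> clamp01 y"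
  by (auto simp: clamp01_def)

lemma clamp01_bounds: "0 \<le> clamp01 x" "clamp01 x \<le> 1"
  by (auto simp: clamp01_def)

section \<open>Continuous paths\<close>

text \<open>The hat function on the unit interval with height 1 at \<open>1 / 2\<close>: up to
  scaling, the Schauder function that one dyadic level adds to the previous one.\<close>

definition tent :: "real \<Rightarrow> real" where
  "tent x = clamp01 (2 * x) - clamp01 (2 * x - 1)"

lemma tent_nonneg: "0 \<le> tent x"
  by (simp add: tent_def clamp01_mono)

text \<open>The hats have disjoint supports. Instead of locating \<open>x\<close>, the proof adds
  the missing differences, nonnegative by monotonicity of \<open>clamp01\<close>, so that the whole
  sum telescopes.\<close>

lemma sum_tent_le: "(\<Sum>k<n. tent (x - real k)) \<le> 1"
proof -
  have "(\<Sum>k<n. tent (x - real k)) \<le>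
      (\<Sum>k<n. tent (x - real k) + (clamp01 (2 * x - real (Suc (2 * k))) - clamp01 (2 * x - real (Suc (Suc (2 * k))))))"
    by (intro sum_mono) (simp add: clamp01_mono)
  also have "\<dots> = (\<Sum>i<2 * n. clamp01 (2 * x - real i) - clamp01 (2 * x - real (Suc i)))"
    unfolding sum_pairs by (intro sum.cong) (simp_all add: tent_def algebra_simps)
  also have "\<dots> = clamp01 (2 * x) - clamp01 (2 * x - real (2 * n))"
    by (subst sum_lessThan_telescope') simp
  also have "\<dots> \<le> 1" using clamp01_bounds[of "2 * x"] clamp01_bounds[of "2 * x - real (2 * n)"] by linarith
  finally show ?thesis .
qed

lemma tent_of_int: "tent (of_int i) = 0"
proof -
  consider "i \<le> 0" | "i \<ge> 1" by linarith
  then show ?thesis by cases (auto simp: tent_def clamp01_def)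
qed

definition path_approx :: "nat \<Rightarrow> nat \<Rightarrow> real \<Rightarrow> (nat \<Rightarrow> real) \<Rightarrow> real" where
  "path_approx j n u \<omega> = (\<Sum>k<2 ^ n. incr n (j * 2 ^ n + k) \<omega> * clamp01 (2 ^ n * u - real k))"

definition bm_path :: "nat \<Rightarrow> real \<Rightarrow> (nat \<Rightarrow> real) \<Rightarrow> real" where
  "bm_path j u \<omega> = lim (\<lambda>n. path_approx j n u \<omega>)"

text \<open>In the application \<open>e\<close>, \<open>a\<close>, \<open>b\<close> are the values
  of \<open>clamp01\<close> for an interval and for its two halves, \<open>d\<close> is the
  increment over the interval and \<open>z\<close> its \<open>disp\<close>.\<close>

lemma refine_linear:
  fixes a b d e z :: real
  assumes "2 * e = a + b"
  shows "(d + z) / 2 * a + (d - z) / 2 * b - d * e = z / 2 * (a - b)"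
proof -
  have e: "e = (a + b) / 2" using assms by simp
  show ?thesis unfolding e by (simp add: field_simps)
qed

lemma path_approx_Suc:
  "path_approx j (Suc n) u \<omega> - path_approx j n u \<omega> =
     (\<Sum>k<2 ^ n. disp n (j * 2 ^ n + k) \<omega> / 2 * tent (2 ^ n * u - real k))"
proof -
  have c: "2 * clamp01 y = clamp01 (2 * y) + clamp01 (2 * y - 1)" for y
    by (simp add: clamp01_def max_def min_def)
  have 1: "path_approx j (Suc n) u \<omega> =
      (\<Sum>k<2 ^ n. incr (Suc n) (2 * (j * 2 ^ n + k)) \<omega> * clamp01 (2 * (2 ^ n * u - real k))
        + incr (Suc n) (Suc (2 * (j * 2 ^ n + k))) \<omega> * clamp01 (2 * (2 ^ n * u - real k) - 1))"
    unfolding path_approx_def power_Suc sum_pairs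
  proof (intro sum.cong refl arg_cong2[where f = "(+)"] arg_cong2[where f = "(*)"])
    fix k
    show "incr (Suc n) (j * (2 * 2 ^ n) + 2 * k) \<omega> = incr (Suc n) (2 * (j * 2 ^ n + k)) \<omega>"
      "incr (Suc n) (j * (2 * 2 ^ n) + Suc (2 * k)) \<omega> = incr (Suc n) (Suc (2 * (j * 2 ^ n + k))) \<omega>"
      by (simp_all add: distrib_left mult.left_commute)
    have "2 * y - real (2 * k) = 2 * (y - real k)" "2 * y - real (Suc (2 * k)) = 2 * (y - real k) - 1" for y
      by simp_all
    from this[of "2 ^ n * u"]
    show "clamp01 (2 * 2 ^ n * u - real (2 * k)) = clamp01 (2 * (2 ^ n * u - real k))"
      "clamp01 (2 * 2 ^ n * u - real (Suc (2 * k))) = clamp01 (2 * (2 ^ n * u - real k) - 1)"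
      by (simp_all only: mult.assoc)
  qed
  show ?thesis
    unfolding 1 unfolding path_approx_def sum_subtractf[symmetric]
  proof (intro sum.cong refl)
    fix k
    show "incr (Suc n) (2 * (j * 2 ^ n + k)) \<omega> * clamp01 (2 * (2 ^ n * u - real k))
        + incr (Suc n) (Suc (2 * (j * 2 ^ n + k))) \<omega> * clamp01 (2 * (2 ^ n * u - real k) - 1)
        - incr n (j * 2 ^ n + k) \<omega> * clamp01 (2 ^ n * u - real k) =
      disp n (j * 2 ^ n + k) \<omega> / 2 * tent (2 ^ n * u - real k)"
      using refine_linear[OF c[of "2 ^ n * u - real k"]] unfolding incr_Suc tent_def .
  qed
qed

lemma path_approx_Suc_le:
  assumes "\<And>k. k < 2 ^ n \<Longrightarrow> \<bar>disp n (j * 2 ^ n + k) \<omega>\<bar> \<le> c"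
  shows "\<bar>path_approx j (Suc n) u \<omega> - path_approx j n u \<omega>\<bar> \<le> c"
proof -
  have "\<bar>disp n (j * 2 ^ n + 0) \<omega>\<bar> \<le> c" by (rule assms) simp
  then have c: "0 \<le> c" by (rule order_trans[OF abs_ge_zero])
  have "\<bar>path_approx j (Suc n) u \<omega> - path_approx j n u \<omega>\<bar> \<le> (\<Sum>k<2 ^ n. c / 2 * tent (2 ^ n * u - real k))"
    unfolding path_approx_Suc
  proof (intro order_trans[OF sum_abs] sum_mono)
    fix k :: nat assume "k \<in> {..<2 ^ n}"
    then have "\<bar>disp n (j * 2 ^ n + k) \<omega>\<bar> \<le> c" by (intro assms) auto
    then have "\<bar>disp n (j * 2 ^ n + k) \<omega> / 2\<bar> \<le> c / 2" by simp
    from mult_right_mono[OF this tent_nonneg]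
    show "\<bar>disp n (j * 2 ^ n + k) \<omega> / 2 * tent (2 ^ n * u - real k)\<bar> \<le> c / 2 * tent (2 ^ n * u - real k)"
      by (simp only: abs_mult abs_of_nonneg[OF tent_nonneg])
  qed
  also have "\<dots> \<le> c / 2 * 1"
    unfolding sum_distrib_left[symmetric] using c sum_tent_le by (intro mult_left_mono) auto
  finally show ?thesis using c by simp
qed

text \<open>Any rate strictly between \<open>2 powr (- 1 / 4)\<close> and 1 would do instead of
  \<open>9 / 10\<close>: above the former, the fourth-moment bounds for the \<open>2 ^ n\<close>
  displacements of level \<open>n\<close> are summable; below 1, the differences of successive
  polygons are.\<close>

definition tame :: "nat \<Rightarrow> (nat \<Rightarrow> real) \<Rightarrow> bool" where
  "tame j \<omega> \<longleftrightarrow> (\<forall>\<^sub>F n in sequentially. \<forall>k<2 ^ n. \<bar>disp n (j * 2 ^ n + k) \<omega>\<bar> \<le> (9 / 10) ^ n)"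

lemma uniform_limit_path:
  assumes "tame j \<omega>"
  shows "uniform_limit UNIV (\<lambda>n u. path_approx j n u \<omega>) (\<lambda>u. bm_path j u \<omega>) sequentially"
proof -
  define f where "f n u = path_approx j (Suc n) u \<omega> - path_approx j n u \<omega>" for n u
  have "uniform_limit UNIV (\<lambda>n u. \<Sum>i<n. f i u) (\<lambda>u. suminf (\<lambda>i. f i u)) sequentially"
  proof (rule Weierstrass_m_test_ev)
    show "\<forall>\<^sub>F n in sequentially. \<forall>u\<in>UNIV. norm (f n u) \<le> (9 / 10) ^ n"
      using assms unfolding tame_def f_def by eventually_elim (auto intro!: path_approx_Suc_le)
  qed (simp add: summable_geometric)
  then have "uniform_limit UNIV (\<lambda>n u. path_approx j 0 u \<omega> + (\<Sum>i<n. f i u))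
      (\<lambda>u. path_approx j 0 u \<omega> + suminf (\<lambda>i. f i u)) sequentially"
    by (intro uniform_limit_intros)
  moreover have "path_approx j 0 u \<omega> + (\<Sum>i<n. f i u) = path_approx j n u \<omega>" for n u
    unfolding f_def using sum_lessThan_telescope[of "\<lambda>n. path_approx j n u \<omega>" n] by simp
  ultimately have *: "uniform_limit UNIV (\<lambda>n u. path_approx j n u \<omega>)
      (\<lambda>u. path_approx j 0 u \<omega> + suminf (\<lambda>i. f i u)) sequentially" by simp
  have "(\<lambda>n. path_approx j n u \<omega>) \<longlonglongrightarrow> path_approx j 0 u \<omega> + suminf (\<lambda>i. f i u)" for u
    using tendsto_uniform_limitI[OF *] by simp
  then have "bm_path j u \<omega> = path_approx j 0 u \<omega> + suminf (\<lambda>i. f i u)" for u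
    unfolding bm_path_def by (rule limI)
  with * show ?thesis by simp
qed

lemma continuous_path:
  assumes "tame j \<omega>"
  shows "continuous_on UNIV (\<lambda>u. bm_path j u \<omega>)"
proof (rule uniform_limit_theorem[OF _ uniform_limit_path[OF assms]])
  show "\<forall>\<^sub>F n in sequentially. continuous_on UNIV (\<lambda>u. path_approx j n u \<omega>)"
    unfolding path_approx_def by (intro always_eventually allI continuous_intros)
qed simp

lemma path_approx_dyadic:
  assumes "n \<le> m" "k \<le> 2 ^ n"
  shows "path_approx j m (real k / 2 ^ n) \<omega> = (\<Sum>i<k. incr n (j * 2 ^ n + i) \<omega>)"
  using assms(1)
proof (induction m rule: dec_induct)
  case base
  have "path_approx j n (real k / 2 ^ n) \<omega> =
      (\<Sum>i<2 ^ n. if i < k then incr n (j * 2 ^ n + i) \<omega> else 0)"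
    unfolding path_approx_def
  proof (intro sum.cong refl)
    fix i
    have "clamp01 (2 ^ n * (real k / 2 ^ n) - real i) = (if i < k then 1 else 0)"
      by (cases "i < k") (auto simp: clamp01_def)
    then show "incr n (j * 2 ^ n + i) \<omega> * clamp01 (2 ^ n * (real k / 2 ^ n) - real i) =
        (if i < k then incr n (j * 2 ^ n + i) \<omega> else 0)" by simp
  qed
  also have "\<dots> = (\<Sum>i\<in>{..<2 ^ n} \<inter> {i. i < k}. incr n (j * 2 ^ n + i) \<omega>)"
    by (subst sum.inter_restrict) auto
  also have "{..<2 ^ n} \<inter> {i. i < k} = {..<k}" using assms(2) by auto
  finally show ?case .
next
  case (step m)
  have "tent (2 ^ m * (real k / 2 ^ n) - real i) = 0" for i
  proof -
    have "(2::real) ^ m = 2 ^ (m - n) * 2 ^ n"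
      using \<open>n \<le> m\<close> by (subst power_add[symmetric]) simp
    then have "2 ^ m * (real k / 2 ^ n) - real i = of_int (2 ^ (m - n) * int k - int i)"
      by simp
    then show ?thesis by (simp only: tent_of_int)
  qed
  then have "path_approx j (Suc m) (real k / 2 ^ n) \<omega> - path_approx j m (real k / 2 ^ n) \<omega> = 0"
    unfolding path_approx_Suc by simp
  with step show ?case by simp
qed

text \<open>Later refinements leave a polygon unchanged at its dyadic nodes, so the sequence is
  eventually constant there. This holds at every sample point, tame or not.\<close>

lemma path_dyadic:
  assumes "k \<le> 2 ^ n"
  shows "bm_path j (real k / 2 ^ n) \<omega> = (\<Sum>i<k. incr n (j * 2 ^ n + i) \<omega>)"
  unfolding bm_path_def
proof (intro limI tendsto_eventually)
  show "\<forall>\<^sub>F m in sequentially. path_approx j m (real k / 2 ^ n) \<omega> = (\<Sum>i<k. incr n (j * 2 ^ n + i) \<omega>)"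
    using eventually_ge_at_top[of n] by eventually_elim (rule path_approx_dyadic[OF _ assms])
qed

section \<open>Tail bounds for the midpoint displacements\<close>

lemma distr_refine_pow_component: "distr gauss_seq borel (\<lambda>\<omega>. (refine ^^ n) \<omega> i) = std_normal_distribution"
proof -
  have "distr gauss_seq borel (\<lambda>\<omega>. (refine ^^ n) \<omega> i) =
      distr (distr gauss_seq (PiM UNIV (\<lambda>_. borel)) (refine ^^ n)) borel (\<lambda>\<omega>. \<omega> i)"
    by (subst distr_distr) (auto simp: comp_def)
  then show ?thesis by (simp add: distr_refine_pow distr_gauss_seq_component)
qed

text \<open>Markov's inequality for the fourth power, whose mean is 3 for a standard normal
  variable. Second moments are too weak: summed over the \<open>2 ^ n\<close> intervals of a level,
  they only give \<open>1 / c ^ 2\<close>.\<close>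

lemma prob_disp_ge_le:
  assumes "c > 0"
  shows "gauss_seq.prob {\<omega>. \<bar>disp n k \<omega>\<bar> \<ge> c} \<le> 3 / (4 ^ n * c ^ 4)"
proof -
  have i: "integrable std_normal_distribution (\<lambda>x. x ^ 4)"
    by (rule integrable_std_normal_distribution_moment)
  have v: "(\<integral>x. x ^ 4 \<partial>std_normal_distribution) = 3"
    using integral_std_normal_moment_even[of 2]
    by (subst integral_density) (auto simp: normal_density_nonneg fact_numeral)
  have d: "integrable gauss_seq (\<lambda>\<omega>. (refine ^^ n) \<omega> (4 * k + 2) ^ 4)"
    using i unfolding distr_refine_pow_component[of n "4 * k + 2", symmetric]
    by (subst (asm) integrable_distr_eq) auto
  have e: "(\<integral>\<omega>. (refine ^^ n) \<omega> (4 * k + 2) ^ 4 \<partial>gauss_seq) = 3"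
    using v unfolding distr_refine_pow_component[of n "4 * k + 2", symmetric]
    by (subst (asm) integral_distr) auto
  have "sqrt 2 ^ n > (0::real)" by simp
  moreover have s4: "(sqrt 2 ^ n) ^ 4 = (4::real) ^ n"
  proof -
    have "(sqrt 2) ^ 4 = (4::real)"
      using real_sqrt_pow2[of 2] by (simp add: power4_eq_xxxx power2_eq_square)
    then show ?thesis by (metis power_mult mult.commute)
  qed
  ultimately have eq: "\<bar>disp n k \<omega>\<bar> \<ge> c \<longleftrightarrow> (refine ^^ n) \<omega> (4 * k + 2) ^ 4 \<ge> 4 ^ n * c ^ 4" for \<omega>
  proof -
    have "\<bar>disp n k \<omega>\<bar> \<ge> c \<longleftrightarrow> \<bar>(refine ^^ n) \<omega> (4 * k + 2)\<bar> \<ge> sqrt 2 ^ n * c"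
      by (simp add: disp_def abs_divide pos_le_divide_eq mult.commute)
    also have "\<dots> \<longleftrightarrow> \<bar>(refine ^^ n) \<omega> (4 * k + 2)\<bar> ^ 4 \<ge> (sqrt 2 ^ n * c) ^ 4"
      by (rule power_mono_iff[symmetric]) (use assms in auto)
    finally show ?thesis by (simp add: power_mult_distrib s4)
  qed
  have "gauss_seq.prob {\<omega>\<in>space gauss_seq. (refine ^^ n) \<omega> (4 * k + 2) ^ 4 \<ge> 4 ^ n * c ^ 4} \<le> 3 / (4 ^ n * c ^ 4)"
    unfolding e[symmetric] using assms by (intro integral_Markov_inequality_measure[where A = "{}"] d) auto
  then show ?thesis unfolding eq by simp
qed

lemma AE_tame: "AE \<omega> in gauss_seq. tame j \<omega>"
proof -
  define A where "A n = (\<Union>k<2 ^ n. {\<omega>. \<bar>disp n (j * 2 ^ n + k) \<omega>\<bar> \<ge> (9 / 10) ^ n})" for n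
  have [measurable]: "A n \<in> sets gauss_seq" for n
  proof -
    have "{\<omega>\<in>space gauss_seq. \<bar>disp n (j * 2 ^ n + k) \<omega>\<bar> \<ge> (9 / 10) ^ n} \<in> sets gauss_seq" for k
      by measurable
    then show ?thesis unfolding A_def by auto
  qed
  have le: "measure gauss_seq (A n) \<le> 3 * (5000 / 6561) ^ n" for n
  proof -
    have "measure gauss_seq (A n) \<le> (\<Sum>k<2 ^ n. gauss_seq.prob {\<omega>. \<bar>disp n (j * 2 ^ n + k) \<omega>\<bar> \<ge> (9 / 10) ^ n})"
      unfolding A_def
    proof (rule gauss_seq.finite_measure_subadditive_finite)
      have "{\<omega>\<in>space gauss_seq. \<bar>disp n (j * 2 ^ n + k) \<omega>\<bar> \<ge> (9 / 10) ^ n} \<in> sets gauss_seq" for k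
        by measurable
      then show "(\<lambda>k. {\<omega>. \<bar>disp n (j * 2 ^ n + k) \<omega>\<bar> \<ge> (9 / 10) ^ n}) ` {..<2 ^ n} \<subseteq> gauss_seq.events"
        by auto
    qed simp
    also have "\<dots> \<le> (\<Sum>k<2 ^ n::nat. 3 / (4 ^ n * ((9 / 10) ^ n) ^ 4))"
      by (intro sum_mono prob_disp_ge_le) simp
    also have "\<dots> = 3 * (2 ^ n / (4 ^ n * ((9 / 10) ^ 4) ^ n))"
      by (simp add: power_mult[symmetric] mult.commute)
    also have "\<dots> = 3 * (2 / (4 * (9 / 10) ^ 4)) ^ n"
      by (simp only: power_divide power_mult_distrib)
    also have "2 / (4 * (9 / 10) ^ 4) = (5000 / 6561 :: real)" by (simp add: power4_eq_xxxx)
    finally show ?thesis .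
  qed
  have "AE \<omega> in gauss_seq. \<forall>\<^sub>F n in sequentially. \<omega> \<in> space gauss_seq - A n"
  proof (rule borel_cantelli_AE1)
    show "summable (\<lambda>n. measure gauss_seq (A n))"
      by (rule summable_comparison_test'[where g = "\<lambda>n. 3 * (5000 / 6561) ^ n" and N = 0])
        (use le in \<open>auto intro!: summable_mult summable_geometric\<close>)
  qed (auto simp: less_top[symmetric])
  then show ?thesis
  proof eventually_elim
    case (elim \<omega>)
    then show ?case unfolding tame_def
      by eventually_elim (auto simp: A_def not_le intro: less_imp_le)
  qed
qed

lemma distributed_gauss_seq_sum:
  assumes "finite B" "B \<noteq> {}"
  shows "distr gauss_seq borel (\<lambda>\<omega>. (\<Sum>i\<in>B. \<omega> i) / sqrt (card B)) = std_normal_distribution"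
proof -
  have one: "distributed gauss_seq lborel (\<lambda>\<omega>. \<omega> i) std_normal_density" for i
    unfolding distributed_def using distr_gauss_seq_component[of i]
    by (auto simp: cong: distr_cong)
  have "distributed gauss_seq lborel (\<lambda>\<omega>. \<Sum>i\<in>B. \<omega> i) (normal_density (\<Sum>i\<in>B. 0) (sqrt (\<Sum>i\<in>B. 1\<^sup>2)))"
    by (rule gauss_seq.sum_indep_normal) (use assms one in \<open>auto intro: gauss_seq.indep_vars_subset[OF indep_vars_gauss_seq]\<close>)
  then have "distributed gauss_seq lborel (\<lambda>\<omega>. \<Sum>i\<in>B. \<omega> i) (normal_density 0 (sqrt (card B)))"
    by simp
  then have "distributed gauss_seq lborel (\<lambda>\<omega>. ((\<Sum>i\<in>B. \<omega> i) - 0) / sqrt (card B)) std_normal_density"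
    using assms by (subst gauss_seq.normal_standard_normal_convert[symmetric]) (auto simp: card_gt_0_iff)
  then show ?thesis
    by (simp add: distributed_def cong: distr_cong)
qed

section \<open>Independence of the future increments\<close>

text \<open>The normal distribution function, as \<open>P(Z > - z)\<close>: in this form
  \<open>P(y + \<tau> * Z > 0)\<close> is \<open>upper_tail (y / \<tau>)\<close> directly, without
  appeal to symmetry.\<close>

definition upper_tail :: "real \<Rightarrow> real" where
  "upper_tail z = measure std_normal_distribution {- z<..}"

text \<open>Freezing: the coordinates in \<open>B\<close> are independent of those in
  \<open>I\<close>, and their normalised sum is again standard normal, so Tonelli allows integrating
  it out first.\<close>

lemma gauss_seq_integrate_out:
  assumes "finite B" "B \<noteq> {}" "I \<inter> B = {}"
    and H [measurable]: "H \<in> borel_measurable (PiM I (\<lambda>_. borel) \<Otimes>\<^sub>M borel)"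
  shows "(\<integral>\<^sup>+\<omega>. H (restrict \<omega> I, (\<Sum>i\<in>B. \<omega> i) / sqrt (card B)) \<partial>gauss_seq) =
    (\<integral>\<^sup>+\<omega>. (\<integral>\<^sup>+z. H (restrict \<omega> I, z) \<partial>std_normal_distribution) \<partial>gauss_seq)"
proof -
  define R where "R = distr gauss_seq (PiM I (\<lambda>_. borel :: real measure)) (\<lambda>\<omega>. restrict \<omega> I)"
  have Rm [measurable]: "(\<lambda>\<omega>. restrict \<omega> I) \<in> gauss_seq \<rightarrow>\<^sub>M PiM I (\<lambda>_. borel :: real measure)"
    by (rule measurable_restrict) auto
  define z where "z \<omega> = (\<Sum>i\<in>B. \<omega> i) / sqrt (card B)" for \<omega> :: "nat \<Rightarrow> real"
  have zm [measurable]: "z \<in> borel_measurable gauss_seq"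
    unfolding z_def by measurable
  have sm: "(\<lambda>f. (\<Sum>i\<in>B. f i) / sqrt (card B)) \<in> borel_measurable (PiM B (\<lambda>_. borel :: real measure))"
    by (intro borel_measurable_divide borel_measurable_sum measurable_component_singleton) auto
  define S where "S = distr gauss_seq (PiM B (\<lambda>_. borel :: real measure)) (\<lambda>\<omega>. restrict \<omega> B)"
  have Sm [measurable]: "(\<lambda>\<omega>. restrict \<omega> B) \<in> gauss_seq \<rightarrow>\<^sub>M PiM B (\<lambda>_. borel :: real measure)"
    by (rule measurable_restrict) auto
  interpret S: prob_space S unfolding S_def by (rule gauss_seq.prob_space_distr) simp
  define g where "g f = (\<Sum>i\<in>B. f i) / sqrt (card B)" for f :: "nat \<Rightarrow> real"
  have gm [measurable]: "g \<in> borel_measurable (PiM B (\<lambda>_. borel :: real measure))"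
    using sm unfolding g_def .
  have gr: "g (restrict \<omega> B) = z \<omega>" for \<omega>
    by (simp add: g_def z_def)
  have gd: "distr S borel g = std_normal_distribution"
    unfolding S_def using distributed_gauss_seq_sum[OF assms(1,2)]
    by (subst distr_distr) (auto simp: comp_def gr z_def)
  have "gauss_seq.indep_var (PiM I (\<lambda>_. borel)) (\<lambda>\<omega>. restrict (\<lambda>i. \<omega> i) I) (PiM B (\<lambda>_. borel)) (\<lambda>\<omega>. restrict (\<lambda>i. \<omega> i) B)"
    by (rule gauss_seq.indep_var_restrict[OF indep_vars_gauss_seq]) (use assms in auto)
  then have *: "R \<Otimes>\<^sub>M S = distr gauss_seq (PiM I (\<lambda>_. borel) \<Otimes>\<^sub>M PiM B (\<lambda>_. borel)) (\<lambda>\<omega>. (restrict \<omega> I, restrict \<omega> B))"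
    unfolding gauss_seq.indep_var_distribution_eq R_def S_def by simp
  have sets: "sets R = sets (PiM I (\<lambda>_. borel :: real measure))" "sets S = sets (PiM B (\<lambda>_. borel :: real measure))"
    by (simp_all add: R_def S_def)
  note [measurable_cong] = sets
  have "(\<integral>\<^sup>+\<omega>. H (restrict \<omega> I, z \<omega>) \<partial>gauss_seq) = (\<integral>\<^sup>+x. H (fst x, g (snd x)) \<partial>(R \<Otimes>\<^sub>M S))"
    unfolding * by (subst nn_integral_distr) (auto simp: gr)
  also have "\<dots> = (\<integral>\<^sup>+r. (\<integral>\<^sup>+b. H (r, g b) \<partial>S) \<partial>R)"
    by (subst S.nn_integral_fst[symmetric]) auto
  also have "\<dots> = (\<integral>\<^sup>+r. (\<integral>\<^sup>+z. H (r, z) \<partial>std_normal_distribution) \<partial>R)"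
  proof (rule nn_integral_cong)
    fix r assume "r \<in> space R"
    then have r: "r \<in> space (PiM I (\<lambda>_. borel :: real measure))"
      using sets_eq_imp_space_eq[OF sets(1)] by simp
    show "(\<integral>\<^sup>+b. H (r, g b) \<partial>S) = (\<integral>\<^sup>+z. H (r, z) \<partial>std_normal_distribution)"
      unfolding gd[symmetric] by (subst nn_integral_distr) (use r in auto)
  qed
  also have "\<dots> = (\<integral>\<^sup>+\<omega>. (\<integral>\<^sup>+z. H (restrict \<omega> I, z) \<partial>std_normal_distribution) \<partial>gauss_seq)"
    unfolding R_def by (subst nn_integral_distr) (auto intro!: std_normal.borel_measurable_nn_integral)
  finally show ?thesis unfolding z_def .
qed

lemma nn_integral_std_normal_gt:
  assumes "\<tau> > 0"
  shows "(\<integral>\<^sup>+z. indicator {0<..} (y + \<tau> * z) \<partial>std_normal_distribution) = ennreal (upper_tail (y / \<tau>))"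
proof -
  have "(\<integral>\<^sup>+z. indicator {0<..} (y + \<tau> * z) \<partial>std_normal_distribution) =
      (\<integral>\<^sup>+z. indicator {- (y / \<tau>)<..} z \<partial>std_normal_distribution)"
  proof (rule nn_integral_cong)
    fix z
    have "0 < y + \<tau> * z \<longleftrightarrow> - (y / \<tau>) < z"
      using pos_divide_less_eq[OF assms, of "- y" z] by (auto simp: mult.commute)
    then show "indicator {0<..} (y + \<tau> * z) = (indicator {- (y / \<tau>)<..} z :: ennreal)"
      by (simp add: indicator_def)
  qed
  then show ?thesis
    by (simp add: upper_tail_def std_normal.emeasure_eq_measure)
qed

lemma sum_incr_refine:
  "(\<Sum>i\<in>{a..<b}. incr n i \<omega>) = (\<Sum>i\<in>{a * 2 ^ l..<b * 2 ^ l}. incr (n + l) i \<omega>)"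
proof (induction l)
  case (Suc l)
  have pairs: "(\<Sum>i\<in>{a * 2..<b * 2}. f i) = (\<Sum>i\<in>{a..<b}. f (2 * i) + f (Suc (2 * i)))" for a b :: nat and f :: "nat \<Rightarrow> real"
  proof (cases "a \<le> b")
    case True
    then show ?thesis
      by (induction b rule: dec_induct) (simp_all add: mult.commute)
  qed simp
  have "(\<Sum>i\<in>{a * 2 ^ Suc l..<b * 2 ^ Suc l}. incr (n + Suc l) i \<omega>) =
      (\<Sum>i\<in>{(a * 2 ^ l) * 2..<(b * 2 ^ l) * 2}. incr (n + Suc l) i \<omega>)"
    by (simp only: power_Suc2 mult.assoc)
  also have "\<dots> = (\<Sum>i\<in>{a * 2 ^ l..<b * 2 ^ l}. incr (n + l) i \<omega>)"
    unfolding pairs by (simp add: incr_split[of "n + l"])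
  finally show ?case using Suc by simp
qed simp

lemma inj_lead: "inj lead"
proof (rule injI)
  fix i j assume eq: "lead i = lead j"
  have "lead i div 4 = i div 2" "lead j div 4 = j div 2" "lead i mod 4 = i mod 2" "lead j mod 4 = j mod 2"
    by (simp_all add: lead_def)
  then show "i = j" using eq by (metis div_mult_mod_eq)
qed

definition known :: "nat \<Rightarrow> real \<Rightarrow> nat set" where
  "known n s = {i. real i + 1 \<le> 2 ^ n * s}"

definition obs :: "nat \<Rightarrow> real \<Rightarrow> (nat \<Rightarrow> real) \<Rightarrow> nat \<Rightarrow> real" where
  "obs n s \<omega> = restrict (\<lambda>i. incr n i \<omega>) (known n s)"

lemma measurable_obs [measurable]: "obs n s \<in> gauss_seq \<rightarrow>\<^sub>M PiM (known n s) (\<lambda>_. borel)"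
  unfolding obs_def by (rule measurable_restrict) simp

lemma known_dyadic:
  assumes "n \<le> m"
  shows "known m (real a / 2 ^ n) = {..<a * 2 ^ (m - n)}"
proof -
  have "(2::real) ^ m = 2 ^ (m - n) * 2 ^ n"
    using assms by (subst power_add[symmetric]) simp
  then have "2 ^ m * (real a / 2 ^ n) = real (a * 2 ^ (m - n))" by simp
  then have "real i + 1 \<le> 2 ^ m * (real a / 2 ^ n) \<longleftrightarrow> real (Suc i) \<le> real (a * 2 ^ (m - n))" for i
    by (simp only: of_nat_Suc add.commute)
  then show ?thesis unfolding known_def of_nat_le_iff Suc_le_eq by auto
qed

text \<open>The conditional probability of \<open>incr 0 j > c\<close> given the observations up to
  a dyadic time: what is still to come of the increment is an independent centred Gaussian variable.
  The observations may be of any finer level \<open>m\<close>, since all levels occur in the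
  generator of the filtration.\<close>

lemma nn_integral_coin_obs:
  assumes "k < 2 ^ n" "n \<le> m" and s: "s = real (j * 2 ^ n + k) / 2 ^ n"
    and C [measurable]: "C \<in> sets (PiM (known m s) (\<lambda>_. borel))"
  shows "(\<integral>\<^sup>+\<omega>. indicator C (obs m s \<omega>) * indicator {0<..} (incr 0 j \<omega> - c) \<partial>gauss_seq) =
    (\<integral>\<^sup>+\<omega>. indicator C (obs m s \<omega>) *
      ennreal (upper_tail (((\<Sum>i<k. incr n (j * 2 ^ n + i) \<omega>) - c) / sqrt (1 - real k / 2 ^ n))) \<partial>gauss_seq)"
proof -
  define l where "l = m - n"
  have m: "m = n + l" using assms(2) by (simp add: l_def)
  define k' where "k' = (j * 2 ^ n + k) * 2 ^ l"
  define L where "L = Suc j * 2 ^ m"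
  have known: "known m s = {..<k'}"
    unfolding s known_dyadic[OF assms(2)] k'_def l_def ..
  have L: "L = (j * 2 ^ n + 2 ^ n) * 2 ^ l"
    unfolding L_def m by (simp add: power_add algebra_simps)
  have jm: "j * 2 ^ m = (j * 2 ^ n) * 2 ^ l"
    unfolding m power_add by (simp only: mult.assoc)
  have scale: "a * 2 ^ l \<le> b * 2 ^ l" if "a \<le> b" for a b :: nat
    using that by (rule mult_le_mono1)
  have scale': "a * 2 ^ l < b * 2 ^ l" if "a < b" for a b :: nat
    using that by (rule mult_less_mono1) (rule zero_less_power, rule zero_less_numeral)
  have jk: "j * 2 ^ m \<le> k'" unfolding k'_def jm by (rule scale, rule le_add1)
  have kL: "k' < L" unfolding k'_def L by (rule scale', rule add_strict_left_mono, rule assms(1))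
  \<comment> \<open>\<open>refine ^^ m\<close> turns the increments of level \<open>m\<close> into
    the coordinates \<open>lead i\<close> of a sequence with law \<open>gauss_seq\<close>:
    \<open>I\<close> carries those observed by time \<open>s\<close>, and \<open>B\<close> those
    from \<open>s\<close> to the end of the unit interval.\<close>
  define I where "I = lead ` {..<k'}"
  define B where "B = lead ` {k'..<L}"
  have IB: "I \<inter> B = {}" unfolding I_def B_def by (subst image_Int[OF inj_lead, symmetric]) auto
  have B: "finite B" "B \<noteq> {}" using kL by (auto simp: B_def)
  have cardB: "card B = L - k'"
    unfolding B_def by (simp add: card_image inj_on_subset[OF inj_lead])
  \<comment> \<open>The standard deviation of the Brownian increment over the remaining
    time.\<close>
  define \<tau> where "\<tau> = sqrt (card B) / sqrt 2 ^ m"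
  have \<tau>: "\<tau> = sqrt (1 - real k / 2 ^ n)"
  proof -
    have "real (card B) = (2 ^ n - real k) * 2 ^ l"
      unfolding cardB L k'_def using assms(1) by (simp add: of_nat_diff algebra_simps)
    then have "real (card B) / 2 ^ m = 1 - real k / 2 ^ n"
      by (simp add: m power_add diff_divide_distrib)
    moreover have "\<tau> = sqrt (real (card B) / 2 ^ m)"
      by (simp add: \<tau>_def real_sqrt_divide real_sqrt_power)
    ultimately show ?thesis by simp
  qed
  have \<tau>_pos: "\<tau> > 0" unfolding \<tau> using assms(1) by simp
  define f where "f r = restrict (\<lambda>i. r (lead i) / sqrt 2 ^ m) {..<k'}" for r :: "nat \<Rightarrow> real"
  define y where "y r = (\<Sum>i\<in>{j * 2 ^ m..<k'}. r (lead i) / sqrt 2 ^ m) - c" for r :: "nat \<Rightarrow> real"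
  define H :: "(nat \<Rightarrow> real) \<times> real \<Rightarrow> ennreal" where
    "H x = indicator C (f (fst x)) * indicator {0<..} (y (fst x) + \<tau> * snd x)" for x
  have comp: "(\<lambda>r. r (lead i)) \<in> borel_measurable (PiM I (\<lambda>_. borel :: real measure))" if "i < k'" for i
    by (rule measurable_component_singleton) (use that in \<open>auto simp: I_def\<close>)
  have C': "C \<in> sets (PiM {..<k'} (\<lambda>_. borel))" using C known by simp
  have fm [measurable]: "f \<in> PiM I (\<lambda>_. borel) \<rightarrow>\<^sub>M PiM {..<k'} (\<lambda>_. borel)"
    unfolding f_def by (intro measurable_restrict borel_measurable_divide comp) auto
  have ym [measurable]: "y \<in> borel_measurable (PiM I (\<lambda>_. borel))"
    unfolding y_def by (intro borel_measurable_diff borel_measurable_sum borel_measurable_divide comp) auto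
  have Hm [measurable]: "H \<in> borel_measurable (PiM I (\<lambda>_. borel) \<Otimes>\<^sub>M borel)"
    using C' unfolding H_def by measurable
  have f_obs: "f (restrict ((refine ^^ m) \<omega>) I) = obs m s \<omega>" for \<omega>
    unfolding f_def obs_def known incr_def by (auto simp: fun_eq_iff I_def restrict_def)
  have f_restr: "f (restrict \<omega> I) = f \<omega>" and y_restr: "y (restrict \<omega> I) = y \<omega>" for \<omega>
    unfolding f_def y_def by (auto simp: fun_eq_iff I_def restrict_def intro!: sum.cong)
  have y_incr: "y ((refine ^^ m) \<omega>) = (\<Sum>i<k. incr n (j * 2 ^ n + i) \<omega>) - c" for \<omega>
  proof -
    have "(\<Sum>i<k. incr n (j * 2 ^ n + i) \<omega>) = (\<Sum>i\<in>{j * 2 ^ n..<j * 2 ^ n + k}. incr n i \<omega>)"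
      by (rule sum.reindex_bij_witness[of _ "\<lambda>i. i - j * 2 ^ n" "\<lambda>i. j * 2 ^ n + i"]) auto
    also have "\<dots> = (\<Sum>i\<in>{j * 2 ^ m..<k'}. incr m i \<omega>)"
      unfolding sum_incr_refine[of n \<omega> _ _ l] k'_def jm m[symmetric] ..
    finally show ?thesis by (simp add: y_def incr_def)
  qed
  have sum_B: "y ((refine ^^ m) \<omega>) + \<tau> * ((\<Sum>i\<in>B. (refine ^^ m) \<omega> i) / sqrt (card B)) = incr 0 j \<omega> - c" for \<omega>
  proof -
    have "sqrt (card B) > 0" using B by (simp add: card_gt_0_iff)
    then have "\<tau> * ((\<Sum>i\<in>B. (refine ^^ m) \<omega> i) / sqrt (card B)) = (\<Sum>i\<in>B. (refine ^^ m) \<omega> i) / sqrt 2 ^ m"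
      by (simp add: \<tau>_def)
    also have "\<dots> = (\<Sum>i\<in>{k'..<L}. incr m i \<omega>)"
      unfolding B_def by (subst sum.reindex) (auto simp: inj_on_subset[OF inj_lead] incr_def sum_divide_distrib)
    finally have "y ((refine ^^ m) \<omega>) + \<tau> * ((\<Sum>i\<in>B. (refine ^^ m) \<omega> i) / sqrt (card B)) =
        (\<Sum>i\<in>{j * 2 ^ m..<k'}. incr m i \<omega>) + (\<Sum>i\<in>{k'..<L}. incr m i \<omega>) - c"
      by (simp add: y_def incr_def)
    also have "(\<Sum>i\<in>{j * 2 ^ m..<k'}. incr m i \<omega>) + (\<Sum>i\<in>{k'..<L}. incr m i \<omega>) = (\<Sum>i\<in>{j * 2 ^ m..<L}. incr m i \<omega>)"
      using jk kL by (intro sum.atLeastLessThan_concat) auto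
    also have "\<dots> = (\<Sum>i\<in>{j..<Suc j}. incr 0 i \<omega>)"
      unfolding sum_incr_refine[of 0 \<omega> _ _ m] L_def by simp
    finally show ?thesis by simp
  qed
  let ?T = "refine ^^ m"
  \<comment> \<open>Invariance of the law under refinement: it leads from the refined sequence to
    the raw one, where \<open>gauss_seq_integrate_out\<close> applies, and back.\<close>
  have T: "(\<integral>\<^sup>+\<omega>. h (?T \<omega>) \<partial>gauss_seq) = (\<integral>\<^sup>+\<omega>. h \<omega> \<partial>gauss_seq)"
    if "h \<in> borel_measurable gauss_seq" for h
    using that distr_refine_pow[of m]
    by (subst (2) distr_refine_pow[of m, symmetric], subst nn_integral_distr) (auto simp: cong: measurable_cong_sets)
  have restr [measurable]: "(\<lambda>\<omega>. restrict \<omega> I) \<in> gauss_seq \<rightarrow>\<^sub>M PiM I (\<lambda>_. borel :: real measure)"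
    by (rule measurable_restrict) auto
  have "(\<integral>\<^sup>+\<omega>. indicator C (obs m s \<omega>) * indicator {0<..} (incr 0 j \<omega> - c) \<partial>gauss_seq) =
      (\<integral>\<^sup>+\<omega>. H (restrict (?T \<omega>) I, (\<Sum>i\<in>B. ?T \<omega> i) / sqrt (card B)) \<partial>gauss_seq)"
    unfolding H_def fst_conv snd_conv f_obs y_restr sum_B ..
  also have "\<dots> = (\<integral>\<^sup>+\<omega>. H (restrict \<omega> I, (\<Sum>i\<in>B. \<omega> i) / sqrt (card B)) \<partial>gauss_seq)"
    by (rule T) measurable
  also have "\<dots> = (\<integral>\<^sup>+\<omega>. (\<integral>\<^sup>+z. H (restrict \<omega> I, z) \<partial>std_normal_distribution) \<partial>gauss_seq)"
    by (rule gauss_seq_integrate_out[OF B IB Hm])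
  also have "\<dots> = (\<integral>\<^sup>+\<omega>. (\<integral>\<^sup>+z. H (restrict (?T \<omega>) I, z) \<partial>std_normal_distribution) \<partial>gauss_seq)"
    by (rule T[symmetric]) (auto intro!: std_normal.borel_measurable_nn_integral)
  also have "\<dots> = (\<integral>\<^sup>+\<omega>. indicator C (obs m s \<omega>) *
      ennreal (upper_tail (((\<Sum>i<k. incr n (j * 2 ^ n + i) \<omega>) - c) / sqrt (1 - real k / 2 ^ n))) \<partial>gauss_seq)"
    unfolding H_def fst_conv snd_conv f_obs y_restr y_incr
    by (intro nn_integral_cong, subst nn_integral_cmult)
      (simp_all only: nn_integral_std_normal_gt[OF \<tau>_pos], simp_all add: \<tau>)
  finally show ?thesis .
qed

section \<open>The Brownian filtration\<close>

lemma upper_tail_eq_cdf: "upper_tail z = 1 - cdf std_normal_distribution (- z)"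
proof -
  have "{- z<..} = space std_normal_distribution - {..- z}" by auto
  then show ?thesis
    unfolding upper_tail_def cdf_def by (simp only:) (subst std_normal.prob_compl, auto)
qed

lemma upper_tail_bounds: "0 \<le> upper_tail z" "upper_tail z \<le> 1"
  by (simp_all add: upper_tail_def)

lemma null_sets_std_normal_singleton: "{x} \<in> null_sets std_normal_distribution"
proof (subst null_sets_density_iff)
  have "AE y in lborel. y \<in> {x} \<longrightarrow> ennreal (std_normal_density y) = 0"
    using AE_lborel_singleton[of x] by eventually_elim simp
  then show "{x} \<in> sets lborel \<and> (AE y in lborel. y \<in> {x} \<longrightarrow> ennreal (std_normal_density y) = 0)"
    by simp
qed simp

lemma isCont_upper_tail: "isCont upper_tail z"
proof -
  have "isCont (cdf std_normal_distribution) x" for x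
    using null_sets_std_normal_singleton[of x] by (subst std_normal.isCont_cdf) (simp add: measure_def null_setsD1)
  then have "isCont (\<lambda>z. cdf std_normal_distribution (- z)) z"
    by (intro isCont_o2[where f = uminus and g = "cdf std_normal_distribution"] continuous_minus continuous_ident)
  then have "isCont (\<lambda>z. 1 - cdf std_normal_distribution (- z)) z"
    by (rule continuous_diff[OF continuous_const])
  then show ?thesis unfolding upper_tail_eq_cdf[abs_def] .
qed

lemma continuous_on_upper_tail: "continuous_on A upper_tail"
  by (simp add: continuous_at_imp_continuous_on isCont_upper_tail)

lemma upper_tail_at_top: "(upper_tail \<longlongrightarrow> 1) at_top"
  and upper_tail_at_bot: "(upper_tail \<longlongrightarrow> 0) at_bot"
proof -
  have "((\<lambda>z. 1 - cdf std_normal_distribution (- z)) \<longlongrightarrow> 1 - 0) at_top"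
    by (intro tendsto_intros filterlim_compose[OF std_normal.cdf_lim_at_bot] filterlim_uminus_at_bot_at_top)
  then show "(upper_tail \<longlongrightarrow> 1) at_top" unfolding upper_tail_eq_cdf[abs_def] by simp
  have "((\<lambda>z. 1 - cdf std_normal_distribution (- z)) \<longlongrightarrow> 1 - 1) at_bot"
    by (intro tendsto_intros filterlim_compose[OF std_normal.cdf_lim_at_top_prob] filterlim_uminus_at_top_at_bot)
  then show "(upper_tail \<longlongrightarrow> 0) at_bot" unfolding upper_tail_eq_cdf[abs_def] by simp
qed

lemma measurable_upper_tail [measurable]: "upper_tail \<in> borel_measurable borel"
  by (rule borel_measurable_continuous_onI[OF continuous_on_upper_tail])

lemma upper_tail_surj:
  assumes "0 < q" "q < 1"
  obtains c where "upper_tail (- c) = q"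
proof -
  have "\<forall>\<^sub>F z in at_top. upper_tail z > q" "\<forall>\<^sub>F z in at_bot. upper_tail z < q"
    using order_tendstoD[OF upper_tail_at_top] order_tendstoD[OF upper_tail_at_bot] assms by blast+
  then obtain a b where a: "\<And>z. z \<ge> a \<Longrightarrow> upper_tail z > q" and b: "\<And>z. z \<le> b \<Longrightarrow> upper_tail z < q"
    unfolding eventually_at_top_linorder eventually_at_bot_linorder by blast
  have "\<exists>z\<ge>min a b. z \<le> max a b \<and> upper_tail z = q"
    by (rule IVT) (use a[of "max a b"] b[of "min a b"] isCont_upper_tail in \<open>auto intro: less_imp_le\<close>)
  then obtain z where "upper_tail z = q" by blast
  then show ?thesis using that[of "- z"] by simp
qed

section \<open>The completed space and its augmented past\<close>

abbreviation wiener :: "(nat \<Rightarrow> real) measure" where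
  "wiener \<equiv> completion gauss_seq"

interpretation wiener: prob_space wiener
  by (rule gauss_seq.prob_space_completion)

lemma space_wiener [simp]: "space wiener = UNIV"
  by simp

text \<open>
  Up to null sets, events of \<open>past_gen s\<close> depend only on the increments of one dyadic level before
  time \<open>s\<close>; these events form an intersection-stable generator of the augmented filtration.
\<close>

definition past_gen :: "real \<Rightarrow> (nat \<Rightarrow> real) set set" where
  "past_gen s = {A \<in> sets wiener. \<exists>n. \<exists>C\<in>sets (PiM (known n s) (\<lambda>_. borel)). AE \<omega> in wiener. \<omega> \<in> A \<longleftrightarrow> obs n s \<omega> \<in> C}"

definition past :: "real \<Rightarrow> (nat \<Rightarrow> real) measure" where
  "past s = sigma UNIV (past_gen s)"

lemma space_past [simp]: "space (past s) = UNIV"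
  by (simp add: past_def)

lemma sets_past: "sets (past s) = sigma_sets UNIV (past_gen s)"
  by (simp add: past_def)

lemma past_gen_subset: "past_gen s \<subseteq> sets wiener"
  by (auto simp: past_gen_def)

lemma sets_past_subset: "sets (past s) \<subseteq> sets wiener"
  unfolding sets_past using sets.sigma_sets_subset[OF past_gen_subset] by simp

text \<open>An increment is the sum of its two halves, and both halves of an interval that ends by
  time \<open>t\<close> end by then too. So a finer level or a later time reveals at least as
  much.\<close>

lemma obs_factor:
  assumes "n \<le> m" "s \<le> t"
  shows "\<exists>g \<in> PiM (known m t) (\<lambda>_. borel) \<rightarrow>\<^sub>M PiM (known n s) (\<lambda>_. borel). \<forall>\<omega>. g (obs m t \<omega>) = obs n s \<omega>"
  using assms(1)
proof (induction m rule: dec_induct)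
  case base
  have "known n s \<subseteq> known n t"
    unfolding known_def using assms(2) by (auto intro: order_trans mult_left_mono)
  then show ?case
    by (intro bexI[of _ "\<lambda>f. restrict f (known n s)"] measurable_restrict_subset)
      (auto simp: obs_def restrict_def fun_eq_iff)
next
  case (step m)
  from step.IH obtain g where g: "g \<in> PiM (known m t) (\<lambda>_. borel) \<rightarrow>\<^sub>M PiM (known n s) (\<lambda>_. borel)"
    "\<And>\<omega>. g (obs m t \<omega>) = obs n s \<omega>" by blast
  define h where "h f = restrict (\<lambda>i. f (2 * i) + f (Suc (2 * i))) (known m t)" for f :: "nat \<Rightarrow> real"
  have sub: "2 * i \<in> known (Suc m) t" "Suc (2 * i) \<in> known (Suc m) t" if "i \<in> known m t" for i
  proof -
    have "real i + 1 \<le> 2 ^ m * t" using that by (simp add: known_def)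
    then have "real (Suc (2 * i)) + 1 \<le> 2 ^ Suc m * t" "real (2 * i) + 1 \<le> 2 ^ Suc m * t"
      unfolding power_Suc mult.assoc by simp_all
    then show "2 * i \<in> known (Suc m) t" "Suc (2 * i) \<in> known (Suc m) t"
      unfolding known_def by blast+
  qed
  have "h \<in> PiM (known (Suc m) t) (\<lambda>_. borel) \<rightarrow>\<^sub>M PiM (known m t) (\<lambda>_. borel)"
    unfolding h_def by (intro measurable_restrict borel_measurable_add measurable_component_singleton sub)
  moreover have "h (obs (Suc m) t \<omega>) = obs m t \<omega>" for \<omega>
    unfolding h_def obs_def using sub by (auto simp: fun_eq_iff restrict_def incr_split[of m])
  ultimately show ?case
    using g by (intro bexI[of _ "g \<circ> h"] measurable_comp) auto
qed

lemma obs_lift: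
  assumes "n \<le> m" "s \<le> t" "C \<in> sets (PiM (known n s) (\<lambda>_. borel))"
  obtains C' where "C' \<in> sets (PiM (known m t) (\<lambda>_. borel))" "\<And>\<omega>. obs n s \<omega> \<in> C \<longleftrightarrow> obs m t \<omega> \<in> C'"
proof -
  obtain g where g: "g \<in> PiM (known m t) (\<lambda>_. borel) \<rightarrow>\<^sub>M PiM (known n s) (\<lambda>_. borel)"
    "\<And>\<omega>. g (obs m t \<omega>) = obs n s \<omega>"
    using obs_factor[OF assms(1,2)] by blast
  show ?thesis
  proof (rule that)
    show "g -` C \<inter> space (PiM (known m t) (\<lambda>_. borel)) \<in> sets (PiM (known m t) (\<lambda>_. borel))"
      using measurable_sets[OF g(1) assms(3)] .
    show "obs n s \<omega> \<in> C \<longleftrightarrow> obs m t \<omega> \<in> g -` C \<inter> space (PiM (known m t) (\<lambda>_. borel))" for \<omega>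
      using g(2)[of \<omega>] measurable_space[OF measurable_obs, of \<omega> m t] by simp
  qed
qed

lemma Int_stable_past_gen: "Int_stable (past_gen s)"
proof (rule Int_stableI)
  fix A B assume "A \<in> past_gen s" "B \<in> past_gen s"
  then obtain n C m D where AB: "A \<in> sets wiener" "B \<in> sets wiener"
    and C: "C \<in> sets (PiM (known n s) (\<lambda>_. borel))" and D: "D \<in> sets (PiM (known m s) (\<lambda>_. borel))"
    and AE: "AE \<omega> in wiener. \<omega> \<in> A \<longleftrightarrow> obs n s \<omega> \<in> C" "AE \<omega> in wiener. \<omega> \<in> B \<longleftrightarrow> obs m s \<omega> \<in> D"
    by (auto simp: past_gen_def)
  obtain C' where C': "C' \<in> sets (PiM (known (max n m) s) (\<lambda>_. borel))" "\<And>\<omega>. obs n s \<omega> \<in> C \<longleftrightarrow> obs (max n m) s \<omega> \<in> C'"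
    using obs_lift[OF max.cobounded1 order_refl C] by metis
  obtain D' where D': "D' \<in> sets (PiM (known (max n m) s) (\<lambda>_. borel))" "\<And>\<omega>. obs m s \<omega> \<in> D \<longleftrightarrow> obs (max n m) s \<omega> \<in> D'"
    using obs_lift[OF max.cobounded2 order_refl D] by metis
  have "AE \<omega> in wiener. \<omega> \<in> A \<inter> B \<longleftrightarrow> obs (max n m) s \<omega> \<in> C' \<inter> D'"
    using AE by eventually_elim (auto simp: C' D')
  moreover have "C' \<inter> D' \<in> sets (PiM (known (max n m) s) (\<lambda>_. borel))" using C' D' by auto
  ultimately show "A \<inter> B \<in> past_gen s"
    using AB unfolding past_gen_def by blast
qed

lemma null_sets_past: "null_sets wiener \<subseteq> sets (past s)"
proof
  fix A assume A: "A \<in> null_sets wiener"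
  then have "A \<in> past_gen s"
    unfolding past_gen_def by (auto intro!: exI[of _ 0] bexI[of _ "{}"] AE_not_in[OF A])
  then show "A \<in> sets (past s)" unfolding sets_past by auto
qed

lemma incr_measurable_past:
  assumes "real i + 1 \<le> 2 ^ n * s"
  shows "incr n i \<in> borel_measurable (past s)"
proof (rule measurableI)
  fix A :: "real set" assume A [measurable]: "A \<in> sets borel"
  have i: "i \<in> known n s" using assms by (simp add: known_def)
  define C where "C = (\<lambda>f. f i) -` A \<inter> space (PiM (known n s) (\<lambda>_. borel :: real measure))"
  have C: "C \<in> sets (PiM (known n s) (\<lambda>_. borel))"
    unfolding C_def by (rule measurable_sets[OF measurable_component_singleton[OF i] A])
  have "incr n i -` A \<inter> space gauss_seq \<in> sets gauss_seq"
    by (rule measurable_sets[OF measurable_incr A])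
  moreover have "incr n i \<omega> \<in> A \<longleftrightarrow> obs n s \<omega> \<in> C" for \<omega>
    using i measurable_space[OF measurable_obs, of \<omega> n s] by (simp add: C_def obs_def)
  ultimately have "incr n i -` A \<in> past_gen s"
    unfolding past_gen_def using C by (auto intro!: exI[of _ n] bexI[of _ C])
  then show "incr n i -` A \<inter> space (past s) \<in> sets (past s)"
    unfolding sets_past by auto
qed simp

text \<open>Uniqueness of measures: the densities \<open>f\<close> and \<open>g\<close> define
  measures on \<open>past s\<close> that agree on its intersection-stable generator, and
  \<open>le\<close> makes them finite. Levels from \<open>n\<close> on suffice because events of a
  coarser level lift to finer ones; this matters because the conditional probabilities are known
  only at levels at which \<open>s\<close> is a node.\<close>

lemma nn_integral_past_eqI:
  assumes [measurable]: "f \<in> borel_measurable wiener" "g \<in> borel_measurable wiener"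
    and le: "\<And>\<omega>. f \<omega> \<le> 1"
    and eq: "\<And>m C. n \<le> m \<Longrightarrow> C \<in> sets (PiM (known m s) (\<lambda>_. borel)) \<Longrightarrow>
      (\<integral>\<^sup>+\<omega>. indicator C (obs m s \<omega>) * f \<omega> \<partial>wiener) = (\<integral>\<^sup>+\<omega>. indicator C (obs m s \<omega>) * g \<omega> \<partial>wiener)"
    and A: "A \<in> sets (past s)"
  shows "(\<integral>\<^sup>+\<omega>. indicator A \<omega> * f \<omega> \<partial>wiener) = (\<integral>\<^sup>+\<omega>. indicator A \<omega> * g \<omega> \<partial>wiener)"
proof -
  have gen: "(\<integral>\<^sup>+\<omega>. indicator A \<omega> * f \<omega> \<partial>wiener) = (\<integral>\<^sup>+\<omega>. indicator A \<omega> * g \<omega> \<partial>wiener)" if "A \<in> past_gen s" for A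
  proof -
    obtain m C where C: "C \<in> sets (PiM (known m s) (\<lambda>_. borel))"
      and AE: "AE \<omega> in wiener. \<omega> \<in> A \<longleftrightarrow> obs m s \<omega> \<in> C" using \<open>A \<in> past_gen s\<close> by (auto simp: past_gen_def)
    obtain C' where C': "C' \<in> sets (PiM (known (max n m) s) (\<lambda>_. borel))" "\<And>\<omega>. obs m s \<omega> \<in> C \<longleftrightarrow> obs (max n m) s \<omega> \<in> C'"
      using obs_lift[OF max.cobounded2 order_refl C] by metis
    have "(\<integral>\<^sup>+\<omega>. indicator A \<omega> * h \<omega> \<partial>wiener) = (\<integral>\<^sup>+\<omega>. indicator C' (obs (max n m) s \<omega>) * h \<omega> \<partial>wiener)" for h
      by (rule nn_integral_cong_AE) (use AE in eventually_elim, simp add: C' indicator_def)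
    then show ?thesis using eq[OF max.cobounded1 C'(1)] by simp
  qed
  have sub: "subalgebra (density wiener h) (past s)" for h
    using sets_past_subset by (auto simp: subalgebra_def)
  let ?R = "\<lambda>h. restr_to_subalg (density wiener h) (past s)"
  have em: "emeasure (?R h) A = (\<integral>\<^sup>+\<omega>. indicator A \<omega> * h \<omega> \<partial>wiener)" if [measurable]: "h \<in> borel_measurable wiener"
    and A: "A \<in> sets (past s)" for h A
  proof -
    have [measurable]: "A \<in> sets wiener" using A sets_past_subset by blast
    show ?thesis unfolding emeasure_restr_to_subalg[OF sub A] by (subst emeasure_density) (simp_all add: mult.commute)
  qed
  have U: "UNIV \<in> past_gen s"
    unfolding past_gen_def using sets.top[of wiener]
    by (auto intro!: exI[of _ 0] bexI[of _ "space (PiM (known 0 s) (\<lambda>_. borel))"] simp: measurable_space[OF measurable_obs, simplified])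
  have "?R f = ?R g"
  proof (rule measure_eqI_generator_eq[where A = "\<lambda>_. UNIV", OF Int_stable_past_gen])
    show "emeasure (?R f) X = emeasure (?R g) X" if "X \<in> past_gen s" for X
      using that gen[OF that] by (auto simp: em sets_past)
    show "sets (?R f) = sigma_sets UNIV (past_gen s)" "sets (?R g) = sigma_sets UNIV (past_gen s)"
      by (simp_all add: sets_restr_to_subalg[OF sub] sets_past)
    have "(\<integral>\<^sup>+\<omega>. f \<omega> \<partial>wiener) \<le> (\<integral>\<^sup>+\<omega>. 1 \<partial>wiener)" by (intro nn_integral_mono le)
    also have "\<dots> < \<infinity>" using wiener.emeasure_space_1 by simp
    finally show "emeasure (?R f) UNIV \<noteq> \<infinity>" for i :: nat
      using U by (subst em) (auto simp: sets_past)
  qed (use U in auto)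
  then show ?thesis using em[OF assms(1) A] em[OF assms(2) A] by simp
qed

section \<open>Continuous martingales ending in a coin toss\<close>

text \<open>Intersecting over later times gives right-continuity by construction. That the
  martingale identity survives this enlargement is proved in \<open>coin_block_mart\<close>, by
  continuity of the paths.\<close>

definition fil :: "real \<Rightarrow> (nat \<Rightarrow> real) measure" where
  "fil t = sigma UNIV (\<Inter>s\<in>{t<..}. sets (past s))"

lemma space_fil [simp]: "space (fil t) = UNIV"
  by (simp add: fil_def)

lemma sets_fil: "sets (fil t) = (\<Inter>s\<in>{t<..}. sets (past s))"
proof -
  have "sigma_algebra UNIV (\<Inter>s\<in>{t<..}. sets (past s))"
    unfolding sigma_algebra_iff2
    using sets.top[of "past _"] sets.compl_sets[of _ "past _"] by auto
  then have "sigma_sets UNIV (\<Inter>s\<in>{t<..}. sets (past s)) = (\<Inter>s\<in>{t<..}. sets (past s))"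
    by (rule sigma_algebra.sigma_sets_eq)
  then show ?thesis unfolding fil_def by simp
qed

lemma sets_fil_mono: "s \<le> t \<Longrightarrow> sets (fil s) \<subseteq> sets (fil t)"
  unfolding sets_fil by auto

lemma sets_fil_subset: "sets (fil t) \<subseteq> sets wiener"
  using sets_past_subset[of "t + 1"] unfolding sets_fil by auto

lemma sets_fil_past: "t < s \<Longrightarrow> sets (fil t) \<subseteq> sets (past s)"
  unfolding sets_fil by auto

lemma null_sets_fil: "null_sets wiener \<subseteq> sets (fil t)"
  unfolding sets_fil using null_sets_past by auto

lemma fil_right_continuous: "sets (fil t) = (\<Inter>s\<in>{t<..}. sets (fil s))"
proof
  show "sets (fil t) \<subseteq> (\<Inter>s\<in>{t<..}. sets (fil s))"
    using sets_fil_mono[of t] by (auto intro: less_imp_le)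
  show "(\<Inter>s\<in>{t<..}. sets (fil s)) \<subseteq> sets (fil t)"
  proof
    fix A assume A: "A \<in> (\<Inter>s\<in>{t<..}. sets (fil s))"
    have "A \<in> sets (past s)" if s: "t < s" for s
    proof -
      obtain r where r: "t < r" "r < s" using dense[OF s] by blast
      then have "A \<in> sets (fil r)" using A by blast
      then show ?thesis using sets_fil_past[OF r(2)] by blast
    qed
    then show "A \<in> sets (fil t)" unfolding sets_fil by blast
  qed
qed

lemma measurable_fil_iff: "f \<in> borel_measurable (fil t) \<longleftrightarrow> (\<forall>s>t. f \<in> borel_measurable (past s))"
  unfolding measurable_def by (auto simp: sets_fil)

lemma measurable_fil_AE:
  fixes f g :: "(nat \<Rightarrow> real) \<Rightarrow> real"
  assumes g: "g \<in> borel_measurable (fil t)" and AE: "AE \<omega> in wiener. f \<omega> = g \<omega>"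
  shows "f \<in> borel_measurable (fil t)"
proof (rule measurableI)
  fix A :: "real set" assume "A \<in> sets borel"
  then have gA: "g -` A \<in> sets (fil t)" using measurable_sets[OF g] by simp
  obtain N where N: "N \<in> null_sets wiener" "\<And>\<omega>. f \<omega> \<noteq> g \<omega> \<Longrightarrow> \<omega> \<in> N"
    using AE unfolding eventually_ae_filter by auto
  have "g -` A - f -` A \<subseteq> N" "f -` A - g -` A \<subseteq> N"
    by (auto intro!: N(2))
  then have "g -` A - f -` A \<in> null_sets wiener" "f -` A - g -` A \<in> null_sets wiener"
    using null_sets_completion_subset[OF _ N(1)] by blast+
  then have "g -` A - f -` A \<in> sets (fil t)" "f -` A - g -` A \<in> sets (fil t)"
    using null_sets_fil by blast+
  then have "(g -` A - (g -` A - f -` A)) \<union> (f -` A - g -` A) \<in> sets (fil t)"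
    using gA by blast
  moreover have "(g -` A - (g -` A - f -` A)) \<union> (f -` A - g -` A) = f -` A" by blast
  ultimately show "f -` A \<inter> space (fil t) \<in> sets (fil t)" by simp
qed simp

definition coin :: "nat \<Rightarrow> real \<Rightarrow> (nat \<Rightarrow> real) \<Rightarrow> real" where
  "coin j c \<omega> = indicator {0<..} (incr 0 j \<omega> - c)"

text \<open>Tameness gives continuity before the end of the block. At the end, the argument of
  \<open>upper_tail\<close> has a denominator tending to 0 and a numerator tending to
  \<open>incr 0 j \<omega> - c\<close>; only if the latter is nonzero does it diverge with a
  definite sign, so that the path reaches 0 or 1 continuously.\<close>

definition regular :: "nat \<Rightarrow> real \<Rightarrow> (nat \<Rightarrow> real) \<Rightarrow> bool" where
  "regular j c \<omega> \<longleftrightarrow> tame j \<omega> \<and> incr 0 j \<omega> \<noteq> c"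

text \<open>
  The last branch only matters on a null set; it is there because continuity and the end values \<open>0\<close>, \<open>1\<close> are
  needed for every sample point.
\<close>

definition profile :: "nat \<Rightarrow> real \<Rightarrow> real \<Rightarrow> (nat \<Rightarrow> real) \<Rightarrow> real" where
  "profile j c u \<omega> = (if regular j c \<omega>
     then if u < 1 then upper_tail ((bm_path j u \<omega> - c) / sqrt (1 - u)) else coin j c \<omega>
     else upper_tail (- c) + (1 - upper_tail (- c)) * u)"

definition block_mart :: "nat \<Rightarrow> real \<Rightarrow> real \<Rightarrow> (nat \<Rightarrow> real) \<Rightarrow> real" where
  "block_mart j c t \<omega> = profile j c (clamp01 (t - real j)) \<omega>"

lemma AE_regular: "AE \<omega> in wiener. regular j c \<omega>"
proof -
  have i: "incr 0 j = (\<lambda>\<omega>. \<omega> (lead j))" by (rule ext) (simp add: incr_def)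
  have "AE x in distr gauss_seq borel (incr 0 j). x \<noteq> c"
    unfolding i distr_gauss_seq_component
    using AE_not_in[OF null_sets_std_normal_singleton[of c]] by simp
  then have "AE \<omega> in gauss_seq. incr 0 j \<omega> \<noteq> c"
    by (subst (asm) AE_distr_iff) auto
  with AE_tame[of j] have "AE \<omega> in gauss_seq. regular j c \<omega>"
    unfolding regular_def by eventually_elim simp
  then show ?thesis by (rule AE_completion)
qed

lemma coin_bounds: "0 \<le> coin j c \<omega>" "coin j c \<omega> \<le> 1" "coin j c \<omega> \<in> {0, 1}"
  by (auto simp: coin_def indicator_def)

lemma bm_path_0: "bm_path j 0 \<omega> = 0"
  using path_dyadic[of 0 0 j \<omega>] by simp

lemma bm_path_1: "bm_path j 1 \<omega> = incr 0 j \<omega>"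
  using path_dyadic[of 1 0 j \<omega>] by simp

lemma profile_bounds:
  assumes "0 \<le> u" "u \<le> 1"
  shows "0 \<le> profile j c u \<omega>" "profile j c u \<omega> \<le> 1"
proof -
  have "(1 - upper_tail (- c)) * u \<le> (1 - upper_tail (- c)) * 1"
    using assms upper_tail_bounds[of "- c"] by (intro mult_left_mono) auto
  then show "0 \<le> profile j c u \<omega>" "profile j c u \<omega> \<le> 1"
    using assms upper_tail_bounds coin_bounds[of j c \<omega>] by (auto simp: profile_def)
qed

lemma block_mart_bounds: "0 \<le> block_mart j c t \<omega>" "block_mart j c t \<omega> \<le> 1"
  unfolding block_mart_def by (intro profile_bounds clamp01_bounds)+

lemma block_mart_before: "t \<le> real j \<Longrightarrow> block_mart j c t \<omega> = upper_tail (- c)"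
  by (simp add: block_mart_def profile_def clamp01_def bm_path_0)

lemma block_mart_after:
  assumes "real j + 1 \<le> t"
  shows "block_mart j c t \<omega> = (if regular j c \<omega> then coin j c \<omega> else 1)"
proof -
  have "clamp01 (t - real j) = 1" using assms by (simp add: clamp01_def)
  then show ?thesis by (simp add: block_mart_def profile_def)
qed

lemma filterlim_divide_sqrt_at_top:
  assumes b: "(b \<longlongrightarrow> l) (at 1 within {0..1})" and l: "(l::real) > 0"
  shows "filterlim (\<lambda>u. b u / sqrt (1 - u)) at_top (at 1 within {0..1})"
proof -
  have "((\<lambda>u. sqrt (1 - u)) \<longlongrightarrow> sqrt (1 - 1)) (at 1 within {0..1})"
    by (intro tendsto_intros)
  moreover have "\<forall>\<^sub>F u in at 1 within {0..1}. 0 < sqrt (1 - u)"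
    unfolding eventually_at_filter by (intro always_eventually) auto
  ultimately show ?thesis
    by (intro LIM_at_top_divide[OF b l]) auto
qed

lemma continuous_profile: "continuous_on {0..1} (\<lambda>u. profile j c u \<omega>)"
proof (cases "regular j c \<omega>")
  case True
  then have tame: "tame j \<omega>" and ne: "incr 0 j \<omega> \<noteq> c" by (auto simp: regular_def)
  define b where "b u = bm_path j u \<omega> - c" for u
  have b: "continuous_on UNIV b"
    unfolding b_def by (intro continuous_intros continuous_path tame)
  show ?thesis
    unfolding continuous_on_def
  proof
    fix u :: real assume u: "u \<in> {0..1}"
    show "((\<lambda>u. profile j c u \<omega>) \<longlongrightarrow> profile j c u \<omega>) (at u within {0..1})"
    proof (cases "u < 1")
      case u1: True
      have "isCont (\<lambda>u. upper_tail (b u / sqrt (1 - u))) u"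
        using u1 continuous_on_eq_continuous_at[of UNIV b] b
        by (intro isCont_o2[OF _ isCont_upper_tail] continuous_intros) auto
      then have "((\<lambda>u. upper_tail (b u / sqrt (1 - u))) \<longlongrightarrow> upper_tail (b u / sqrt (1 - u))) (at u within {0..1})"
        unfolding isCont_def by (rule tendsto_within_subset) simp
      moreover have "\<forall>\<^sub>F v in at u within {0..1}. v < 1"
        by (rule eventually_at_topological[THEN iffD2]) (use u1 in \<open>auto intro!: exI[of _ "{..<1}"]\<close>)
      then have "\<forall>\<^sub>F v in at u within {0..1}. upper_tail (b v / sqrt (1 - v)) = profile j c v \<omega>"
        by eventually_elim (simp add: profile_def True b_def)
      ultimately have "((\<lambda>u. profile j c u \<omega>) \<longlongrightarrow> upper_tail (b u / sqrt (1 - u))) (at u within {0..1})"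
        by (rule Lim_transform_eventually)
      then show ?thesis using u1 True by (simp add: profile_def b_def)
    next
      case False
      then have u1: "u = 1" using u by simp
      have lim: "(b \<longlongrightarrow> b 1) (at 1 within {0..1})"
        using b unfolding continuous_on_def by (auto intro: tendsto_within_subset)
      have b1: "b 1 = incr 0 j \<omega> - c" by (simp add: b_def bm_path_1)
      have "((\<lambda>u. upper_tail (b u / sqrt (1 - u))) \<longlongrightarrow> coin j c \<omega>) (at 1 within {0..1})"
      proof (cases "b 1 > 0")
        case True
        then show ?thesis
          using filterlim_compose[OF upper_tail_at_top filterlim_divide_sqrt_at_top[OF lim True]]
          by (simp add: coin_def b1)
      next
        case False
        then have neg: "- b 1 > 0" using ne b1 by simp
        have "filterlim (\<lambda>u. - (- b u / sqrt (1 - u))) at_bot (at 1 within {0..1})"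
          using filterlim_divide_sqrt_at_top[OF tendsto_minus[OF lim] neg]
          by (rule filterlim_compose[OF filterlim_uminus_at_bot_at_top])
        then show ?thesis
          using filterlim_compose[OF upper_tail_at_bot, of "\<lambda>u. b u / sqrt (1 - u)"] neg
          by (simp add: coin_def b1)
      qed
      moreover have "\<forall>\<^sub>F v in at 1 within {0..1}. upper_tail (b v / sqrt (1 - v)) = profile j c v \<omega>"
        unfolding eventually_at_filter by (intro always_eventually) (auto simp: profile_def True b_def)
      ultimately have "((\<lambda>u. profile j c u \<omega>) \<longlongrightarrow> coin j c \<omega>) (at 1 within {0..1})"
        by (rule Lim_transform_eventually)
      then show ?thesis using True by (simp add: profile_def u1)
    qed
  qed
next
  case False
  then show ?thesis unfolding profile_def by (simp, intro continuous_intros)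
qed

lemma continuous_block_mart: "continuous_on A (\<lambda>t. block_mart j c t \<omega>)"
  unfolding block_mart_def
  by (rule continuous_on_compose2[OF continuous_profile]) (auto intro!: continuous_intros simp: clamp01_bounds)

section \<open>Adaptedness of the block martingales\<close>

lemma measurable_lim_ignore:
  fixes f :: "nat \<Rightarrow> 'a \<Rightarrow> real"
  assumes "\<And>n. N \<le> n \<Longrightarrow> f n \<in> borel_measurable M"
  shows "(\<lambda>\<omega>. lim (\<lambda>n. f n \<omega>)) \<in> borel_measurable M"
proof -
  have "lim (\<lambda>n. x (n + N)) = lim x" for x :: "nat \<Rightarrow> real"
    unfolding lim_def by (metis LIMSEQ_ignore_initial_segment LIMSEQ_offset)
  from this[symmetric] have "(\<lambda>\<omega>. lim (\<lambda>n. f n \<omega>)) = (\<lambda>\<omega>. lim (\<lambda>n. f (n + N) \<omega>))"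
    by (rule ext)
  moreover have "(\<lambda>\<omega>. lim (\<lambda>n. f (n + N) \<omega>)) \<in> borel_measurable M"
    by (rule borel_measurable_lim_metric) (rule assms, simp)
  ultimately show ?thesis by simp
qed

text \<open>The polygon at time \<open>u\<close> uses the whole increment of the interval that
  contains \<open>u\<close>, and so looks ahead by at most \<open>1 / 2 ^ n\<close>. In the limit,
  \<open>bm_path\<close> becomes measurable for every later time \<open>s\<close>, which is exactly
  what \<open>fil\<close> demands.\<close>

lemma path_approx_measurable_past:
  assumes "real j + u + 1 / 2 ^ n \<le> s"
  shows "(\<lambda>\<omega>. path_approx j n u \<omega>) \<in> borel_measurable (past s)"
  unfolding path_approx_def
proof (rule borel_measurable_sum)
  fix k
  show "(\<lambda>\<omega>. incr n (j * 2 ^ n + k) \<omega> * clamp01 (2 ^ n * u - real k)) \<in> borel_measurable (past s)"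
  proof (cases "real k < 2 ^ n * u")
    case True
    have "2 ^ n * (real j + u + 1 / 2 ^ n) \<le> 2 ^ n * s"
      using assms by (intro mult_left_mono) auto
    then have "real (j * 2 ^ n) + 2 ^ n * u + 1 \<le> 2 ^ n * s"
      by (simp add: algebra_simps)
    then have "real (j * 2 ^ n + k) + 1 \<le> 2 ^ n * s" using True by simp
    then show ?thesis
      by (intro borel_measurable_times incr_measurable_past borel_measurable_const)
  next
    case False
    then have "clamp01 (2 ^ n * u - real k) = 0" by (simp add: clamp01_def)
    then show ?thesis by simp
  qed
qed

lemma bm_path_measurable_past:
  assumes "real j + u < s"
  shows "(\<lambda>\<omega>. bm_path j u \<omega>) \<in> borel_measurable (past s)"
proof -
  obtain n0 where n0: "(1 / 2) ^ n0 < s - (real j + u)"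
    using real_arch_pow_inv[of "s - (real j + u)" "1 / 2"] assms by auto
  show ?thesis
    unfolding bm_path_def
  proof (rule measurable_lim_ignore[where N = n0])
    fix n assume "n0 \<le> n"
    then have "(1 / 2 :: real) ^ n \<le> (1 / 2) ^ n0" by (rule power_decreasing) auto
    then show "(\<lambda>\<omega>. path_approx j n u \<omega>) \<in> borel_measurable (past s)"
      using n0 by (intro path_approx_measurable_past) (simp add: power_one_over)
  qed
qed

lemma block_mart_measurable: "(\<lambda>\<omega>. block_mart j c t \<omega>) \<in> borel_measurable (fil t)"
proof -
  define u where "u = clamp01 (t - real j)"
  consider "t \<le> real j" | "real j \<le> t" "t < real j + 1" | "real j + 1 \<le> t" by linarith
  then show ?thesis
  proof cases
    case 1
    then show ?thesis by (simp add: block_mart_before)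
  next
    case 2
    then have u: "u = t - real j" "u < 1" by (auto simp: u_def clamp01_def)
    have "(\<lambda>\<omega>. upper_tail ((bm_path j u \<omega> - c) / sqrt (1 - u))) \<in> borel_measurable (fil t)"
      unfolding measurable_fil_iff
    proof (intro allI impI)
      fix s assume "t < s"
      then have [measurable]: "(\<lambda>\<omega>. bm_path j u \<omega>) \<in> borel_measurable (past s)"
        by (intro bm_path_measurable_past) (simp add: u)
      show "(\<lambda>\<omega>. upper_tail ((bm_path j u \<omega> - c) / sqrt (1 - u))) \<in> borel_measurable (past s)"
        by measurable
    qed
    moreover have "AE \<omega> in wiener. block_mart j c t \<omega> = upper_tail ((bm_path j u \<omega> - c) / sqrt (1 - u))"
      using AE_regular[of j c] by eventually_elim (simp add: block_mart_def profile_def u_def[symmetric] u(2))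
    ultimately show ?thesis by (rule measurable_fil_AE)
  next
    case 3
    have "coin j c \<in> borel_measurable (fil t)"
      unfolding measurable_fil_iff
    proof (intro allI impI)
      fix s assume "t < s"
      then have [measurable]: "incr 0 j \<in> borel_measurable (past s)"
        using 3 by (intro incr_measurable_past) simp
      show "coin j c \<in> borel_measurable (past s)"
        unfolding coin_def[abs_def] by measurable
    qed
    moreover have "AE \<omega> in wiener. block_mart j c t \<omega> = coin j c \<omega>"
      using AE_regular[of j c] by eventually_elim (simp add: block_mart_after[OF 3])
    ultimately show ?thesis by (rule measurable_fil_AE)
  qed
qed

lemma measurable_fil_wiener: "f \<in> borel_measurable (fil t) \<Longrightarrow> f \<in> borel_measurable wiener"
  using sets_fil_subset[of t] by (auto simp: measurable_def)

lemma block_mart_measurable_wiener [measurable]: "(\<lambda>\<omega>. block_mart j c t \<omega>) \<in> borel_measurable wiener"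
  using block_mart_measurable by (rule measurable_fil_wiener)

lemma coin_measurable [measurable]: "coin j c \<in> borel_measurable wiener"
  using measurable_completion[OF measurable_incr[of 0 j]] unfolding coin_def[abs_def] by measurable

section \<open>The martingale identity for the block martingales\<close>

lemma coin_block_mart_dyadic:
  assumes k: "k < 2 ^ n" and s: "s = real (j * 2 ^ n + k) / 2 ^ n" and A: "A \<in> sets (past s)"
  shows "(\<integral>\<omega>. indicator A \<omega> * coin j c \<omega> \<partial>wiener) = (\<integral>\<omega>. indicator A \<omega> * block_mart j c s \<omega> \<partial>wiener)"
proof -
  let ?g = "\<lambda>\<omega>. upper_tail (((\<Sum>i<k. incr n (j * 2 ^ n + i) \<omega>) - c) / sqrt (1 - real k / 2 ^ n))"
  have [measurable]: "A \<in> sets wiener" using A sets_past_subset by blast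
  have gm [measurable]: "?g \<in> borel_measurable wiener"
    by (rule measurable_completion) measurable
  have "s - real j = real k / 2 ^ n" unfolding s by (simp add: field_simps)
  moreover have "real k / 2 ^ n < 1" using k by simp
  ultimately have u: "clamp01 (s - real j) = real k / 2 ^ n" "real k / 2 ^ n < 1"
    by (auto simp: clamp01_def)
  have AE: "AE \<omega> in wiener. block_mart j c s \<omega> = ?g \<omega>"
    using AE_regular[of j c]
    by eventually_elim (use k in \<open>simp add: block_mart_def profile_def u path_dyadic\<close>)
  have "(\<integral>\<^sup>+\<omega>. indicator A \<omega> * ennreal (coin j c \<omega>) \<partial>wiener) = (\<integral>\<^sup>+\<omega>. indicator A \<omega> * ennreal (?g \<omega>) \<partial>wiener)"
  proof (rule nn_integral_past_eqI[OF _ _ _ _ A, where n = n])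
    fix m and C :: "(nat \<Rightarrow> real) set" assume m: "n \<le> m" and C: "C \<in> sets (PiM (known m s) (\<lambda>_. borel))"
    have "ennreal (coin j c \<omega>) = indicator {0<..} (incr 0 j \<omega> - c)" for \<omega>
      by (simp add: coin_def indicator_def)
    then show "(\<integral>\<^sup>+\<omega>. indicator C (obs m s \<omega>) * ennreal (coin j c \<omega>) \<partial>wiener) =
        (\<integral>\<^sup>+\<omega>. indicator C (obs m s \<omega>) * ennreal (?g \<omega>) \<partial>wiener)"
      unfolding nn_integral_completion using nn_integral_coin_obs[OF k m s C] by simp
  qed (auto simp: coin_bounds)
  also have "\<dots> = (\<integral>\<^sup>+\<omega>. indicator A \<omega> * ennreal (block_mart j c s \<omega>) \<partial>wiener)"
    by (rule nn_integral_cong_AE) (use AE in eventually_elim, simp)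
  finally have *: "(\<integral>\<^sup>+\<omega>. ennreal (indicator A \<omega> * coin j c \<omega>) \<partial>wiener) =
      (\<integral>\<^sup>+\<omega>. ennreal (indicator A \<omega> * block_mart j c s \<omega>) \<partial>wiener)"
    by (simp add: ennreal_mult coin_bounds block_mart_bounds ennreal_indicator)
  show ?thesis
    by (subst (1 2) integral_eq_nn_integral) (auto simp: * coin_bounds block_mart_bounds)
qed

text \<open>Inside the block, \<open>t\<close> is approached from the right by dyadic times
  \<open>s i\<close>: an event of \<open>fil t\<close> belongs to \<open>past (s i)\<close>, and
  continuity of the path with bounded convergence passes to \<open>t\<close>. Before the block, the
  dyadic time \<open>j\<close> serves, where the martingale still has its initial value; after it,
  coin and martingale agree almost surely.\<close>

lemma coin_block_mart:
  assumes t: "0 \<le> t" and A: "A \<in> sets (fil t)"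
  shows "(\<integral>\<omega>. indicator A \<omega> * coin j c \<omega> \<partial>wiener) = (\<integral>\<omega>. indicator A \<omega> * block_mart j c t \<omega> \<partial>wiener)"
proof -
  have Am [measurable]: "A \<in> sets wiener" using A sets_fil_subset by blast
  consider "t < real j" | "real j \<le> t" "t < real j + 1" | "real j + 1 \<le> t" by linarith
  then show ?thesis
  proof cases
    case 1
    have "A \<in> sets (past (real j))" using A sets_fil_past[OF 1] by blast
    then show ?thesis
      using coin_block_mart_dyadic[of 0 0 "real j" j A c] 1 by (simp add: block_mart_before)
  next
    case 2
    \<comment> \<open>Adding 1 to the floor makes \<open>s i\<close> strictly larger than
      \<open>t\<close>, even when \<open>t\<close> itself is dyadic.\<close>
    define s where "s i = (real_of_int \<lfloor>2 ^ i * t\<rfloor> + 1) / 2 ^ i" for i :: nat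
    have s_gt: "t < s i" and s_le: "s i \<le> t + (1 / 2) ^ i" for i
    proof -
      have "2 ^ i * t < real_of_int \<lfloor>2 ^ i * t\<rfloor> + 1" "real_of_int \<lfloor>2 ^ i * t\<rfloor> \<le> 2 ^ i * t" by linarith+
      then show "t < s i" "s i \<le> t + (1 / 2) ^ i" unfolding s_def power_one_over
        by (simp_all add: field_simps)
    qed
    have lim: "s \<longlonglongrightarrow> t"
    proof (rule tendsto_sandwich[of "\<lambda>_. t" _ _ "\<lambda>i. t + (1 / 2) ^ i"])
      have "(\<lambda>i. t + (1 / 2 :: real) ^ i) \<longlonglongrightarrow> t + 0" by (intro tendsto_intros) auto
      then show "(\<lambda>i. t + (1 / 2 :: real) ^ i) \<longlonglongrightarrow> t" by simp
    qed (use s_gt s_le in \<open>auto intro!: always_eventually less_imp_le\<close>)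
    have "\<forall>\<^sub>F i in sequentially. s i < real j + 1"
      using order_tendstoD(2)[OF lim 2(2)] .
    then have ev: "\<forall>\<^sub>F i in sequentially. (\<integral>\<omega>. indicator A \<omega> * block_mart j c (s i) \<omega> \<partial>wiener) =
        (\<integral>\<omega>. indicator A \<omega> * coin j c \<omega> \<partial>wiener)"
    proof eventually_elim
      case (elim i)
      define a where "a = nat (\<lfloor>2 ^ i * t\<rfloor> + 1)"
      have "0 \<le> \<lfloor>2 ^ i * t\<rfloor>" using t by simp
      then have a: "real a = real_of_int \<lfloor>2 ^ i * t\<rfloor> + 1" by (simp add: a_def)
      have sa: "s i = real a / 2 ^ i" by (simp add: s_def a)
      have "real (j * 2 ^ i) < real a"
      proof -
        have "real j * 2 ^ i \<le> t * 2 ^ i" using 2(1) by (intro mult_right_mono) auto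
        also have "t * 2 ^ i < real a" using s_gt[of i] unfolding sa by (simp add: field_simps)
        finally show ?thesis by simp
      qed
      moreover have "real a < real ((j + 1) * 2 ^ i)"
        using elim unfolding sa by (simp add: field_simps)
      ultimately have ja: "j * 2 ^ i < a" "a < (j + 1) * 2 ^ i" unfolding of_nat_less_iff .
      have "A \<in> sets (past (s i))" using A sets_fil_past[OF s_gt] by blast
      then show ?case
        using ja by (intro coin_block_mart_dyadic[of "a - j * 2 ^ i" i, symmetric]) (auto simp: sa)
    qed
    have "(\<lambda>i. \<integral>\<omega>. indicator A \<omega> * block_mart j c (s i) \<omega> \<partial>wiener) \<longlonglongrightarrow> (\<integral>\<omega>. indicator A \<omega> * block_mart j c t \<omega> \<partial>wiener)"
    proof (rule integral_dominated_convergence[where w = "\<lambda>_. 1"])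
      have "(\<lambda>i. block_mart j c (s i) \<omega>) \<longlonglongrightarrow> block_mart j c t \<omega>" for \<omega>
        by (rule continuous_on_tendsto_compose[OF continuous_block_mart[of UNIV j c \<omega>] lim]) auto
      then show "AE \<omega> in wiener. (\<lambda>i. indicator A \<omega> * block_mart j c (s i) \<omega>) \<longlonglongrightarrow> indicator A \<omega> * block_mart j c t \<omega>"
        by (intro always_eventually allI tendsto_intros)
    qed (auto simp: indicator_def block_mart_bounds)
    moreover have "(\<lambda>i. \<integral>\<omega>. indicator A \<omega> * block_mart j c (s i) \<omega> \<partial>wiener) \<longlonglongrightarrow> (\<integral>\<omega>. indicator A \<omega> * coin j c \<omega> \<partial>wiener)"
      by (rule tendsto_eventually[OF ev])
    ultimately show ?thesis using LIMSEQ_unique by blast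
  next
    case 3
    show ?thesis
    proof (rule integral_cong_AE)
      show "AE \<omega> in wiener. indicator A \<omega> * coin j c \<omega> = indicator A \<omega> * block_mart j c t \<omega>"
        using AE_regular[of j c] by eventually_elim (simp add: block_mart_after[OF 3])
    qed measurable
  qed
qed

lemma block_mart_integral_eq:
  assumes "0 \<le> s" "s \<le> t" "A \<in> sets (fil s)"
  shows "(\<integral>\<omega>. indicator A \<omega> * block_mart j c t \<omega> \<partial>wiener) = (\<integral>\<omega>. indicator A \<omega> * block_mart j c s \<omega> \<partial>wiener)"
  using coin_block_mart[of t A j c] coin_block_mart[of s A j c] assms sets_fil_mono[of s t] by auto

text \<open>All that the strategy uses of Brownian motion. The fairness of each bet given the past
  is encoded in \<open>martingale_N\<close> and \<open>N_before\<close>: conditionally on the events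
  up to \<open>real j * d\<close>, the final value of \<open>N j\<close> has mean
  \<open>q\<close>.\<close>

locale coin_blocks = usual_filtered_prob_space P F
  for P :: "'a measure" and F :: "ennreal \<Rightarrow> 'a measure" +
  fixes N :: "nat \<Rightarrow> real \<Rightarrow> 'a \<Rightarrow> real" and q d :: real
  assumes q: "0 < q" "q < 1" and d_pos: "0 < d"
    and martingale_N: "martingale P F (N j)"
    and N_bounds: "0 \<le> N j t \<omega>" "N j t \<omega> \<le> 1"
    and continuous_N: "continuous_on UNIV (\<lambda>t. N j t \<omega>)"
    and N_before: "t \<le> real j * d \<Longrightarrow> N j t \<omega> = q"
    and N_after: "(real j + 1) * d \<le> t \<Longrightarrow> N j t \<omega> = N j ((real j + 1) * d) \<omega>"
    and N_final: "N j ((real j + 1) * d) \<omega> \<in> {0, 1}"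

text \<open>Dividing time by \<open>d\<close> squeezes each bet of unit length into a slot of length
  \<open>d\<close>. Infinity is a separate case because \<open>enn2real\<close> sends it to
  0.\<close>

definition scaled_fil :: "real \<Rightarrow> ennreal \<Rightarrow> (nat \<Rightarrow> real) measure" where
  "scaled_fil d t = (if t = \<infinity> then wiener else fil (enn2real t / d))"

lemma scaled_fil_ennreal: "0 \<le> t \<Longrightarrow> scaled_fil d (ennreal t) = fil (t / d)"
  by (simp add: scaled_fil_def)

lemma sets_scaled_fil_mono:
  assumes "0 < d" "s \<le> t"
  shows "sets (scaled_fil d s) \<subseteq> sets (scaled_fil d t)"
proof (cases "t = \<infinity>")
  case True
  then show ?thesis using sets_fil_subset by (auto simp: scaled_fil_def)
next
  case False
  then have t: "t < top" by (simp add: less_top)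
  then have "s < top" using assms(2) by simp
  have "enn2real s / d \<le> enn2real t / d"
    using enn2real_mono[OF assms(2) t] assms(1) by (simp add: divide_right_mono)
  with \<open>s < top\<close> t show ?thesis
    using sets_fil_mono by (auto simp: scaled_fil_def)
qed

lemma usual_scaled_fil:
  assumes d: "0 < d"
  shows "usual_filtered_prob_space wiener (scaled_fil d)"
proof -
  interpret complete_measure wiener ..
  interpret filtration "space wiener" "scaled_fil d"
    by standard (use sets_scaled_fil_mono[OF d] in \<open>auto simp: scaled_fil_def\<close>)
  show ?thesis
  proof
    show "sets (scaled_fil d t) \<subseteq> sets wiener" for t
      using sets_fil_subset by (auto simp: scaled_fil_def)
    show "null_sets wiener \<subseteq> sets (scaled_fil d 0)"
      using null_sets_fil by (simp add: scaled_fil_def)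
    fix t :: ennreal assume t: "t < \<infinity>"
    show "sets (scaled_fil d t) = (\<Inter>s\<in>{t<..}. sets (scaled_fil d s))"
    proof
      show "sets (scaled_fil d t) \<subseteq> (\<Inter>s\<in>{t<..}. sets (scaled_fil d s))"
        using sets_scaled_fil_mono[OF d, of t] by (auto intro: less_imp_le)
      show "(\<Inter>s\<in>{t<..}. sets (scaled_fil d s)) \<subseteq> sets (scaled_fil d t)"
      proof
        fix A assume A: "A \<in> (\<Inter>s\<in>{t<..}. sets (scaled_fil d s))"
        have "A \<in> sets (fil r)" if r: "enn2real t / d < r" for r
        proof -
          have rd: "enn2real t < r * d" using r d by (simp add: divide_less_eq)
          then have nn: "0 \<le> r * d" using enn2real_nonneg[of t] by linarith
          have "t < ennreal (r * d)"
            using t rd nn by (subst ennreal_enn2real[symmetric]) (auto simp: ennreal_less_iff)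
          then have "A \<in> sets (scaled_fil d (ennreal (r * d)))" using A by blast
          then show ?thesis using nn d by (simp add: scaled_fil_ennreal)
        qed
        then have "A \<in> sets (fil (enn2real t / d))"
          unfolding fil_right_continuous[of "enn2real t / d"] by blast
        then show "A \<in> sets (scaled_fil d t)" using t by (simp add: scaled_fil_def)
      qed
    qed
  qed
qed

lemma martingale_block_mart:
  assumes d: "0 < d"
  shows "martingale wiener (scaled_fil d) (\<lambda>t. block_mart j c (t / d))"
  unfolding martingale_def
proof (intro conjI allI impI)
  show "adapted (scaled_fil d) (\<lambda>t. block_mart j c (t / d))"
    unfolding adapted_def using block_mart_measurable by (auto simp: scaled_fil_ennreal)
  have int: "integrable wiener (block_mart j c t)" for t
    by (rule wiener.integrable_const_bound[where B = 1]) (auto simp: block_mart_bounds)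
  then show "integrable wiener (block_mart j c (t / d))" for t .
  fix s t :: real assume st: "0 \<le> s \<and> s \<le> t"
  then have s: "0 \<le> s / d" "s / d \<le> t / d" using d by (auto simp: divide_right_mono)
  interpret finite_measure_subalgebra wiener "fil (s / d)"
    by standard (use sets_fil_subset in \<open>auto simp: subalgebra_def\<close>)
  have "AE \<omega> in wiener. real_cond_exp wiener (fil (s / d)) (block_mart j c (t / d)) \<omega> = block_mart j c (s / d) \<omega>"
  proof (rule real_cond_exp_charact)
    show "(\<integral>\<omega>\<in>A. block_mart j c (t / d) \<omega> \<partial>wiener) = (\<integral>\<omega>\<in>A. block_mart j c (s / d) \<omega> \<partial>wiener)"
      if "A \<in> sets (fil (s / d))" for A
      using block_mart_integral_eq[OF s that] by (simp add: set_lebesgue_integral_def)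
  qed (use int block_mart_measurable in auto)
  then show "AE \<omega> in wiener. real_cond_exp wiener (scaled_fil d (ennreal s)) (block_mart j c (t / d)) \<omega> = block_mart j c (s / d) \<omega>"
    using st by (simp add: scaled_fil_ennreal)
qed

lemma exists_coin_blocks:
  assumes "0 < q" "q < 1" "0 < d"
  shows "\<exists>(P :: sample measure) F N. coin_blocks P F N q d"
proof -
  obtain c where c: "upper_tail (- c) = q" using upper_tail_surj[OF assms(1,2)] by blast
  interpret usual_filtered_prob_space wiener "scaled_fil d" by (rule usual_scaled_fil[OF assms(3)])
  have "coin_blocks wiener (scaled_fil d) (\<lambda>j t. block_mart j c (t / d)) q d"
  proof
    fix j t \<omega>
    show "martingale wiener (scaled_fil d) (\<lambda>t. block_mart j c (t / d))"
      by (rule martingale_block_mart[OF assms(3)])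
    show "continuous_on UNIV (\<lambda>t. block_mart j c (t / d) \<omega>)"
      by (rule continuous_on_compose2[OF continuous_block_mart[of UNIV]]) (use assms in \<open>auto intro!: continuous_intros\<close>)
    show "block_mart j c (t / d) \<omega> = q" if "t \<le> real j * d"
      using that assms(3) by (subst block_mart_before) (auto simp: c divide_le_eq)
    have *: "block_mart j c (t / d) \<omega> = (if regular j c \<omega> then coin j c \<omega> else 1)" if "(real j + 1) * d \<le> t" for t
      using that assms(3) by (intro block_mart_after) (simp add: le_divide_eq)
    show "block_mart j c ((real j + 1) * d / d) \<omega> \<in> {0, 1}"
      using coin_bounds(3)[of j c \<omega>] by (subst *) auto
    show "block_mart j c (t / d) \<omega> = block_mart j c ((real j + 1) * d / d) \<omega>" if "(real j + 1) * d \<le> t"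
      using *[OF that] *[OF order_refl] by simp
  qed (use assms block_mart_bounds in auto)
  then show ?thesis by blast
qed

section \<open>The betting strategy\<close>

text \<open>A period consists of \<open>W\<close> waiting slots and \<open>m\<close> bets, each of
  length \<open>d\<close>; nothing moves after \<open>J\<close> slots. By \<open>W_le\<close> a
  waiting phase lasts at most 1, so the capital it yields does not exceed the current maximum; this
  is what \<open>level_le_peak\<close> rests on.\<close>

locale coin_strategy = coin_blocks P F N q d
  for P :: "'a measure" and F :: "ennreal \<Rightarrow> 'a measure" and N :: "nat \<Rightarrow> real \<Rightarrow> 'a \<Rightarrow> real" and q d :: real +
  fixes W m J :: nat
  assumes W_pos: "0 < W" and W_le: "real W * d \<le> 1"
begin

definition toss :: "nat \<Rightarrow> 'a \<Rightarrow> real" where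
  "toss j \<omega> = N j ((real j + 1) * d) \<omega>"

definition waiting :: "nat \<Rightarrow> bool" where
  "waiting j \<longleftrightarrow> j mod (W + m) < W"

text \<open>
  A state consists of the maximum reached so far and of the current capital, which is restarted at every
  waiting phase; what was left of it is never used again.
\<close>

primrec state :: "nat \<Rightarrow> 'a \<Rightarrow> real \<times> real" where
  "state 0 \<omega> = (1, 0)"
| "state (Suc j) \<omega> = (let (S, x) = state j \<omega> in
     if waiting j then (S, (real (j mod (W + m)) + 1) * d * S)
     else (max S (toss j \<omega> * x / q), toss j \<omega> * x / q))"

definition peak :: "nat \<Rightarrow> 'a \<Rightarrow> real" where "peak j \<omega> = fst (state j \<omega>)"

definition level :: "nat \<Rightarrow> 'a \<Rightarrow> real" where "level j \<omega> = snd (state j \<omega>)"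

lemma peak_0 [simp]: "peak 0 \<omega> = 1" and level_0 [simp]: "level 0 \<omega> = 0"
  by (simp_all add: peak_def level_def)

lemma peak_Suc: "peak (Suc j) \<omega> = (if waiting j then peak j \<omega> else max (peak j \<omega>) (toss j \<omega> * level j \<omega> / q))"
  and level_Suc: "level (Suc j) \<omega> = (if waiting j then (real (j mod (W + m)) + 1) * d * peak j \<omega> else toss j \<omega> * level j \<omega> / q)"
  by (simp_all add: peak_def level_def case_prod_beta Let_def)

lemma toss_cases: "toss j \<omega> \<in> {0, 1}"
  unfolding toss_def by (rule N_final)

lemma toss_bounds: "0 \<le> toss j \<omega>" "toss j \<omega> \<le> 1"
  using toss_cases[of j \<omega>] by auto

lemma peak_ge_1: "1 \<le> peak j \<omega>"
  by (induction j) (auto simp: peak_Suc le_max_iff_disj)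

lemma waiting_time_le:
  assumes "waiting j"
  shows "(real (j mod (W + m)) + 1) * d \<le> 1"
proof -
  have "real (j mod (W + m)) + 1 \<le> real W" using assms by (simp add: waiting_def)
  then have "(real (j mod (W + m)) + 1) * d \<le> real W * d" using d_pos by (intro mult_right_mono) auto
  then show ?thesis using W_le by linarith
qed

lemma level_nonneg: "0 \<le> level j \<omega>"
proof (induction j)
  case (Suc j)
  then show ?case using peak_ge_1[of j \<omega>] d_pos q toss_bounds[of j \<omega>]
    by (auto simp: level_Suc intro!: mult_nonneg_nonneg divide_nonneg_nonneg)
qed simp

lemma level_le_peak: "level j \<omega> \<le> peak j \<omega>"
proof (cases j)
  case (Suc i)
  show ?thesis
  proof (cases "waiting i")
    case True
    have "(real (i mod (W + m)) + 1) * d * peak i \<omega> \<le> 1 * peak i \<omega>"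
      using waiting_time_le[OF True] peak_ge_1[of i \<omega>] by (intro mult_right_mono) auto
    then show ?thesis using True by (simp add: Suc level_Suc peak_Suc)
  qed (simp add: Suc level_Suc peak_Suc)
qed simp

text \<open>Crude, but deterministic: it bounds the powers of the state and the stakes, and thereby
  settles their integrability.\<close>

lemma peak_le: "peak j \<omega> \<le> (1 / q) ^ j"
proof (induction j)
  case (Suc j)
  have p: "0 \<le> peak j \<omega>" using peak_ge_1[of j \<omega>] by linarith
  have "toss j \<omega> * level j \<omega> \<le> 1 * peak j \<omega>"
    by (intro mult_mono toss_bounds level_le_peak level_nonneg) auto
  then have 1: "toss j \<omega> * level j \<omega> / q \<le> peak j \<omega> / q"
    using q by (intro divide_right_mono) auto
  have "peak j \<omega> * q \<le> peak j \<omega> * 1" using p q by (intro mult_left_mono) auto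
  then have 2: "peak j \<omega> \<le> peak j \<omega> / q" using q by (simp add: le_divide_eq)
  have "peak (Suc j) \<omega> \<le> peak j \<omega> / q" using 1 2 by (simp add: peak_Suc)
  also have "\<dots> \<le> (1 / q) ^ j / q" using Suc q by (intro divide_right_mono) auto
  finally show ?case by simp
qed simp

lemma time_nonneg: "0 \<le> real j * d"
  using d_pos by simp

lemma time_mono: "i \<le> j \<Longrightarrow> real i * d \<le> real j * d"
  using d_pos by (intro mult_right_mono) auto

lemma measurable_F_mono:
  assumes "s \<le> t" "f \<in> borel_measurable (F s)"
  shows "f \<in> borel_measurable (F t)"
  using assms sets_F_mono[OF assms(1)] unfolding measurable_def by (auto simp: space_F)

lemma measurable_F_P: "f \<in> borel_measurable (F s) \<Longrightarrow> f \<in> borel_measurable P"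
  using sets_F_subset[of s] unfolding measurable_def by (auto simp: space_F)

lemma N_adapted: "0 \<le> t \<Longrightarrow> N j t \<in> borel_measurable (F (ennreal t))"
  using martingale_N[of j] unfolding martingale_def adapted_def by simp

lemma toss_measurable: "toss j \<in> borel_measurable (F (ennreal (real (Suc j) * d)))"
proof -
  have "N j ((real j + 1) * d) \<in> borel_measurable (F (ennreal ((real j + 1) * d)))"
    using d_pos by (intro N_adapted) simp
  then show ?thesis by (simp add: toss_def[abs_def] add.commute)
qed

lemma state_measurable:
  "peak j \<in> borel_measurable (F (ennreal (real j * d)))"
  "level j \<in> borel_measurable (F (ennreal (real j * d)))"
proof (induction j)
  case 0
  have "peak 0 = (\<lambda>_. 1)" "level 0 = (\<lambda>_. 0)" by (auto simp: fun_eq_iff)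
  then show "peak 0 \<in> borel_measurable (F (ennreal (real 0 * d)))" "level 0 \<in> borel_measurable (F (ennreal (real 0 * d)))"
    by simp_all
next
  case (Suc j)
  have le: "ennreal (real j * d) \<le> ennreal (real (Suc j) * d)"
    using time_mono[of j "Suc j"] by (intro ennreal_leI) simp
  note [measurable] = measurable_F_mono[OF le Suc(1)] measurable_F_mono[OF le Suc(2)] toss_measurable[of j]
  show "peak (Suc j) \<in> borel_measurable (F (ennreal (real (Suc j) * d)))"
    unfolding peak_Suc[abs_def] by (cases "waiting j") (simp_all del: of_nat_Suc, measurable)
  show "level (Suc j) \<in> borel_measurable (F (ennreal (real (Suc j) * d)))"
    unfolding level_Suc[abs_def] by (cases "waiting j") (simp_all del: of_nat_Suc, measurable)
qed

text \<open>Chosen so that \<open>x + x / q * (N - q) = x * N / q\<close>: the bet turns the capital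
  \<open>x\<close> into \<open>x / q\<close> or 0.\<close>

definition stake :: "nat \<Rightarrow> 'a \<Rightarrow> real" where
  "stake j \<omega> = (if waiting j then 0 else level j \<omega> / q)"

definition gain :: "nat \<Rightarrow> 'a \<Rightarrow> real" where
  "gain j \<omega> = (if waiting j then d * peak j \<omega> else 0)"

text \<open>The condition on the process is an inequality, so the drift may grow at the rate
  \<open>peak\<close>, constant on each slot, instead of the true running maximum; no integral
  equation has to be solved.\<close>

definition drift :: "real \<Rightarrow> 'a \<Rightarrow> real" where
  "drift t \<omega> = (\<Sum>j<J. gain j \<omega> * clamp01 (t / d - real j))"

definition bet :: "real \<Rightarrow> 'a \<Rightarrow> real" where
  "bet t \<omega> = (\<Sum>j<J. stake j \<omega> * (N j t \<omega> - q))"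

definition wealth :: "real \<Rightarrow> 'a \<Rightarrow> real" where
  "wealth t \<omega> = 1 + drift t \<omega> + bet t \<omega>"

lemma stake_nonneg: "0 \<le> stake j \<omega>"
  using level_nonneg[of j \<omega>] q by (simp add: stake_def)

lemma gain_nonneg: "0 \<le> gain j \<omega>"
  using peak_ge_1[of j \<omega>] d_pos by (simp add: gain_def)

lemma level_waiting: "j mod (W + m) \<le> W \<Longrightarrow> real (j mod (W + m)) * d * peak j \<omega> \<le> level j \<omega>"
proof (cases j)
  case (Suc i)
  assume le: "j mod (W + m) \<le> W"
  show ?thesis
  proof (cases "j mod (W + m) = 0")
    case True
    then show ?thesis using level_nonneg[of j \<omega>] by simp
  next
    case False
    then have eq: "j mod (W + m) = Suc (i mod (W + m))"
      unfolding Suc mod_Suc by (auto split: if_splits)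
    then have "waiting i" using le by (simp add: waiting_def)
    then show ?thesis by (simp only: eq) (simp add: Suc level_Suc peak_Suc add.commute)
  qed
qed (use level_nonneg in simp)

text \<open>Equality is lost only at the start of a waiting phase: there \<open>level\<close> is
  reset as if nothing had been left, while the sum keeps the nonnegative remainder.\<close>

lemma level_le_sum: "level n \<omega> \<le> (\<Sum>j<n. gain j \<omega> + stake j \<omega> * (toss j \<omega> - q))"
proof (induction n)
  case (Suc n)
  have "level (Suc n) \<omega> \<le> level n \<omega> + (gain n \<omega> + stake n \<omega> * (toss n \<omega> - q))"
  proof (cases "waiting n")
    case True
    then have "real (n mod (W + m)) * d * peak n \<omega> \<le> level n \<omega>"
      by (intro level_waiting) (simp add: waiting_def)
    then show ?thesis using True by (simp add: level_Suc gain_def stake_def algebra_simps)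
  next
    case False
    have "level n \<omega> / q * (toss n \<omega> - q) = toss n \<omega> * level n \<omega> / q - level n \<omega>"
      using q by (simp add: field_simps)
    then show ?thesis using False by (simp add: level_Suc gain_def stake_def)
  qed
  then show ?case using Suc by simp
qed simp

lemma N_toss: "(real j + 1) * d \<le> t \<Longrightarrow> N j t \<omega> = toss j \<omega>"
  unfolding toss_def by (rule N_after)

lemma clamp01_before: "t \<le> real j * d \<Longrightarrow> clamp01 (t / d - real j) = 0"
proof -
  assume "t \<le> real j * d"
  then have "t / d \<le> real j" using d_pos by (simp add: divide_le_eq)
  then show ?thesis by (simp add: clamp01_def)
qed

lemma clamp01_after: "(real j + 1) * d \<le> t \<Longrightarrow> clamp01 (t / d - real j) = 1"
proof -
  assume "(real j + 1) * d \<le> t"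
  then have "real j + 1 \<le> t / d" using d_pos by (simp add: le_divide_eq)
  then show ?thesis by (simp add: clamp01_def)
qed

lemma wealth_sum: "wealth t \<omega> = 1 + (\<Sum>j<J. gain j \<omega> * clamp01 (t / d - real j) + stake j \<omega> * (N j t \<omega> - q))"
  by (simp add: wealth_def drift_def bet_def sum.distrib)

lemma partial_sum_eq:
  assumes "real n * d \<le> t"
  shows "(\<Sum>j<n. gain j \<omega> * clamp01 (t / d - real j) + stake j \<omega> * (N j t \<omega> - q)) =
    (\<Sum>j<n. gain j \<omega> + stake j \<omega> * (toss j \<omega> - q))"
proof (rule sum.cong)
  fix j assume "j \<in> {..<n}"
  then have "real (Suc j) * d \<le> real n * d" by (intro time_mono) auto
  then have "(real j + 1) * d \<le> t" using assms by (simp add: add.commute)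
  then show "gain j \<omega> * clamp01 (t / d - real j) + stake j \<omega> * (N j t \<omega> - q) = gain j \<omega> + stake j \<omega> * (toss j \<omega> - q)"
    by (simp add: N_toss clamp01_after)
qed simp

text \<open>Slots that have not begun contribute 0. Slot \<open>n\<close> can lose at most
  \<open>stake n \<omega> * q\<close>, that is, \<open>level n \<omega>\<close>, and the completed
  slots before it have earned at least that by \<open>level_le_sum\<close>.\<close>

lemma partial_sum_nonneg:
  "0 \<le> (\<Sum>j<n. gain j \<omega> * clamp01 (t / d - real j) + stake j \<omega> * (N j t \<omega> - q))"
proof (induction n)
  case (Suc n)
  show ?case
  proof (cases "t \<le> real n * d")
    case True
    then show ?thesis using Suc by (simp add: clamp01_before N_before)
  next
    case False
    have "level n \<omega> \<le> (\<Sum>j<n. gain j \<omega> * clamp01 (t / d - real j) + stake j \<omega> * (N j t \<omega> - q))"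
      using level_le_sum[of n \<omega>] False by (subst partial_sum_eq) auto
    moreover have "- level n \<omega> \<le> stake n \<omega> * (N n t \<omega> - q)"
    proof (cases "waiting n")
      case True
      then show ?thesis using level_nonneg[of n \<omega>] by (simp add: stake_def)
    next
      case False
      have "stake n \<omega> * (- q) \<le> stake n \<omega> * (N n t \<omega> - q)"
        using N_bounds[of n t \<omega>] by (intro mult_left_mono stake_nonneg) simp
      then show ?thesis using False q by (simp add: stake_def)
    qed
    moreover have "0 \<le> gain n \<omega> * clamp01 (t / d - real n)"
      by (intro mult_nonneg_nonneg gain_nonneg clamp01_bounds)
    ultimately show ?thesis by simp
  qed
qed simp

lemma wealth_ge_1: "1 \<le> wealth t \<omega>"
  unfolding wealth_sum using partial_sum_nonneg[where n = J] by simp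

lemma level_le_wealth:
  assumes "n \<le> J"
  shows "level n \<omega> \<le> wealth (real n * d) \<omega>"
proof -
  let ?f = "\<lambda>j. gain j \<omega> * clamp01 (real n * d / d - real j) + stake j \<omega> * (N j (real n * d) \<omega> - q)"
  have "(\<Sum>j<J. ?f j) = (\<Sum>j<n. ?f j)"
  proof (rule sum.mono_neutral_right)
    show "\<forall>i\<in>{..<J} - {..<n}. ?f i = 0"
    proof
      fix i assume "i \<in> {..<J} - {..<n}"
      then have "real n * d \<le> real i * d" by (intro time_mono) auto
      then show "?f i = 0" by (simp only: clamp01_before N_before) simp
    qed
  qed (use assms in auto)
  also have "\<dots> = (\<Sum>j<n. gain j \<omega> + stake j \<omega> * (toss j \<omega> - q))"
    by (rule partial_sum_eq) simp
  finally show ?thesis using level_le_sum[of n \<omega>] unfolding wealth_sum by linarith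
qed

lemma continuous_wealth: "continuous_on A (\<lambda>t. wealth t \<omega>)"
  unfolding wealth_def drift_def bet_def
  by (intro continuous_intros continuous_on_subset[OF continuous_N]) (use d_pos in auto)

lemma continuous_bet: "continuous_on A (\<lambda>t. bet t \<omega>)"
  unfolding bet_def by (intro continuous_intros continuous_on_subset[OF continuous_N]) auto

lemma bdd_above_wealth: "bdd_above ((\<lambda>s. wealth s \<omega>) ` {0..t})"
  by (intro bounded_imp_bdd_above compact_imp_bounded compact_continuous_image continuous_wealth) auto

lemma wealth_le_running_sup: "0 \<le> s \<Longrightarrow> s \<le> t \<Longrightarrow> wealth s \<omega> \<le> running_sup wealth t \<omega>"
  unfolding running_sup_def by (rule cSUP_upper[OF _ bdd_above_wealth]) simp

lemma running_sup_mono: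
  assumes "0 \<le> s" "s \<le> t"
  shows "running_sup wealth s \<omega> \<le> running_sup wealth t \<omega>"
  unfolding running_sup_def by (rule cSUP_subset_mono[OF _ bdd_above_wealth]) (use assms in auto)

text \<open>Every new peak is a \<open>level\<close>, and the wealth at the end of the slot is at
  least that.\<close>

lemma peak_le_running_sup: "n \<le> J \<Longrightarrow> peak n \<omega> \<le> running_sup wealth (real n * d) \<omega>"
proof (induction n)
  case 0
  then show ?case using wealth_le_running_sup[of 0 0 \<omega>] wealth_ge_1[of 0 \<omega>] by simp
next
  case (Suc n)
  have le: "real n * d \<le> real (Suc n) * d" by (rule time_mono) simp
  have "peak n \<omega> \<le> running_sup wealth (real (Suc n) * d) \<omega>"
    using Suc running_sup_mono[OF time_nonneg le, of \<omega>] by simp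
  moreover have "level (Suc n) \<omega> \<le> running_sup wealth (real (Suc n) * d) \<omega>"
    using level_le_wealth[OF Suc.prems, of \<omega>] wealth_le_running_sup[OF time_nonneg order_refl, of "Suc n" \<omega>] by linarith
  ultimately show ?case by (simp add: peak_Suc level_Suc split: if_splits)
qed

lemma running_sup_integrable:
  assumes "0 \<le> a"
  shows "(\<lambda>s. running_sup wealth s \<omega>) integrable_on {a..b}"
  by (rule integrable_on_mono_on) (use assms in \<open>auto simp: mono_on_def intro!: running_sup_mono\<close>)

text \<open>During slot \<open>n\<close> the drift has rate at most \<open>peak n\<close>, a value
  fixed at the start of the slot, and from then on the running supremum is at least as large.
  Summation over slots gives the claim.\<close>

lemma drift_le_integral:
  assumes t: "0 \<le> t"
  shows "drift t \<omega> \<le> integral {0..t} (\<lambda>s. running_sup wealth s \<omega>)"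
proof -
  let ?R = "\<lambda>s. running_sup wealth s \<omega>"
  have R_nonneg: "0 \<le> ?R s" if "0 \<le> s" for s
    using wealth_le_running_sup[OF that order_refl] wealth_ge_1 order_trans[of 0 1] by (meson order_trans zero_le_one)
  have "n \<le> J \<Longrightarrow> (\<Sum>j<n. gain j \<omega> * clamp01 (t / d - real j)) \<le> integral {0..min t (real n * d)} ?R" for n
  proof (induction n)
    case 0
    then show ?case using t by (simp add: min_def)
  next
    case (Suc n)
    show ?case
    proof (cases "t \<le> real n * d")
      case True
      then have "t \<le> real (Suc n) * d" using time_mono[of n "Suc n"] by linarith
      then show ?thesis using Suc True by (simp add: clamp01_before min_absorb1)
    next
      case False
      define u where "u = min t (real (Suc n) * d)"
      have nu: "real n * d \<le> u" using False time_mono[of n "Suc n"] by (simp add: u_def)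
      have "gain n \<omega> * clamp01 (t / d - real n) \<le> peak n \<omega> * (d * clamp01 (t / d - real n))"
        using clamp01_bounds(1)[of "t / d - real n"] peak_ge_1[of n \<omega>] d_pos by (simp add: gain_def)
      also have "d * clamp01 (t / d - real n) = u - real n * d"
        using False d_pos by (auto simp: u_def clamp01_def min_def field_simps)
      also have "peak n \<omega> * (u - real n * d) = integral {real n * d..u} (\<lambda>_. peak n \<omega>)"
        using nu by simp
      also have "\<dots> \<le> integral {real n * d..u} ?R"
      proof (rule integral_le)
        fix s assume "s \<in> {real n * d..u}"
        then show "peak n \<omega> \<le> ?R s"
          using peak_le_running_sup[of n \<omega>] running_sup_mono[OF time_nonneg, of n s \<omega>] Suc.prems by simp
      qed (auto intro!: running_sup_integrable time_nonneg)
      finally have "gain n \<omega> * clamp01 (t / d - real n) \<le> integral {real n * d..u} ?R" .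
      moreover have "integral {0..real n * d} ?R + integral {real n * d..u} ?R = integral {0..u} ?R"
        by (rule Henstock_Kurzweil_Integration.integral_combine) (auto intro!: running_sup_integrable time_nonneg nu)
      ultimately show ?thesis using Suc False by (simp add: u_def min_absorb2)
    qed
  qed
  from this[of J] have "drift t \<omega> \<le> integral {0..min t (real J * d)} ?R"
    by (simp add: drift_def)
  also have "\<dots> \<le> integral {0..t} ?R"
    by (rule integral_subset_le) (use R_nonneg in \<open>auto intro!: running_sup_integrable\<close>)
  finally show ?thesis .
qed

section \<open>Martingale property of the accumulated bets\<close>

lemma finite_measure_subalgebra_F: "finite_measure_subalgebra P (F s)"
  by standard (use sets_F_subset in \<open>auto simp: subalgebra_def space_F\<close>)

lemma stake_measurable: "stake j \<in> borel_measurable (F (ennreal (real j * d)))"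
proof -
  note [measurable] = state_measurable[of j]
  show ?thesis unfolding stake_def[abs_def] by measurable
qed

lemma gain_measurable: "gain j \<in> borel_measurable (F (ennreal (real j * d)))"
proof -
  note [measurable] = state_measurable[of j]
  show ?thesis unfolding gain_def[abs_def] by measurable
qed

lemma stake_le: "stake j \<omega> \<le> (1 / q) ^ Suc j"
proof -
  have "stake j \<omega> \<le> level j \<omega> / q" using level_nonneg[of j \<omega>] q by (simp add: stake_def)
  also have "\<dots> \<le> (1 / q) ^ j / q"
    using level_le_peak[of j \<omega>] peak_le[of j \<omega>] q by (intro divide_right_mono) auto
  finally show ?thesis by simp
qed

lemma bet_term_measurable:
  assumes "0 \<le> t"
  shows "(\<lambda>\<omega>. stake j \<omega> * (N j t \<omega> - q)) \<in> borel_measurable (F (ennreal t))"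
proof (cases "t \<le> real j * d")
  case True
  then show ?thesis by (simp add: N_before)
next
  case False
  then have "ennreal (real j * d) \<le> ennreal t" by (intro ennreal_leI) simp
  note [measurable] = measurable_F_mono[OF this stake_measurable[of j]] N_adapted[OF assms, of j]
  show ?thesis by measurable
qed

lemma bet_term_integrable:
  assumes "0 \<le> t"
  shows "integrable P (\<lambda>\<omega>. stake j \<omega> * (N j t \<omega> - q))"
proof (rule integrable_const_bound[where B = "(1 / q) ^ Suc j * 1"])
  have "norm (stake j \<omega> * (N j t \<omega> - q)) \<le> (1 / q) ^ Suc j * 1" for \<omega>
    unfolding norm_mult using stake_nonneg[of j \<omega>] stake_le[of j \<omega>] N_bounds[of j t \<omega>] q
    by (intro mult_mono) auto
  then show "AE \<omega> in P. norm (stake j \<omega> * (N j t \<omega> - q)) \<le> (1 / q) ^ Suc j * 1" by simp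
  show "(\<lambda>\<omega>. stake j \<omega> * (N j t \<omega> - q)) \<in> borel_measurable P"
    by (rule measurable_F_P[OF bet_term_measurable[OF assms]])
qed

lemma N_integrable: "0 \<le> t \<Longrightarrow> integrable P (N j t)"
  using martingale_N[of j] unfolding martingale_def by simp

lemma N_cond_exp:
  "0 \<le> s \<Longrightarrow> s \<le> t \<Longrightarrow> AE \<omega> in P. real_cond_exp P (F (ennreal s)) (N j t) \<omega> = N j s \<omega>"
  using martingale_N[of j] unfolding martingale_def by simp

lemma bet_term_cond_exp_late:
  assumes s: "real j * d \<le> s" "s \<le> t"
  shows "AE \<omega> in P. real_cond_exp P (F (ennreal s)) (\<lambda>\<omega>. stake j \<omega> * (N j t \<omega> - q)) \<omega> = stake j \<omega> * (N j s \<omega> - q)"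
proof -
  interpret S: finite_measure_subalgebra P "F (ennreal s)" by (rule finite_measure_subalgebra_F)
  have s0: "0 \<le> s" "0 \<le> t" using s time_nonneg[of j] by linarith+
  have a: "stake j \<in> borel_measurable (F (ennreal s))"
    using measurable_F_mono[OF ennreal_leI[OF s(1)] stake_measurable] .
  have "AE \<omega> in P. real_cond_exp P (F (ennreal s)) (\<lambda>\<omega>. stake j \<omega> * (N j t \<omega> - q)) \<omega> =
      stake j \<omega> * real_cond_exp P (F (ennreal s)) (\<lambda>\<omega>. N j t \<omega> - q) \<omega>"
    by (rule S.real_cond_exp_mult[OF a _ bet_term_integrable[OF s0(2)]])
      (use measurable_F_P[OF N_adapted[OF s0(2), of j]] in simp)
  moreover have "AE \<omega> in P. real_cond_exp P (F (ennreal s)) (\<lambda>\<omega>. N j t \<omega> - q) \<omega> =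
      real_cond_exp P (F (ennreal s)) (N j t) \<omega> - real_cond_exp P (F (ennreal s)) (\<lambda>_. q) \<omega>"
    by (rule S.real_cond_exp_diff) (use N_integrable[OF s0(2)] in auto)
  moreover have "AE \<omega> in P. real_cond_exp P (F (ennreal s)) (\<lambda>_. q) \<omega> = q"
    by (rule S.real_cond_exp_F_meas) auto
  moreover note N_cond_exp[OF s0(1) s(2), of j]
  ultimately show ?thesis by eventually_elim simp
qed

text \<open>Once the bet has begun, the stake is known and factors out. Before that, the tower
  property passes through the starting time of the bet, where the conditional mean is already
  0.\<close>

lemma bet_term_cond_exp:
  assumes s: "0 \<le> s" "s \<le> t"
  shows "AE \<omega> in P. real_cond_exp P (F (ennreal s)) (\<lambda>\<omega>. stake j \<omega> * (N j t \<omega> - q)) \<omega> = stake j \<omega> * (N j s \<omega> - q)"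
proof -
  consider "real j * d \<le> s" | "t \<le> real j * d" | "s < real j * d" "real j * d < t" by linarith
  then show ?thesis
  proof cases
    case 1
    then show ?thesis using s(2) by (rule bet_term_cond_exp_late)
  next
    case 2
    interpret S: finite_measure_subalgebra P "F (ennreal s)" by (rule finite_measure_subalgebra_F)
    have "AE \<omega> in P. real_cond_exp P (F (ennreal s)) (\<lambda>_. 0) \<omega> = 0"
      by (rule S.real_cond_exp_F_meas) auto
    then show ?thesis using 2 s by (simp add: N_before)
  next
    case 3
    let ?G = "F (ennreal (real j * d))"
    interpret S: finite_measure_subalgebra P "F (ennreal s)" by (rule finite_measure_subalgebra_F)
    have "ennreal s \<le> ennreal (real j * d)" using 3 by (intro ennreal_leI) simp
    then have sub: "subalgebra ?G (F (ennreal s))"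
      using sets_F_mono by (auto simp: subalgebra_def space_F)
    have subP: "subalgebra P ?G"
      using sets_F_subset by (auto simp: subalgebra_def space_F)
    let ?X = "\<lambda>\<omega>. stake j \<omega> * (N j t \<omega> - q)"
    have i: "integrable P ?X" using s by (intro bet_term_integrable) simp
    have "AE \<omega> in P. real_cond_exp P (F (ennreal s)) (real_cond_exp P ?G ?X) \<omega> = real_cond_exp P (F (ennreal s)) ?X \<omega>"
      by (rule S.real_cond_exp_nested_subalg[OF subP sub i])
    moreover have "AE \<omega> in P. real_cond_exp P ?G ?X \<omega> = 0"
      using bet_term_cond_exp_late[of j "real j * d" t] 3 by (simp add: N_before)
    then have "AE \<omega> in P. real_cond_exp P (F (ennreal s)) (real_cond_exp P ?G ?X) \<omega> = real_cond_exp P (F (ennreal s)) (\<lambda>_. 0) \<omega>"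
      by (intro S.real_cond_exp_cong) auto
    moreover have "AE \<omega> in P. real_cond_exp P (F (ennreal s)) (\<lambda>_. 0) \<omega> = 0"
      by (rule S.real_cond_exp_F_meas) auto
    ultimately show ?thesis
      by eventually_elim (use 3 in \<open>simp add: N_before\<close>)
  qed
qed

lemma adapted_bet: "adapted F bet"
  unfolding adapted_def bet_def[abs_def] by (intro allI impI borel_measurable_sum bet_term_measurable)

lemma martingale_bet: "martingale P F bet"
  unfolding martingale_def
proof (intro conjI allI impI adapted_bet)
  show "integrable P (bet t)" if "0 \<le> t" for t
    unfolding bet_def[abs_def] by (intro Bochner_Integration.integrable_sum bet_term_integrable that)
  fix s t :: real assume st: "0 \<le> s \<and> s \<le> t"
  interpret S: finite_measure_subalgebra P "F (ennreal s)" by (rule finite_measure_subalgebra_F)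
  have "AE \<omega> in P. real_cond_exp P (F (ennreal s)) (\<lambda>\<omega>. \<Sum>j<J. stake j \<omega> * (N j t \<omega> - q)) \<omega> =
      (\<Sum>j<J. real_cond_exp P (F (ennreal s)) (\<lambda>\<omega>. stake j \<omega> * (N j t \<omega> - q)) \<omega>)"
    by (rule S.real_cond_exp_sum) (use st in \<open>auto intro: bet_term_integrable\<close>)
  moreover have "AE \<omega> in P. \<forall>j\<in>{..<J}. real_cond_exp P (F (ennreal s)) (\<lambda>\<omega>. stake j \<omega> * (N j t \<omega> - q)) \<omega> = stake j \<omega> * (N j s \<omega> - q)"
    by (rule AE_finite_allI) (use st in \<open>auto intro: bet_term_cond_exp\<close>)
  ultimately show "AE \<omega> in P. real_cond_exp P (F (ennreal s)) (bet t) \<omega> = bet s \<omega>"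
    unfolding bet_def[abs_def] by eventually_elim simp
qed

lemma bet_0: "bet 0 \<omega> = 0"
  by (simp add: bet_def N_before time_nonneg)

lemma local_martingale_bet: "local_martingale P F bet"
  unfolding local_martingale_def
proof (intro conjI adapted_bet exI[of _ "\<lambda>_ _. \<infinity>"] allI)
  show "stopping_time F (\<lambda>_. \<infinity>)" by (rule stopping_time_const)
  have "martingale P F (\<lambda>t \<omega>. stopped bet (\<lambda>_. \<infinity>) t \<omega> - bet 0 \<omega>) = martingale P F bet"
    unfolding martingale_def adapted_def by (simp add: stopped_def bet_0)
  then show "martingale P F (\<lambda>t \<omega>. stopped bet (\<lambda>_. \<infinity>) t \<omega> - bet 0 \<omega>)"
    using martingale_bet by simp
qed (simp add: incseq_def)

lemma adapted_wealth: "adapted F wealth"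
  unfolding adapted_def
proof (intro allI impI)
  fix t :: real assume t: "0 \<le> t"
  have "(\<lambda>\<omega>. gain j \<omega> * clamp01 (t / d - real j)) \<in> borel_measurable (F (ennreal t))" for j
  proof (cases "t \<le> real j * d")
    case True
    then show ?thesis by (simp add: clamp01_before)
  next
    case False
    then have "ennreal (real j * d) \<le> ennreal t" by (intro ennreal_leI) simp
    note [measurable] = measurable_F_mono[OF this gain_measurable[of j]]
    show ?thesis by measurable
  qed
  moreover have "bet t \<in> borel_measurable (F (ennreal t))"
    using adapted_bet t by (simp add: adapted_def)
  ultimately show "wealth t \<in> borel_measurable (F (ennreal t))"
    unfolding wealth_def[abs_def] drift_def[abs_def]
    by (intro borel_measurable_add borel_measurable_sum borel_measurable_const)
qed

lemma wealth_le_gronwall: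
  "0 \<le> t \<Longrightarrow> wealth t \<omega> \<le> integral {0..t} (\<lambda>s. running_sup wealth s \<omega>) + bet t \<omega> + 1"
  using drift_le_integral[of t \<omega>] by (simp add: wealth_def)

text \<open>\<open>f\<close> is known when bet \<open>j\<close> starts, and at that moment the
  conditional mean of the toss is the starting value \<open>q\<close> of \<open>N j\<close>.\<close>

lemma integral_toss:
  assumes f: "f \<in> borel_measurable (F (ennreal (real j * d)))" and B: "\<And>\<omega>. \<bar>f \<omega>\<bar> \<le> B"
  shows "(\<integral>\<omega>. f \<omega> * toss j \<omega> \<partial>P) = q * (\<integral>\<omega>. f \<omega> \<partial>P)"
proof -
  interpret S: finite_measure_subalgebra P "F (ennreal (real j * d))" by (rule finite_measure_subalgebra_F)
  have le: "real j * d \<le> real (Suc j) * d" by (rule time_mono) simp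
  have tossN: "toss j = N j (real (Suc j) * d)" by (simp add: toss_def[abs_def] add.commute)
  have tm: "toss j \<in> borel_measurable P" by (rule measurable_F_P[OF toss_measurable])
  have fm: "f \<in> borel_measurable P" by (rule measurable_F_P[OF f])
  have "\<bar>f \<omega> * toss j \<omega>\<bar> \<le> B" for \<omega>
    using mult_mono[of "\<bar>f \<omega>\<bar>" B "\<bar>toss j \<omega>\<bar>" 1] B[of \<omega>] toss_bounds[of j \<omega>] abs_ge_zero[of "f \<omega>"]
    by (simp add: abs_mult)
  then have "integrable P (\<lambda>\<omega>. f \<omega> * toss j \<omega>)"
    using tm fm by (intro integrable_const_bound[where B = B]) auto
  then have "(\<integral>\<omega>. f \<omega> * toss j \<omega> \<partial>P) = (\<integral>\<omega>. f \<omega> * real_cond_exp P (F (ennreal (real j * d))) (toss j) \<omega> \<partial>P)"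
    using S.real_cond_exp_intg(2)[OF _ f tm] by simp
  also have "\<dots> = (\<integral>\<omega>. f \<omega> * q \<partial>P)"
  proof (rule integral_cong_AE)
    have "AE \<omega> in P. real_cond_exp P (F (ennreal (real j * d))) (toss j) \<omega> = q"
      using N_cond_exp[OF time_nonneg le, of j] by (simp add: tossN N_before)
    then show "AE \<omega> in P. f \<omega> * real_cond_exp P (F (ennreal (real j * d))) (toss j) \<omega> = f \<omega> * q"
      by eventually_elim simp
  qed (use fm in measurable)
  finally show ?thesis by (simp add: mult.commute)
qed

end

section \<open>Growth of the running maximum\<close>

text \<open>At \<open>z = 1\<close> both sides agree, and the slope of their difference there is
  \<open>(1 + \<kappa>) * p - \<kappa>\<close>, which is positive precisely because
  \<open>\<kappa> < p / (1 - p)\<close>. Here the critical constant enters. In the application,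
  \<open>z\<close> is the ratio of the new capital to the old maximum.\<close>

lemma powr_linear_lower_bound:
  fixes p \<kappa> :: real
  assumes p: "0 < p" "p < 1" and \<kappa>: "0 < \<kappa>" "\<kappa> < p / (1 - p)"
  shows "\<exists>q. 0 < q \<and> q < 1 \<and> (\<forall>z. 1 \<le> z \<and> z \<le> 1 / q \<longrightarrow> 1 + \<kappa> * z \<le> (1 + \<kappa>) * z powr p)"
proof -
  define r where "r = \<kappa> / ((1 + \<kappa>) * p)"
  have "\<kappa> * (1 - p) < p" using \<kappa> p by (simp add: less_divide_eq)
  then have "\<kappa> < (1 + \<kappa>) * p" by (simp add: algebra_simps)
  then have r: "0 < r" "r < 1" using \<kappa> p by (simp_all add: r_def)
  \<comment> \<open>With this choice the derivative of \<open>f\<close> below vanishes exactly at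
    \<open>1 / q\<close>.\<close>
  define q where "q = r powr (1 / (1 - p))"
  have q: "0 < q" "q < 1"
    using r p powr_less_mono2[of "1 / (1 - p)" r 1] unfolding q_def by auto
  have qr: "q powr (1 - p) = r" using r p by (simp add: q_def powr_powr)
  have "1 + \<kappa> * z \<le> (1 + \<kappa>) * z powr p" if z: "1 \<le> z" "z \<le> 1 / q" for z
  proof -
    define f where "f z = (1 + \<kappa>) * z powr p - \<kappa> * z" for z :: real
    have "f 1 \<le> f z"
    proof (rule DERIV_nonneg_imp_nondecreasing[OF z(1)])
      fix y assume y: "1 \<le> y" "y \<le> z"
      have "(f has_real_derivative (1 + \<kappa>) * (p * y powr (p - 1)) - \<kappa>) (at y)"
        unfolding f_def using y by (auto intro!: derivative_eq_intros)
      moreover have "0 \<le> (1 + \<kappa>) * (p * y powr (p - 1)) - \<kappa>"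
      proof -
        have "y \<le> 1 / q" using y z by simp
        then have "q \<le> 1 / y" using q y by (simp add: field_simps)
        then have "r \<le> (1 / y) powr (1 - p)" unfolding qr[symmetric] using p q by (intro powr_mono2) auto
        also have "\<dots> = y powr (p - 1)" using y by (simp add: powr_divide powr_minus_divide[symmetric])
        finally have "(1 + \<kappa>) * p * r \<le> (1 + \<kappa>) * p * y powr (p - 1)"
          using \<kappa> p by (intro mult_left_mono) auto
        moreover have "(1 + \<kappa>) * p * r = \<kappa>" using \<kappa> p by (simp add: r_def)
        ultimately show ?thesis by (simp add: mult.assoc)
      qed
      ultimately show "\<exists>y'. (f has_real_derivative y') (at y) \<and> 0 \<le> y'" by blast
    qed
    then show ?thesis by (simp add: f_def)
  qed
  then show ?thesis using q by blast
qed

context coin_strategy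
begin

lemma peak_pos: "0 < peak j \<omega>"
  using peak_ge_1[of j \<omega>] by linarith

text \<open>
  While betting, this is a submartingale as long as \<open>\<kappa> < p / (1 - p)\<close> and \<open>q\<close> is close to \<open>1\<close>.
\<close>

definition energy :: "real \<Rightarrow> real \<Rightarrow> nat \<Rightarrow> 'a \<Rightarrow> real" where
  "energy p \<kappa> j \<omega> = peak j \<omega> powr p + \<kappa> * (level j \<omega> * peak j \<omega> powr (p - 1))"

lemma state_measurable_P [measurable]: "peak j \<in> borel_measurable P" "level j \<in> borel_measurable P"
  using state_measurable measurable_F_P by blast+

lemma peak_powr_bounds: "0 \<le> p \<Longrightarrow> \<bar>peak j \<omega> powr p\<bar> \<le> ((1 / q) ^ j) powr p"
  using peak_le[of j \<omega>] peak_pos[of j \<omega>] by (auto intro!: powr_mono2)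

lemma level_powr_bounds: "0 \<le> p \<Longrightarrow> \<bar>level j \<omega> powr p\<bar> \<le> ((1 / q) ^ j) powr p"
  using peak_le[of j \<omega>] level_le_peak[of j \<omega>] level_nonneg[of j \<omega>] by (auto intro!: powr_mono2)

lemma level_peak_powr_bounds:
  assumes "p \<le> 1"
  shows "\<bar>level j \<omega> * peak j \<omega> powr (p - 1)\<bar> \<le> (1 / q) ^ j"
proof -
  have "peak j \<omega> powr (p - 1) \<le> peak j \<omega> powr 0" using assms peak_ge_1[of j \<omega>] by (intro powr_mono) auto
  then have "peak j \<omega> powr (p - 1) \<le> 1" using peak_pos[of j \<omega>] by simp
  then have "level j \<omega> * peak j \<omega> powr (p - 1) \<le> (1 / q) ^ j * 1"
    using peak_le[of j \<omega>] level_le_peak[of j \<omega>] level_nonneg[of j \<omega>] q by (intro mult_mono) auto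
  then show ?thesis using level_nonneg[of j \<omega>] by simp
qed

lemma integrable_peak_powr: "0 \<le> p \<Longrightarrow> integrable P (\<lambda>\<omega>. peak j \<omega> powr p)"
  by (rule integrable_const_bound[where B = "((1 / q) ^ j) powr p"]) (use peak_powr_bounds in auto)

lemma integrable_level_powr: "0 \<le> p \<Longrightarrow> integrable P (\<lambda>\<omega>. level j \<omega> powr p)"
  by (rule integrable_const_bound[where B = "((1 / q) ^ j) powr p"]) (use level_powr_bounds in auto)

lemma integrable_level_peak: "p \<le> 1 \<Longrightarrow> integrable P (\<lambda>\<omega>. level j \<omega> * peak j \<omega> powr (p - 1))"
  by (rule integrable_const_bound[where B = "(1 / q) ^ j"]) (use level_peak_powr_bounds in auto)

lemma integrable_energy: "0 \<le> p \<Longrightarrow> p \<le> 1 \<Longrightarrow> integrable P (energy p \<kappa> j)"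
  unfolding energy_def[abs_def]
  by (intro Bochner_Integration.integrable_add integrable_mult_right integrable_peak_powr integrable_level_peak)

text \<open>Only a won bet whose capital \<open>y\<close> exceeds the old maximum \<open>S\<close>
  is not immediate: then peak and level both become \<open>y = S * z\<close>, and division by
  \<open>S powr p\<close> leaves \<open>key\<close>. The left side is linear in \<open>toss\<close>,
  so its mean is the old mean energy.\<close>

lemma energy_active:
  assumes act: "\<not> waiting j"
    and key: "\<And>z. 1 \<le> z \<Longrightarrow> z \<le> 1 / q \<Longrightarrow> 1 + \<kappa> * z \<le> (1 + \<kappa>) * z powr p"
  shows "peak j \<omega> powr p + \<kappa> / q * (level j \<omega> * peak j \<omega> powr (p - 1)) * toss j \<omega> \<le> energy p \<kappa> (Suc j) \<omega>"
proof -
  let ?S = "peak j \<omega>" and ?x = "level j \<omega>"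
  note S = peak_pos[of j \<omega>]
  show ?thesis
  proof (cases "toss j \<omega> = 0")
    case True
    then show ?thesis using act S by (simp add: energy_def peak_Suc level_Suc)
  next
    case False
    then have t: "toss j \<omega> = 1" using toss_cases[of j \<omega>] by simp
    define y where "y = ?x / q"
    have l: "level (Suc j) \<omega> = y" and k: "peak (Suc j) \<omega> = max ?S y"
      using act by (simp_all add: level_Suc peak_Suc t y_def)
    have lhs: "\<kappa> / q * (?x * ?S powr (p - 1)) * toss j \<omega> = \<kappa> * (y * ?S powr (p - 1))"
      by (simp add: t y_def)
    show ?thesis
    proof (cases "y \<le> ?S")
      case True
      then show ?thesis unfolding lhs by (simp add: energy_def l k max_absorb1)
    next
      case False
      then have y: "?S < y" by simp
      define z where "z = y / ?S"
      have yz: "y = ?S * z" using S by (simp add: z_def)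
      have z1: "1 \<le> z" using y S by (simp add: z_def)
      have "y \<le> ?S / q" unfolding y_def using level_le_peak q by (intro divide_right_mono) auto
      then have z2: "z \<le> 1 / q" using S q by (simp add: z_def field_simps)
      have Sp: "?S * ?S powr (p - 1) = ?S powr p"
        using S by (metis powr_mult_base less_imp_le add.commute diff_add_cancel)
      have yp: "y * y powr (p - 1) = y powr p"
        using S y by (metis powr_mult_base less_imp_le less_trans add.commute diff_add_cancel)
      have "?S powr p + \<kappa> * (y * ?S powr (p - 1)) = ?S powr p * (1 + \<kappa> * z)"
        unfolding yz Sp[symmetric] by (simp add: algebra_simps)
      also have "\<dots> \<le> ?S powr p * ((1 + \<kappa>) * z powr p)"
        by (intro mult_left_mono key z1 z2) simp
      also have "\<dots> = (1 + \<kappa>) * y powr p"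
        unfolding yz using S z1 by (simp add: powr_mult)
      also have "\<dots> = energy p \<kappa> (Suc j) \<omega>"
        using y by (simp add: energy_def l k max_absorb2 yp algebra_simps)
      finally show ?thesis unfolding lhs .
    qed
  qed
qed

lemma integral_energy_active:
  assumes act: "\<not> waiting j" and p: "0 < p" "p < 1"
    and key: "\<And>z. 1 \<le> z \<Longrightarrow> z \<le> 1 / q \<Longrightarrow> 1 + \<kappa> * z \<le> (1 + \<kappa>) * z powr p"
  shows "(\<integral>\<omega>. energy p \<kappa> j \<omega> \<partial>P) \<le> (\<integral>\<omega>. energy p \<kappa> (Suc j) \<omega> \<partial>P)"
proof -
  let ?g = "\<lambda>\<omega>. level j \<omega> * peak j \<omega> powr (p - 1)"
  note [measurable] = state_measurable[of j]
  have g: "?g \<in> borel_measurable (F (ennreal (real j * d)))" by measurable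
  have tm [measurable]: "toss j \<in> borel_measurable P" by (rule measurable_F_P[OF toss_measurable])
  have gt: "integrable P (\<lambda>\<omega>. ?g \<omega> * toss j \<omega>)"
  proof (rule integrable_const_bound[where B = "(1 / q) ^ j * 1"])
    have "norm (?g \<omega> * toss j \<omega>) \<le> (1 / q) ^ j * 1" for \<omega>
      unfolding norm_mult using level_peak_powr_bounds[of p j \<omega>] toss_bounds[of j \<omega>] p q
      by (intro mult_mono) auto
    then show "AE \<omega> in P. norm (?g \<omega> * toss j \<omega>) \<le> (1 / q) ^ j * 1" by simp
  qed measurable
  have i1: "integrable P (\<lambda>\<omega>. peak j \<omega> powr p)" using p by (intro integrable_peak_powr) simp
  have i2: "integrable P (\<lambda>\<omega>. \<kappa> / q * (?g \<omega> * toss j \<omega>))" by (rule integrable_mult_right[OF gt])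
  have i3: "integrable P (\<lambda>\<omega>. \<kappa> * ?g \<omega>)" using p by (intro integrable_mult_right integrable_level_peak) simp
  have "(\<integral>\<omega>. energy p \<kappa> j \<omega> \<partial>P) = (\<integral>\<omega>. peak j \<omega> powr p \<partial>P) + \<kappa> * (\<integral>\<omega>. ?g \<omega> \<partial>P)"
    unfolding energy_def using i1 i3 by simp
  also have "\<dots> = (\<integral>\<omega>. peak j \<omega> powr p \<partial>P) + \<kappa> / q * (\<integral>\<omega>. ?g \<omega> * toss j \<omega> \<partial>P)"
    using integral_toss[OF g level_peak_powr_bounds] p q by simp
  also have "\<dots> = (\<integral>\<omega>. peak j \<omega> powr p + \<kappa> / q * (?g \<omega> * toss j \<omega>) \<partial>P)"
    using i1 i2 by simp
  also have "\<dots> \<le> (\<integral>\<omega>. energy p \<kappa> (Suc j) \<omega> \<partial>P)"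
  proof (rule integral_mono)
    show "integrable P (\<lambda>\<omega>. peak j \<omega> powr p + \<kappa> / q * (?g \<omega> * toss j \<omega>))"
      using i1 i2 by simp
    show "integrable P (energy p \<kappa> (Suc j))" using p by (intro integrable_energy) auto
    show "peak j \<omega> powr p + \<kappa> / q * (?g \<omega> * toss j \<omega>) \<le> energy p \<kappa> (Suc j) \<omega>" for \<omega>
      using energy_active[OF act key, of \<omega>] by (simp add: mult.assoc)
  qed
  finally show ?thesis .
qed

lemma integral_level_powr_active:
  assumes act: "\<not> waiting j" and p: "0 < p" "p < 1"
  shows "(\<integral>\<omega>. level (Suc j) \<omega> powr p \<partial>P) = q powr (1 - p) * (\<integral>\<omega>. level j \<omega> powr p \<partial>P)"
proof -
  note [measurable] = state_measurable[of j]
  have m: "(\<lambda>\<omega>. level j \<omega> powr p) \<in> borel_measurable (F (ennreal (real j * d)))" by measurable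
  have "level (Suc j) \<omega> powr p = (1 / q) powr p * (level j \<omega> powr p * toss j \<omega>)" for \<omega>
    using act toss_cases[of j \<omega>] level_nonneg[of j \<omega>] q p
    by (auto simp: level_Suc powr_divide)
  then have "(\<integral>\<omega>. level (Suc j) \<omega> powr p \<partial>P) = (1 / q) powr p * (q * (\<integral>\<omega>. level j \<omega> powr p \<partial>P))"
    using integral_toss[OF m level_powr_bounds] p by simp
  moreover have "(1 / q) powr p * q = q powr (1 - p)"
    using q by (simp add: powr_diff powr_divide)
  ultimately show ?thesis by (simp add: mult.assoc[symmetric])
qed

text \<open>Waiting raises the mean energy to \<open>1 + \<kappa> * h\<close> times the moment of
  the peak, and betting does not lower it. At the end, \<open>level * peak powr (p - 1)\<close> is
  at most \<open>level powr p\<close>, since \<open>level\<close> is below \<open>peak\<close> and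
  \<open>p < 1\<close>; this leftover is the subtracted term.\<close>

lemma integral_peak_period:
  assumes p: "0 < p" "p < 1" and \<kappa>: "0 < \<kappa>"
    and key: "\<And>z. 1 \<le> z \<Longrightarrow> z \<le> 1 / q \<Longrightarrow> 1 + \<kappa> * z \<le> (1 + \<kappa>) * z powr p"
  defines "h \<equiv> real W * d"
  shows "(1 + \<kappa> * h - \<kappa> * (q powr (1 - p)) ^ m * h powr p) * (\<integral>\<omega>. peak (k * (W + m)) \<omega> powr p \<partial>P)
    \<le> (\<integral>\<omega>. peak (Suc k * (W + m)) \<omega> powr p \<partial>P)"
proof -
  define B where "B = k * (W + m)"
  have h: "0 < h" unfolding h_def using W_pos d_pos by simp
  have Bmod: "(B + i) mod (W + m) = i" if "i < W + m" for i
    using that by (simp add: B_def)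
  \<comment> \<open>At \<open>i = 0\<close> the level is still the remainder of the previous period,
    hence the guard \<open>0 < i\<close>.\<close>
  have wait: "peak (B + i) \<omega> = peak B \<omega> \<and> (0 < i \<longrightarrow> level (B + i) \<omega> = real i * d * peak B \<omega>)" if "i \<le> W" for i \<omega>
    using that
  proof (induction i)
    case (Suc i)
    then have "(B + i) mod (W + m) = i" by (intro Bmod) simp
    then show ?case using Suc by (simp add: peak_Suc level_Suc waiting_def add.commute)
  qed simp
  let ?I = "\<integral>\<omega>. peak B \<omega> powr p \<partial>P"
  have pk: "peak (B + W) = peak B" and lv: "level (B + W) \<omega> = h * peak B \<omega>" for \<omega>
    using wait[of W] W_pos by (auto simp: h_def)
  have "energy p \<kappa> (B + W) \<omega> = (1 + \<kappa> * h) * peak B \<omega> powr p" for \<omega>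
  proof -
    have "peak B \<omega> * peak B \<omega> powr (p - 1) = peak B \<omega> powr p"
      using peak_pos[of B \<omega>] by (metis powr_mult_base less_imp_le add.commute diff_add_cancel)
    then show ?thesis by (simp add: energy_def pk lv algebra_simps)
  qed
  then have e0: "(\<integral>\<omega>. energy p \<kappa> (B + W) \<omega> \<partial>P) = (1 + \<kappa> * h) * ?I" by simp
  have l0: "(\<integral>\<omega>. level (B + W) \<omega> powr p \<partial>P) = h powr p * ?I"
    unfolding lv using h peak_pos less_imp_le by (subst powr_mult) auto
  have active: "\<not> waiting (B + W + i)" if "i < m" for i
    using that Bmod[of "W + i"] by (simp add: waiting_def add.assoc)
  have "i \<le> m \<Longrightarrow> (1 + \<kappa> * h) * ?I \<le> (\<integral>\<omega>. energy p \<kappa> (B + W + i) \<omega> \<partial>P)" for i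
  proof (induction i)
    case (Suc i)
    have "(\<integral>\<omega>. energy p \<kappa> (B + W + i) \<omega> \<partial>P) \<le> (\<integral>\<omega>. energy p \<kappa> (Suc (B + W + i)) \<omega> \<partial>P)"
      using Suc.prems by (intro integral_energy_active active p key) auto
    then show ?case using Suc by simp
  qed (simp add: e0)
  then have e: "(1 + \<kappa> * h) * ?I \<le> (\<integral>\<omega>. energy p \<kappa> (B + W + m) \<omega> \<partial>P)" by simp
  have "i \<le> m \<Longrightarrow> (\<integral>\<omega>. level (B + W + i) \<omega> powr p \<partial>P) = (q powr (1 - p)) ^ i * (h powr p * ?I)" for i
  proof (induction i)
    case (Suc i)
    have "(\<integral>\<omega>. level (Suc (B + W + i)) \<omega> powr p \<partial>P) = q powr (1 - p) * (\<integral>\<omega>. level (B + W + i) \<omega> powr p \<partial>P)"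
      using Suc.prems by (intro integral_level_powr_active active p) auto
    then show ?case using Suc by simp
  qed (simp add: l0)
  then have l: "(\<integral>\<omega>. level (B + W + m) \<omega> powr p \<partial>P) = (q powr (1 - p)) ^ m * (h powr p * ?I)" by simp
  let ?E = "B + W + m"
  have "energy p \<kappa> ?E \<omega> \<le> peak ?E \<omega> powr p + \<kappa> * level ?E \<omega> powr p" for \<omega>
  proof -
    have "level ?E \<omega> * peak ?E \<omega> powr (p - 1) \<le> level ?E \<omega> powr p"
    proof (cases "level ?E \<omega> = 0")
      case False
      then have pos: "0 < level ?E \<omega>" using level_nonneg[of ?E \<omega>] by simp
      have "peak ?E \<omega> powr (p - 1) \<le> level ?E \<omega> powr (p - 1)"
        using pos level_le_peak[of ?E \<omega>] p by (intro powr_mono2') auto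
      then have "level ?E \<omega> * peak ?E \<omega> powr (p - 1) \<le> level ?E \<omega> * level ?E \<omega> powr (p - 1)"
        using pos by (intro mult_left_mono) auto
      also have "\<dots> = level ?E \<omega> powr p"
        using pos by (metis powr_mult_base less_imp_le add.commute diff_add_cancel)
      finally show ?thesis .
    qed simp
    then show ?thesis using \<kappa> by (simp add: energy_def)
  qed
  then have "(\<integral>\<omega>. energy p \<kappa> ?E \<omega> \<partial>P) \<le> (\<integral>\<omega>. peak ?E \<omega> powr p + \<kappa> * level ?E \<omega> powr p \<partial>P)"
    using p by (intro integral_mono integrable_energy Bochner_Integration.integrable_add integrable_mult_right
        integrable_peak_powr integrable_level_powr) auto
  also have "\<dots> = (\<integral>\<omega>. peak ?E \<omega> powr p \<partial>P) + \<kappa> * (\<integral>\<omega>. level ?E \<omega> powr p \<partial>P)"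
    using p integrable_peak_powr[of p ?E] integrable_level_powr[of p ?E] by simp
  finally have "(1 + \<kappa> * h) * ?I - \<kappa> * ((q powr (1 - p)) ^ m * (h powr p * ?I)) \<le> (\<integral>\<omega>. peak ?E \<omega> powr p \<partial>P)"
    using e l by simp
  moreover have "?E = Suc k * (W + m)" by (simp add: B_def)
  ultimately show ?thesis unfolding B_def[symmetric] by (simp add: algebra_simps)
qed

lemma integral_peak_power:
  assumes p: "0 < p" "p < 1" and \<kappa>: "0 < \<kappa>"
    and key: "\<And>z. 1 \<le> z \<Longrightarrow> z \<le> 1 / q \<Longrightarrow> 1 + \<kappa> * z \<le> (1 + \<kappa>) * z powr p"
  defines "\<gamma> \<equiv> 1 + \<kappa> * (real W * d) - \<kappa> * (q powr (1 - p)) ^ m * (real W * d) powr p"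
  assumes \<gamma>: "0 \<le> \<gamma>"
  shows "\<gamma> ^ k \<le> (\<integral>\<omega>. peak (k * (W + m)) \<omega> powr p \<partial>P)"
proof (induction k)
  case 0
  have "prob (space P) = 1" by (rule prob_space)
  then show ?case by simp
next
  case (Suc k)
  have "\<gamma> ^ Suc k \<le> \<gamma> * (\<integral>\<omega>. peak (k * (W + m)) \<omega> powr p \<partial>P)"
    unfolding power_Suc using Suc \<gamma> by (rule mult_left_mono)
  also have "\<dots> \<le> (\<integral>\<omega>. peak (Suc k * (W + m)) \<omega> powr p \<partial>P)"
    unfolding \<gamma>_def by (rule integral_peak_period[OF p \<kappa> key])
  finally show ?case .
qed

end

section \<open>The lower bound for the exponent\<close>

text \<open>A constant factor is invisible to exponential growth; this is how
  \<open>\<alpha>\<close> drops out.\<close>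

lemma le_of_powers_le:
  fixes a b C :: real
  assumes b: "0 < b" and le: "\<And>k. a ^ k \<le> C * b ^ k"
  shows "a \<le> b"
proof (rule ccontr)
  assume "\<not> a \<le> b"
  then have "1 < a / b" using b by simp
  then obtain k where "C < (a / b) ^ k" using real_arch_pow by blast
  then have "C * b ^ k < a ^ k" using b by (simp add: power_divide less_divide_eq)
  with le[of k] show False by simp
qed

lemma le_of_exp_bound:
  fixes \<kappa> c :: real
  assumes c: "0 < c" and le: "\<And>h. 0 < h \<Longrightarrow> h \<le> 1 \<Longrightarrow> 1 + \<kappa> * h \<le> exp (c * h)"
  shows "\<kappa> \<le> c"
proof -
  have "((\<lambda>h. (exp (c * h) - 1) / h) \<longlongrightarrow> c) (at_right 0)"
  proof -
    have "((\<lambda>h. exp (c * h)) has_real_derivative c) (at 0 within {0<..})"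
      by (auto intro!: derivative_eq_intros)
    then show ?thesis unfolding has_field_derivative_iff by simp
  qed
  moreover have "\<forall>\<^sub>F h in at_right 0. \<kappa> \<le> (exp (c * h) - 1) / h"
    unfolding eventually_at_right_field
    by (intro exI[of _ 1]) (use le in \<open>force simp: le_divide_eq\<close>)
  ultimately show ?thesis by (rule tendsto_lowerbound) simp
qed

lemma p_norm_le_iff_moment:
  assumes p: "0 < p" and C: "0 \<le> C" and le: "p_norm P p Y \<le> ennreal C"
  shows "(\<integral>\<^sup>+ \<omega>. ennreal (\<bar>Y \<omega>\<bar> powr p) \<partial>P) \<le> ennreal (C powr p)"
proof -
  define I where "I = (\<integral>\<^sup>+ \<omega>. ennreal (\<bar>Y \<omega>\<bar> powr p) \<partial>P)"
  have fin: "I \<noteq> \<infinity>"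
    using le by (auto simp: p_norm_def I_def[symmetric] Let_def top_unique)
  then have "ennreal (enn2real I powr (1 / p)) \<le> ennreal C"
    using le by (simp add: p_norm_def I_def[symmetric] Let_def)
  then have "enn2real I powr (1 / p) \<le> C" using C by simp
  then have "(enn2real I powr (1 / p)) powr p \<le> C powr p"
    using p by (intro powr_mono2) auto
  then have "enn2real I \<le> C powr p" using p by (simp add: powr_powr)
  then have "ennreal (enn2real I) \<le> ennreal (C powr p)" by (rule ennreal_leI)
  moreover have "ennreal (enn2real I) = I" using fin by (simp add: less_top)
  ultimately show ?thesis unfolding I_def by simp
qed

theorem theorem3p6:
  fixes p \<alpha> \<beta> :: real
  assumes "0 < p" and "p < 1" and "\<alpha> > 0" and "\<beta> > 0"
    and bound: "\<And>(P :: sample measure) (F :: ennreal \<Rightarrow> sample measure) X M H.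
       \<lbrakk> usual_filtered_prob_space P F;
         adapted F X; continuous_process P X;
         \<forall>t\<ge>0. \<forall>\<omega>\<in>space P. 0 \<le> X t \<omega>;
         local_martingale P F M; continuous_process P M;
         \<forall>\<omega>\<in>space P. M 0 \<omega> = 0;
         H > 0;
         \<forall>t\<ge>0. \<forall>\<omega>\<in>space P.
           X t \<omega> \<le> integral {0..t} (\<lambda>s. running_sup X s \<omega>) + M t \<omega> + H \<rbrakk>
       \<Longrightarrow> \<forall>t\<ge>0. p_norm P p (running_sup X t) \<le> ennreal (\<alpha> * H * exp (\<beta> * t))"
  shows "\<beta> \<ge> 1 / (1 - p)"
proof -
  note p = \<open>0 < p\<close> \<open>p < 1\<close>
  \<comment> \<open>One period lasts \<open>h + real m * h / real W\<close>: the waiting time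
    \<open>h\<close> and \<open>m\<close> bets of length \<open>h / W\<close>.\<close>
  have period: "1 + \<kappa> * h - \<kappa> * (q powr (1 - p)) ^ m * h powr p \<le> exp (p * \<beta> * (h + real m * h / real W))"
    if q: "0 < q" "q < 1" and \<kappa>: "0 < \<kappa>"
      and key: "\<And>z. 1 \<le> z \<Longrightarrow> z \<le> 1 / q \<Longrightarrow> 1 + \<kappa> * z \<le> (1 + \<kappa>) * z powr p"
      and h: "0 < h" "h \<le> 1" and W: "0 < W" for q \<kappa> h :: real and m W :: nat
  proof -
    define \<gamma> where "\<gamma> = 1 + \<kappa> * h - \<kappa> * (q powr (1 - p)) ^ m * h powr p"
    define d where "d = h / real W"
    have d: "0 < d" "real W * d = h" using h W by (simp_all add: d_def)
    have per: "real (W + m) * d = h + real m * h / real W"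
      using W by (simp add: d_def field_simps)
    have "\<gamma> \<le> exp (p * \<beta> * (real (W + m) * d))"
    \<comment> \<open>With few bets the leftover term may push \<open>\<gamma>\<close> below 0,
      where powers are not monotone; the claim is then trivial.\<close>
    proof (cases "0 \<le> \<gamma>")
      case False
      then show ?thesis using exp_gt_zero[of "p * \<beta> * (real (W + m) * d)"] by linarith
    next
      case True
      obtain P :: "sample measure" and F N where "coin_blocks P F N q d"
        using exists_coin_blocks[OF q d(1)] by blast
      then have cs: "coin_strategy P F N q d W"
        using W h d by (simp add: coin_strategy_def coin_strategy_axioms_def)
      \<comment> \<open>Each \<open>k\<close> gets its own wealth process, which runs for exactly
        \<open>k\<close> periods with \<open>H = 1\<close>.\<close>
      have "\<gamma> ^ k \<le> \<alpha> powr p * exp (p * \<beta> * (real (W + m) * d)) ^ k" for k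
      proof -
        interpret coin_strategy P F N q d W m "k * (W + m)" by (rule cs)
        define T where "T = real (k * (W + m)) * d"
        have T: "0 \<le> T" unfolding T_def by (rule time_nonneg)
        have usual: "usual_filtered_prob_space P F" ..
        have "\<forall>t\<ge>0. p_norm P p (running_sup wealth t) \<le> ennreal (\<alpha> * 1 * exp (\<beta> * t))"
        proof (rule bound[OF usual adapted_wealth _ _ local_martingale_bet])
          show "continuous_process P wealth" "continuous_process P bet"
            by (auto simp: continuous_process_def intro: continuous_wealth continuous_bet)
          show "\<forall>t\<ge>0. \<forall>\<omega>\<in>space P. 0 \<le> wealth t \<omega>"
            using wealth_ge_1 by (meson order_trans zero_le_one)
        qed (auto simp: bet_0 intro: wealth_le_gronwall)
        then have "p_norm P p (running_sup wealth T) \<le> ennreal (\<alpha> * exp (\<beta> * T))"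
          using T by simp
        then have moment: "(\<integral>\<^sup>+ \<omega>. ennreal (\<bar>running_sup wealth T \<omega>\<bar> powr p) \<partial>P) \<le> ennreal ((\<alpha> * exp (\<beta> * T)) powr p)"
          using p \<open>\<alpha> > 0\<close> by (intro p_norm_le_iff_moment) auto
        have "\<gamma> ^ k \<le> (\<integral>\<omega>. peak (k * (W + m)) \<omega> powr p \<partial>P)"
          using integral_peak_power[OF p \<kappa> key, of k] True unfolding \<gamma>_def d(2) by simp
        then have "ennreal (\<gamma> ^ k) \<le> ennreal (\<integral>\<omega>. peak (k * (W + m)) \<omega> powr p \<partial>P)" by (rule ennreal_leI)
        also have "\<dots> = (\<integral>\<^sup>+ \<omega>. ennreal (peak (k * (W + m)) \<omega> powr p) \<partial>P)"
          using p by (intro nn_integral_eq_integral[symmetric] integrable_peak_powr) auto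
        also have "\<dots> \<le> (\<integral>\<^sup>+ \<omega>. ennreal (\<bar>running_sup wealth T \<omega>\<bar> powr p) \<partial>P)"
        proof (intro nn_integral_mono ennreal_leI)
          fix \<omega>
          have "peak (k * (W + m)) \<omega> \<le> running_sup wealth T \<omega>"
            unfolding T_def by (rule peak_le_running_sup) simp
          then show "peak (k * (W + m)) \<omega> powr p \<le> \<bar>running_sup wealth T \<omega>\<bar> powr p"
            using p peak_pos[of "k * (W + m)" \<omega>] by (intro powr_mono2) auto
        qed
        also note moment
        finally have "\<gamma> ^ k \<le> (\<alpha> * exp (\<beta> * T)) powr p" by simp
        also have "\<dots> = \<alpha> powr p * exp (p * \<beta> * T)"
          using \<open>\<alpha> > 0\<close> by (simp add: powr_mult exp_powr_real mult_ac)
        also have "exp (p * \<beta> * T) = exp (p * \<beta> * (real (W + m) * d)) ^ k"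
          by (simp add: T_def exp_of_nat_mult[symmetric] mult_ac)
        finally show ?thesis .
      qed
      then show ?thesis by (rule le_of_powers_le[rotated]) simp
    qed
    then show ?thesis unfolding \<gamma>_def per .
  qed
  \<comment> \<open>Order of the limits: \<open>\<kappa>\<close> determines \<open>q\<close>; for
    fixed \<open>h\<close> and \<open>m\<close>, letting \<open>W\<close> tend to infinity removes
    the betting time; then \<open>m\<close> tends to infinity and removes the leftover capital; then
    \<open>h\<close> tends to 0 and slopes are compared. Last, \<open>\<kappa>\<close> increases to
    \<open>p / (1 - p)\<close>.\<close>
  have "\<kappa> \<le> p * \<beta>" if \<kappa>: "0 < \<kappa>" "\<kappa> < p / (1 - p)" for \<kappa>
  proof -
    obtain q where q: "0 < q" "q < 1"
      and key: "\<And>z. 1 \<le> z \<Longrightarrow> z \<le> 1 / q \<Longrightarrow> 1 + \<kappa> * z \<le> (1 + \<kappa>) * z powr p"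
      using powr_linear_lower_bound[OF p \<kappa>] by blast
    have "1 + \<kappa> * h \<le> exp (p * \<beta> * h)" if h: "0 < h" "h \<le> 1" for h
    proof -
      have m: "1 + \<kappa> * h - \<kappa> * (q powr (1 - p)) ^ m * h powr p \<le> exp (p * \<beta> * h)" for m
      proof (rule tendsto_lowerbound)
        have "(\<lambda>W. exp (p * \<beta> * (h + real m * h / real W))) \<longlonglongrightarrow> exp (p * \<beta> * (h + 0))"
          by (intro tendsto_intros tendsto_divide_0[OF tendsto_const] filterlim_at_top_imp_at_infinity filterlim_real_sequentially)
        then show "(\<lambda>W. exp (p * \<beta> * (h + real m * h / real W))) \<longlonglongrightarrow> exp (p * \<beta> * h)" by simp
        show "\<forall>\<^sub>F W in sequentially. 1 + \<kappa> * h - \<kappa> * (q powr (1 - p)) ^ m * h powr p \<le> exp (p * \<beta> * (h + real m * h / real W))"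
          using eventually_gt_at_top[of 0] by eventually_elim (rule period[OF q \<kappa>(1) key h])
      qed simp
      have "q powr (1 - p) < 1" using q p powr_less_mono2[of "1 - p" q 1] by simp
      then have "(\<lambda>m. (q powr (1 - p)) ^ m) \<longlonglongrightarrow> 0" by (intro LIMSEQ_power_zero) simp
      then have "(\<lambda>m. 1 + \<kappa> * h - \<kappa> * (q powr (1 - p)) ^ m * h powr p) \<longlonglongrightarrow> 1 + \<kappa> * h - \<kappa> * 0 * h powr p"
        by (intro tendsto_diff tendsto_mult tendsto_const)
      then show ?thesis
        by (intro tendsto_upperbound[of "\<lambda>m. 1 + \<kappa> * h - \<kappa> * (q powr (1 - p)) ^ m * h powr p"]) (use m in auto)
    qed
    moreover have "0 < p * \<beta>" using p \<open>\<beta> > 0\<close> by simp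
    ultimately show ?thesis using le_of_exp_bound by blast
  qed
  moreover have "0 < p / (1 - p)" using p by simp
  ultimately have "p / (1 - p) \<le> p * \<beta>"
    using dense_le_bounded by blast
  then have "p * (1 / (1 - p)) \<le> p * \<beta>" by simp
  then show ?thesis using p by (simp only: mult_le_cancel_left_pos)
qed

end
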